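(* Let $X^{(1)},\dots,X^{(n)}$ be i.i.d. samples from $\mathcal{N}(0,\Sigma)$, where $\Sigma\in\mathbb{R}^{p\times p}$ is invariant under a subgroup $\mathfrak{G}$ of the symmetric group on $\{1,\dots,p\}$ and $\|\Sigma\|\le\psi$ for a constant $\psi$, and let $\hat\Sigma=\mathcal{P}_{\mathfrak{G}}(\Sigma^n)$. Then there are constants $C_1,C_2>0$ (independent of $p$ and $n$) such that for all $t>0$ $$\mathbb{P}\left(\max_{i,j}|\hat\Sigma_{ij}-\Sigma_{ij}|>t\right)\le n_{\mathcal{O}}\max\left\{\exp\left(-C_1n\mathcal{O}t^2\right),\ \exp\left(-C_2n\mathcal{O}_dt\right)\right\}.$$
   Context: For $g\in\mathfrak{G}$, $\Pi_g$ is the permutation matrix of $g$; $\Sigma$ is $\mathfrak{G}$-invariant if $\Pi_g\Sigma\Pi_g^T=\Sigma$ for all $g\in\mathfrak{G}$. $\mathcal{W}_{\mathfrak{G}}\subseteq\mathbb{R}^{p\times p}$ is the subspace of invariant matrices, $\mathcal{P}_{\mathfrak{G}}$ the Euclidean (Frobenius-orthogonal) projection onto it, $\Sigma^n=\frac1n\sum_{k=1}^nX^{(k)}(X^{(k)})^T$. $\|\cdot\|$ is the spectral norm; it is a standing assumption that $\|\Sigma\|\le\psi$ with $\psi$ independent of $p$ and $n$, and "constants" may depend on $\psi$. Orbit parameters: with $V=\{1,\dots,p\}$, $\mathcal{O}(i,j)=\{(g(i),g(j)) : g\in\mathfrak{G}\}$ (unordered pairs, each enumerated once, $i=j$ allowed);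 $\mathcal{V}(i,j)$ is the set of nodes appearing in pairs of $\mathcal{O}(i,j)$; $d_{ij}=\max_{k\in\mathcal{V}(i,j)}\#\{l\in\mathcal{V}(i,j) : (k,l)\in\mathcal{O}(i,j)\}$; $\mathcal{O}=\min_{i,j}|\mathcal{O}(i,j)|$, $\mathcal{O}_d=\min_{i,j}|\mathcal{O}(i,j)|/d_{ij}$, and $n_{\mathcal{O}}$ is the number of distinct edge orbits $\mathcal{O}(i,j)$. *)

theory Defs
  imports "HOL-Probability.Probability" "Jordan_Normal_Form.Matrix" "HOL-Combinatorics.Permutations"
begin

text \<open>The vertex set is \<open>{0..<p}\<close> rather than \<open>{1..p}\<close>, to agree with the index
  range of the entries of a matrix in \<open>carrier_mat p p\<close>.\<close>

definition sym_grp :: "nat \<Rightarrow> (nat \<Rightarrow> nat) monoid" where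
  "sym_grp p = \<lparr>carrier = {g. g permutes {..<p}}, mult = (\<circ>), one = id\<rparr>"

text \<open>The matrix mapping the unit vector \<open>e\<^sub>j\<close> to \<open>e\<close> with index \<open>g j\<close>.\<close>

definition perm_mat :: "nat \<Rightarrow> (nat \<Rightarrow> nat) \<Rightarrow> real mat" where
  "perm_mat p g = mat p p (\<lambda>(i, j). if i = g j then 1 else 0)"

definition invariant_mat :: "nat \<Rightarrow> (nat \<Rightarrow> nat) set \<Rightarrow> real mat \<Rightarrow> bool" where
  "invariant_mat p G A \<longleftrightarrow>
     (\<forall>g\<in>G. perm_mat p g * A * transpose_mat (perm_mat p g) = A)"

definition invariant_subspace :: "nat \<Rightarrow> (nat \<Rightarrow> nat) set \<Rightarrow> real mat set" where
  "invariant_subspace p G = {A \<in> carrier_mat p p. invariant_mat p G A}"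

definition frob_inner :: "nat \<Rightarrow> real mat \<Rightarrow> real mat \<Rightarrow> real" where
  "frob_inner p A B = (\<Sum>i<p. \<Sum>j<p. A $$ (i, j) * B $$ (i, j))"

text \<open>Orthogonal projection onto a linear subspace \<open>W\<close> of the \<open>p \<times> p\<close> matrices;
  the point described is unique because \<open>W\<close> is a subspace.\<close>

definition frob_proj :: "nat \<Rightarrow> real mat set \<Rightarrow> real mat \<Rightarrow> real mat" where
  "frob_proj p W A = (THE B. B \<in> W \<and> (\<forall>C\<in>W. frob_inner p (A - B) C = 0))"

definition spectral_norm :: "nat \<Rightarrow> real mat \<Rightarrow> real" where
  "spectral_norm p A =
     (SUP v \<in> {v \<in> carrier_vec p. sqrt (v \<bullet> v) \<le> 1}. sqrt ((A *\<^sub>v v) \<bullet> (A *\<^sub>v v)))"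

text \<open>The univariate normal law with the given mean and variance; it is a point mass when
  the variance vanishes.\<close>

definition normal_law :: "real \<Rightarrow> real \<Rightarrow> real measure" where
  "normal_law m v =
     (if v = 0 then return borel m else density lborel (normal_density m (sqrt v)))"

text \<open>\<open>X \<sim> N(0, S)\<close>, for a random element \<open>X\<close> of \<open>\<real>\<^sup>p\<close> (realised as a finite product of
  Borel spaces): every linear combination of the coordinates is univariate normal with the
  variance prescribed by \<open>S\<close>. Singular \<open>S\<close> is allowed. Symmetry of \<open>S\<close> is demanded
  separately since the quadratic form only sees the symmetric part.\<close>

definition centered_gaussian ::
    "'a measure \<Rightarrow> nat \<Rightarrow> real mat \<Rightarrow> ('a \<Rightarrow> nat \<Rightarrow> real) \<Rightarrow> bool" where
  "centered_gaussian M p S X \<longleftrightarrow>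
     S \<in> carrier_mat p p \<and> transpose_mat S = S \<and>
     (\<forall>a \<in> carrier_vec p. 0 \<le> a \<bullet> (S *\<^sub>v a)) \<and>
     X \<in> measurable M (PiM {..<p} (\<lambda>_. borel)) \<and>
     (\<forall>a \<in> carrier_vec p.
        distr M borel (\<lambda>\<omega>. \<Sum>i<p. a $ i * X \<omega> i) = normal_law 0 (a \<bullet> (S *\<^sub>v a)))"

definition iid_gaussian_samples ::
    "'a measure \<Rightarrow> nat \<Rightarrow> nat \<Rightarrow> real mat \<Rightarrow> (nat \<Rightarrow> 'a \<Rightarrow> nat \<Rightarrow> real) \<Rightarrow> bool" where
  "iid_gaussian_samples M p n S X \<longleftrightarrow>
     prob_space M \<and>
     prob_space.indep_vars M (\<lambda>_. PiM {..<p} (\<lambda>_. borel)) X {1..n} \<and>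
     (\<forall>k\<in>{1..n}. centered_gaussian M p S (X k))"

definition sample_cov :: "nat \<Rightarrow> nat \<Rightarrow> (nat \<Rightarrow> nat \<Rightarrow> real) \<Rightarrow> real mat" where
  "sample_cov p n x = mat p p (\<lambda>(i, j). (1 / real n) * (\<Sum>k=1..n. x k i * x k j))"

text \<open>The unordered pair of \<open>i\<close> and \<open>j\<close> is the set \<open>{i, j}\<close>, a singleton if \<open>i = j\<close>.\<close>

definition edge_orbit :: "(nat \<Rightarrow> nat) set \<Rightarrow> nat \<Rightarrow> nat \<Rightarrow> nat set set" where
  "edge_orbit G i j = (\<lambda>g. {g i, g j}) ` G"

definition orbit_nodes :: "(nat \<Rightarrow> nat) set \<Rightarrow> nat \<Rightarrow> nat \<Rightarrow> nat set" where
  "orbit_nodes G i j = \<Union> (edge_orbit G i j)"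

definition orbit_degree :: "(nat \<Rightarrow> nat) set \<Rightarrow> nat \<Rightarrow> nat \<Rightarrow> nat" where
  "orbit_degree G i j =
     Max ((\<lambda>k. card {l \<in> orbit_nodes G i j. {k, l} \<in> edge_orbit G i j}) ` orbit_nodes G i j)"

definition min_orbit :: "nat \<Rightarrow> (nat \<Rightarrow> nat) set \<Rightarrow> nat" where
  "min_orbit p G = Min {card (edge_orbit G i j) | i j. i < p \<and> j < p}"

definition min_orbit_deg :: "nat \<Rightarrow> (nat \<Rightarrow> nat) set \<Rightarrow> real" where
  "min_orbit_deg p G =
     Min {real (card (edge_orbit G i j)) / real (orbit_degree G i j) | i j. i < p \<and> j < p}"

definition num_orbits :: "nat \<Rightarrow> (nat \<Rightarrow> nat) set \<Rightarrow> nat" where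
  "num_orbits p G = card {edge_orbit G i j | i j. i < p \<and> j < p}"

definition max_abs_entry :: "nat \<Rightarrow> real mat \<Rightarrow> real" where
  "max_abs_entry p A = Max {\<bar>A $$ (i, j)\<bar> | i j. i < p \<and> j < p}"

end

theory Submission
  imports Defs "HOL-Real_Asymp.Real_Asymp"
begin

text \<open>An entry of the projected sample covariance \<open>P\<^sub>G(\<Sigma>\<^sup>n)\<close> is a sample mean of quadratic forms:
\<open>P\<^sub>G\<close> replaces the entry \<open>(i, j)\<close> by its average over the orbit of \<open>(i, j)\<close>, so the entry equals
\<open>1/n \<Sum>\<^sub>k x\<^sub>k \<bullet> A x\<^sub>k\<close>, where \<open>A\<close> spreads total mass one over the edge orbit \<open>O(i, j)\<close>, and its
expectation is the trace of \<open>A \<Sigma>\<close>, which is \<open>\<Sigma>\<^sub>i\<^sub>j\<close> by invariance. By the orbit-stabiliser theorem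
no entry of \<open>A\<close> exceeds \<open>1/|O(i, j)|\<close>. Hence the squared Frobenius norm of \<open>A\<close> is at most
\<open>1/|O(i, j)|\<close>, and Schur's test bounds its operator norm by the row sum \<open>d\<^sub>i\<^sub>j/|O(i, j)|\<close>. These two
numbers are what a Hanson-Wright inequality turns into a subgaussian rate \<open>n |O(i, j)| t\<^sup>2\<close> and a
subexponential rate \<open>n |O(i, j)| t / d\<^sub>i\<^sub>j\<close>. A union bound over the edge orbits gives the theorem up to
a factor 2.

The Hanson-Wright inequality is obtained without diagonalising anything. Write
\<open>F(A) = E exp(x \<bullet> A x)\<close> for a Gaussian vector \<open>x\<close> with covariance \<open>S\<close>. With an independent copy \<open>y\<close>,
the difference \<open>x \<bullet> A x - y \<bullet> A y\<close> equals \<open>2 u \<bullet> A v\<close> for \<open>u = (x - y)/\<surd>2\<close> and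
\<open>v = (x + y)/\<surd>2\<close>, and \<open>(u, v)\<close> has the law of \<open>(x, y)\<close>. Integrating over \<open>v\<close> first yields the exact
identity \<open>F(A) F(-A) = F(2ASA)\<close>. As \<open>F(-A) \<ge> exp(- tr(AS))\<close> by Jensen's inequality,
\<open>F(A) \<le> exp(tr(AS)) F(2ASA)\<close>. The map from \<open>A\<close> to \<open>2ASA\<close> squares the small quantity
\<open>2 \<parallel>S\<parallel> \<parallel>A\<parallel>\<close>, so iterating it drives the remaining factor to 1, while the traces that are picked up after
the first step sum geometrically to a multiple of \<open>\<parallel>S\<parallel>\<^sup>2 \<parallel>A\<parallel>\<^sub>F\<^sup>2\<close>. That \<open>(u, v)\<close> and \<open>(x, y)\<close> have
the same law has to be derived from linear functionals alone, since normality of a vector means normality of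
its linear functionals; this is the uniqueness theorem for joint characteristic functions, which is
reduced to Levy's theorem on the line one coordinate at a time.

The factor 2 of the two-sided bound has to be absorbed into the constants, although for small \<open>t\<close> the claimed
bound tends to the number of orbits itself. If \<open>p \<ge> 2\<close>, there are at least two edge orbits, because
the orbits of a loop and of a proper edge differ; the claim is then trivial unless the exponential is below 1/2, and
there a change of constants beats the factor. For \<open>p = 1\<close> there is a single orbit, and a lower bound on the
probability of a small deviation is indispensable: a chi-square variable \<open>T\<close> with \<open>n\<close> degrees of freedom satisfies
\<open>P(|T - n| \<le> w \<surd>n) \<ge> c w\<close> for \<open>w \<le> 1\<close>. It follows by comparing the laws of \<open>exp(\<theta>) T\<close>
over all \<open>\<theta>\<close> of order \<open>1/\<surd>n\<close>: their densities are comparable near \<open>n\<close>, and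
one of these rescalings carries a typical value of \<open>T\<close> to the given window.\<close>

section \<open>The univariate normal law\<close>

text \<open>The degenerate case \<open>v = 0\<close> of the normal law is covered by the same formula, so the computations of moments
need no case distinction.\<close>

lemma normal_law_eq_distr:
  assumes "v \<ge> 0"
  shows "normal_law 0 v = distr std_normal_distribution borel (\<lambda>z. sqrt v * z)"
proof (cases "v = 0")
  case True
  interpret prob_space std_normal_distribution
    by (rule prob_space_normal_density) simp
  have "distr std_normal_distribution borel (\<lambda>z. 0 :: real) = return borel 0"
    by (intro distr_const) auto
  then show ?thesis using True by (simp add: normal_law_def)
next
  case False
  then have v: "sqrt v > 0" using assms by simp
  interpret prob_space std_normal_distribution
    by (rule prob_space_normal_density) simp
  have "distributed std_normal_distribution lborel (\<lambda>z. z) std_normal_density"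
    by (simp add: distributed_def distr_id2)
  from normal_density_affine[OF this, of "sqrt v" 0] v
  have "distributed std_normal_distribution lborel (\<lambda>z. sqrt v * z) (normal_density 0 (sqrt v))"
    by simp
  then have "distr std_normal_distribution lborel (\<lambda>z. sqrt v * z) = density lborel (normal_density 0 (sqrt v))"
    by (simp add: distributed_def)
  moreover have "distr std_normal_distribution lborel (\<lambda>z. sqrt v * z) = distr std_normal_distribution borel (\<lambda>z. sqrt v * z)"
    by (intro distr_cong) auto
  ultimately show ?thesis using False by (simp add: normal_law_def)
qed

text \<open>Completing the square turns the integrand into a multiple of the normal density with variance \<open>1 / (1 - 2c)\<close>.\<close>

lemma nn_integral_std_normal_exp_quadratic:
  assumes "c < 1/2"
  shows "(\<integral>\<^sup>+z. ennreal (exp (s * z + c * z\<^sup>2)) \<partial>std_normal_distribution)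
         = ennreal (exp (s\<^sup>2 / (2 * (1 - 2 * c))) / sqrt (1 - 2 * c))"
proof -
  define r where "r = 1 - 2 * c"
  have r: "r > 0" using assms by (simp add: r_def)
  define \<sigma> where "\<sigma> = 1 / sqrt r"
  have \<sigma>: "\<sigma> > 0" "\<sigma>\<^sup>2 = 1 / r" using r by (auto simp: \<sigma>_def power_divide)
  have eq: "std_normal_density z * exp (s * z + c * z\<^sup>2)
      = (exp (s\<^sup>2 / (2 * r)) / sqrt r) * normal_density (s / r) \<sigma> z" for z
  proof -
    have e: "- z\<^sup>2 / 2 + (s * z + c * z\<^sup>2) = s\<^sup>2 / (2 * r) + (- (z - s / r)\<^sup>2 / (2 * \<sigma>\<^sup>2))"
    proof -
      have "c = (1 - r) / 2" by (simp add: r_def)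
      show ?thesis unfolding \<open>c = (1 - r) / 2\<close> \<sigma>(2) using r by (simp add: field_simps power2_eq_square)
    qed
    have "std_normal_density z * exp (s * z + c * z\<^sup>2)
        = (1 / sqrt (2 * pi)) * exp (- z\<^sup>2 / 2 + (s * z + c * z\<^sup>2))"
      by (simp only: std_normal_density_def exp_add mult.assoc)
    also have "\<dots> = (1 / sqrt (2 * pi)) * (exp (s\<^sup>2 / (2 * r)) * exp (- (z - s / r)\<^sup>2 / (2 * \<sigma>\<^sup>2)))"
      by (simp only: e exp_add)
    also have "\<dots> = (exp (s\<^sup>2 / (2 * r)) / sqrt r) * normal_density (s / r) \<sigma> z"
      using r unfolding normal_density_def \<sigma>(2) by (simp add: real_sqrt_divide field_simps real_sqrt_mult)
    finally show ?thesis .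
  qed
  have "(\<integral>\<^sup>+z. ennreal (exp (s * z + c * z\<^sup>2)) \<partial>std_normal_distribution)
      = (\<integral>\<^sup>+z. ennreal (std_normal_density z * exp (s * z + c * z\<^sup>2)) \<partial>lborel)"
    by (subst nn_integral_density) (auto simp: ennreal_mult)
  also have "\<dots> = (\<integral>\<^sup>+z. ennreal (exp (s\<^sup>2 / (2 * r)) / sqrt r) * ennreal (normal_density (s / r) \<sigma> z) \<partial>lborel)"
    unfolding eq using r by (intro nn_integral_cong) (simp add: ennreal_mult'[symmetric])
  also have "\<dots> = ennreal (exp (s\<^sup>2 / (2 * r)) / sqrt r) * (\<integral>\<^sup>+z. ennreal (normal_density (s / r) \<sigma> z) \<partial>lborel)"
    by (subst nn_integral_cmult) auto
  also have "(\<integral>\<^sup>+z. ennreal (normal_density (s / r) \<sigma> z) \<partial>lborel) = 1"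
    using \<sigma> by (subst nn_integral_eq_integral) auto
  finally show ?thesis by (simp add: r_def)
qed

context
  fixes N :: "'a measure" and Z :: "'a \<Rightarrow> real" and v :: real
  assumes N: "distr N borel Z = normal_law 0 v" and v: "v \<ge> 0" and [measurable]: "Z \<in> borel_measurable N"
begin

lemma nn_integral_normal_transfer:
  assumes [measurable]: "f \<in> borel_measurable borel"
  shows "(\<integral>\<^sup>+x. f (Z x) \<partial>N) = (\<integral>\<^sup>+z. f (sqrt v * z) \<partial>std_normal_distribution)"
proof -
  have "(\<integral>\<^sup>+x. f (Z x) \<partial>N) = (\<integral>\<^sup>+x. f x \<partial>distr N borel Z)"
    by (subst nn_integral_distr) auto
  also have "\<dots> = (\<integral>\<^sup>+z. f (sqrt v * z) \<partial>std_normal_distribution)"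
    unfolding N normal_law_eq_distr[OF v] by (subst nn_integral_distr) auto
  finally show ?thesis .
qed

lemma normal_exp_quadratic:
  assumes "2 * c * v < 1"
  shows "(\<integral>\<^sup>+x. ennreal (exp (c * (Z x)\<^sup>2)) \<partial>N) = ennreal (1 / sqrt (1 - 2 * c * v))"
proof -
  have "(\<integral>\<^sup>+x. ennreal (exp (c * (Z x)\<^sup>2)) \<partial>N)
      = (\<integral>\<^sup>+z. ennreal (exp (0 * z + (c * v) * z\<^sup>2)) \<partial>std_normal_distribution)"
    using v by (subst nn_integral_normal_transfer[of "\<lambda>z. ennreal (exp (c * z\<^sup>2))"])
      (auto simp: power_mult_distrib mult_ac)
  also have "\<dots> = ennreal (1 / sqrt (1 - 2 * c * v))"
    using assms by (subst nn_integral_std_normal_exp_quadratic) (auto simp: mult_ac)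
  finally show ?thesis .
qed

lemma normal_mgf: "(\<integral>\<^sup>+x. ennreal (exp (Z x)) \<partial>N) = ennreal (exp (v / 2))"
proof -
  have "(\<integral>\<^sup>+x. ennreal (exp (Z x)) \<partial>N)
      = (\<integral>\<^sup>+z. ennreal (exp (sqrt v * z + 0 * z\<^sup>2)) \<partial>std_normal_distribution)"
    by (subst nn_integral_normal_transfer[of "\<lambda>z. ennreal (exp z)"]) auto
  also have "\<dots> = ennreal (exp (v / 2))"
    using v by (subst nn_integral_std_normal_exp_quadratic) auto
  finally show ?thesis .
qed

lemma normal_cf: "(\<integral>x. iexp (Z x) \<partial>N) = complex_of_real (exp (- v / 2))"
proof -
  have "(\<integral>x. iexp (Z x) \<partial>N) = (\<integral>x. iexp x \<partial>distr N borel Z)"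
    by (subst integral_distr) auto
  also have "\<dots> = (\<integral>z. iexp (sqrt v * z) \<partial>std_normal_distribution)"
    unfolding N normal_law_eq_distr[OF v] by (subst integral_distr) auto
  also have "\<dots> = char std_normal_distribution (sqrt v)"
    by (simp add: char_def)
  also have "\<dots> = complex_of_real (exp (- v / 2))"
    using v by (simp add: char_std_normal_distribution)
  finally show ?thesis .
qed

lemma normal_second_moment:
  shows "integrable N (\<lambda>x. (Z x)\<^sup>2)" and "(\<integral>x. (Z x)\<^sup>2 \<partial>N) = v"
proof -
  have i: "integrable std_normal_distribution (\<lambda>z. (sqrt v * z)\<^sup>2)"
    using integrable_std_normal_distribution_moment[of 2] by (simp add: power_mult_distrib)
  then have "integrable (distr N borel Z) (\<lambda>z. z\<^sup>2)"
    unfolding N normal_law_eq_distr[OF v] by (subst integrable_distr_eq) auto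
  then show "integrable N (\<lambda>x. (Z x)\<^sup>2)"
    by (subst (asm) integrable_distr_eq) auto
  have "(\<integral>x. (Z x)\<^sup>2 \<partial>N) = (\<integral>x. x\<^sup>2 \<partial>distr N borel Z)"
    by (subst integral_distr) auto
  also have "\<dots> = (\<integral>z. (sqrt v * z)\<^sup>2 \<partial>std_normal_distribution)"
    unfolding N normal_law_eq_distr[OF v] by (subst integral_distr) auto
  also have "\<dots> = v"
    using v std_normal_distribution_even_moments(1)[of 1] by (simp add: power_mult_distrib)
  finally show "(\<integral>x. (Z x)\<^sup>2 \<partial>N) = v" .
qed

end

section \<open>Joint laws are determined by characteristic functions\<close>

text \<open>Levy's uniqueness theorem for the images of the finite measures with densities \<open>w\<close> and \<open>w'\<close>. The
weights are what allows an induction over coordinates: they carry the coordinates that are already settled.\<close>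

lemma weighted_Levy_uniqueness:
  fixes w Y :: "'a \<Rightarrow> real" and w' Y' :: "'b \<Rightarrow> real"
  assumes w: "integrable M w" "\<And>x. 0 \<le> w x" and [measurable]: "Y \<in> borel_measurable M"
    and w': "integrable N w'" "\<And>x. 0 \<le> w' x" and [measurable]: "Y' \<in> borel_measurable N"
    and eq: "\<And>s. (\<integral>x. w x *\<^sub>R iexp (s * Y x) \<partial>M) = (\<integral>x. w' x *\<^sub>R iexp (s * Y' x) \<partial>N)"
    and B: "B \<in> sets borel"
  shows "(\<integral>x. w x * indicator B (Y x) \<partial>M) = (\<integral>x. w' x * indicator B (Y' x) \<partial>N)"
proof -
  define m where "m = (\<integral>x. w x \<partial>M)"
  have [measurable]: "w \<in> borel_measurable M" "w' \<in> borel_measurable N"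
    using w w' by auto
  have m': "m = (\<integral>x. w' x \<partial>N)"
    using eq[of 0] w w' by (simp add: m_def scaleR_conv_of_real)
  show ?thesis
  proof (cases "m = 0")
    case True
    have 1: "AE x in M. w x = 0"
      using True w by (simp add: m_def integral_nonneg_eq_0_iff_AE)
    have 2: "AE x in N. w' x = 0"
      using True w' unfolding m' by (simp add: integral_nonneg_eq_0_iff_AE)
    have "(\<integral>x. w x * indicator B (Y x) \<partial>M) = (\<integral>x. 0 \<partial>M)"
      using 1 B by (intro integral_cong_AE) auto
    moreover have "(\<integral>x. w' x * indicator B (Y' x) \<partial>N) = (\<integral>x. 0 \<partial>N)"
      using 2 B by (intro integral_cong_AE) auto
    ultimately show ?thesis by simp
  next
    case False
    have "m \<ge> 0" unfolding m_def using w by (intro Bochner_Integration.integral_nonneg) auto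
    with False have m: "m > 0" by simp
    define P where "P = distr (density M (\<lambda>x. ennreal (w x / m))) borel Y"
    define Q where "Q = distr (density N (\<lambda>x. ennreal (w' x / m))) borel Y'"
    have "emeasure (density M (\<lambda>x. ennreal (w x / m))) (space M) = 1"
      using m w by (simp add: emeasure_density nn_integral_eq_integral m_def[symmetric] cong: nn_integral_cong)
    then have "prob_space (density M (\<lambda>x. ennreal (w x / m)))"
      by (intro prob_spaceI) simp
    then have "prob_space P" unfolding P_def by (intro prob_space.prob_space_distr) auto
    then have P: "real_distribution P"
      by (simp add: real_distribution_def real_distribution_axioms_def P_def)
    have "emeasure (density N (\<lambda>x. ennreal (w' x / m))) (space N) = 1"
      using m w' by (simp add: emeasure_density nn_integral_eq_integral m'[symmetric] cong: nn_integral_cong)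
    then have "prob_space (density N (\<lambda>x. ennreal (w' x / m)))"
      by (intro prob_spaceI) simp
    then have "prob_space Q" unfolding Q_def by (intro prob_space.prob_space_distr) auto
    then have Q: "real_distribution Q"
      by (simp add: real_distribution_def real_distribution_axioms_def Q_def)
    have cP: "char P s = (1 / m) *\<^sub>R (\<integral>x. w x *\<^sub>R iexp (s * Y x) \<partial>M)" for s
    proof -
      have "char P s = (\<integral>x. (w x / m) *\<^sub>R iexp (s * Y x) \<partial>M)"
        using w(2) m unfolding char_def P_def by (simp add: integral_distr integral_density)
      also have "\<dots> = (\<integral>x. (1 / m) *\<^sub>R (w x *\<^sub>R iexp (s * Y x)) \<partial>M)"
        by (intro Bochner_Integration.integral_cong) auto
      finally show ?thesis by (simp only: integral_scaleR_right)
    qed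
    have cQ: "char Q s = (1 / m) *\<^sub>R (\<integral>x. w' x *\<^sub>R iexp (s * Y' x) \<partial>N)" for s
    proof -
      have "char Q s = (\<integral>x. (w' x / m) *\<^sub>R iexp (s * Y' x) \<partial>N)"
        using w'(2) m unfolding char_def Q_def by (simp add: integral_distr integral_density)
      also have "\<dots> = (\<integral>x. (1 / m) *\<^sub>R (w' x *\<^sub>R iexp (s * Y' x)) \<partial>N)"
        by (intro Bochner_Integration.integral_cong) auto
      finally show ?thesis by (simp only: integral_scaleR_right)
    qed
    have "P = Q"
      using P Q by (rule Levy_uniqueness) (intro ext, simp only: cP cQ eq)
    then have "(\<integral>x. indicator B x \<partial>P) = (\<integral>x. (indicator B x :: real) \<partial>Q)" by (rule arg_cong)
    moreover have "(\<integral>x. indicator B x \<partial>P) = (\<integral>x. w x * indicator B (Y x) \<partial>M) / m"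
      using w(2) m B unfolding P_def
      by (subst integral_distr) (auto simp: integral_density simp del: integral_indicator)
    moreover have "(\<integral>x. indicator B x \<partial>Q) = (\<integral>x. w' x * indicator B (Y' x) \<partial>N) / m"
      using w'(2) m B unfolding Q_def
      by (subst integral_distr) (auto simp: integral_density simp del: integral_indicator)
    ultimately show ?thesis using m by simp
  qed
qed

text \<open>The coordinates are moved one at a time from the exponent, where they are tested by characters, to a
product of indicators, where they are tested by Borel sets. To move the coordinate \<open>k\<close>, the one-dimensional theorem is
applied to \<open>Y\<^sub>k\<close> with the remaining exponential as a weight. That weight is complex, but its real
and imaginary parts can be read off from the nonnegative weights \<open>1 + cos(T - \<phi>)\<close> with \<open>\<phi> = 0\<close>
and \<open>\<phi> = \<pi>/2\<close>, whose characteristic functions are combinations of the known ones with \<open>T\<close> multiplied by 1, 0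
and -1.\<close>

theorem joint_distribution_eqI_cf:
  fixes Y :: "'j \<Rightarrow> 'a \<Rightarrow> real" and Y' :: "'j \<Rightarrow> 'b \<Rightarrow> real"
  assumes M: "prob_space M" and N: "prob_space N" and J: "finite J"
    and Y[measurable]: "\<And>j. j \<in> J \<Longrightarrow> Y j \<in> borel_measurable M"
    and Y'[measurable]: "\<And>j. j \<in> J \<Longrightarrow> Y' j \<in> borel_measurable N"
    and eq: "\<And>b :: 'j \<Rightarrow> real. (\<integral>x. iexp (\<Sum>j\<in>J. b j * Y j x) \<partial>M) = (\<integral>x. iexp (\<Sum>j\<in>J. b j * Y' j x) \<partial>N)"
  shows "distr M (PiM J (\<lambda>_. borel)) (\<lambda>x. \<lambda>j\<in>J. Y j x) = distr N (PiM J (\<lambda>_. borel)) (\<lambda>x. \<lambda>j\<in>J. Y' j x)"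
proof -
  interpret M: prob_space M by fact
  interpret N: prob_space N by fact
  define W :: "('j \<Rightarrow> real set) \<Rightarrow> 'j set \<Rightarrow> ('j \<Rightarrow> real) \<Rightarrow> real"
    where "W B D y = (\<Prod>j\<in>D. indicator (B j) (y j))" for B D y
  have W01: "0 \<le> W B D y" "W B D y \<le> 1" for B D y
    unfolding W_def by (auto intro!: prod_nonneg prod_le_1)
  have main: "(\<integral>x. W B D (\<lambda>j. Y j x) *\<^sub>R iexp (\<Sum>j\<in>J - D. b j * Y j x) \<partial>M)
      = (\<integral>x. W B D (\<lambda>j. Y' j x) *\<^sub>R iexp (\<Sum>j\<in>J - D. b j * Y' j x) \<partial>N)"
    if "finite D" "D \<subseteq> J" "\<And>j. B j \<in> sets borel" for B D and b :: "'j \<Rightarrow> real"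
    using that
  proof (induction D arbitrary: b rule: finite_induct)
    case empty
    then show ?case using eq[of b] by (simp add: W_def)
  next
    case (insert k D)
    have k: "k \<in> J" "k \<notin> D" and D: "D \<subseteq> J" "finite D" using insert by auto
    have B[measurable]: "\<And>j. B j \<in> sets borel" using insert by auto
    define R where "R = J - insert k D"
    have R: "finite R" "R \<subseteq> J" "k \<notin> R" "J - D = insert k R" using J k by (auto simp: R_def)
    define wM where "wM x = W B D (\<lambda>j. Y j x)" for x
    define wN where "wN x = W B D (\<lambda>j. Y' j x)" for x
    define T where "T x = (\<Sum>j\<in>R. b j * Y j x)" for x
    define T' where "T' x = (\<Sum>j\<in>R. b j * Y' j x)" for x
    have [measurable]: "wM \<in> borel_measurable M"
      unfolding wM_def W_def using D by (intro borel_measurable_prod) (auto intro!: borel_measurable_indicator' measurable_sets)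
    have [measurable]: "wN \<in> borel_measurable N"
      unfolding wN_def W_def using D by (intro borel_measurable_prod) auto
    have [measurable]: "T \<in> borel_measurable M" "T' \<in> borel_measurable N" "Y k \<in> borel_measurable M" "Y' k \<in> borel_measurable N"
      unfolding T_def T'_def using R k by (auto intro!: borel_measurable_sum borel_measurable_times)
    have w01: "0 \<le> wM x" "wM x \<le> 1" "0 \<le> wN y" "wN y \<le> 1" for x y
      using W01 by (auto simp: wM_def wN_def)
    have IH: "(\<integral>x. wM x *\<^sub>R iexp (c * T x + s * Y k x) \<partial>M) = (\<integral>x. wN x *\<^sub>R iexp (c * T' x + s * Y' k x) \<partial>N)" for c s
    proof -
      have "(\<Sum>j\<in>J - D. (if j = k then s else c * b j) * Y j x) = c * T x + s * Y k x" for x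
      proof -
        have "(\<Sum>j\<in>R. (if j = k then s else c * b j) * Y j x) = c * T x"
          unfolding T_def sum_distrib_left using R by (intro sum.cong) auto
        then show ?thesis using R by simp
      qed
      moreover have "(\<Sum>j\<in>J - D. (if j = k then s else c * b j) * Y' j x) = c * T' x + s * Y' k x" for x
      proof -
        have "(\<Sum>j\<in>R. (if j = k then s else c * b j) * Y' j x) = c * T' x"
          unfolding T'_def sum_distrib_left using R by (intro sum.cong) auto
        then show ?thesis using R by simp
      qed
      ultimately show ?thesis
        using insert.IH[OF D(1) B, of "\<lambda>j. if j = k then s else c * b j"] by (simp add: wM_def wN_def)
    qed
    have iM: "integrable M (\<lambda>x. wM x *\<^sub>R iexp (g x))" if [measurable]: "g \<in> borel_measurable M" for g :: "'a \<Rightarrow> real"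
      by (rule M.integrable_const_bound[of _ 1]) (auto simp: w01)
    have iN: "integrable N (\<lambda>x. wN x *\<^sub>R iexp (g x))" if [measurable]: "g \<in> borel_measurable N" for g :: "'b \<Rightarrow> real"
      by (rule N.integrable_const_bound[of _ 1]) (auto simp: w01)
    have split: "(u * (1 + cos (t - \<phi>))) *\<^sub>R iexp r
        = u *\<^sub>R iexp (0 * t + r) + (iexp (- \<phi>) / 2) * (u *\<^sub>R iexp (1 * t + r)) + (iexp \<phi> / 2) * (u *\<^sub>R iexp ((-1) * t + r))"
      for u t \<phi> r :: real
    proof -
      have "complex_of_real (cos (t - \<phi>)) = (iexp (t - \<phi>) + iexp (\<phi> - t)) / 2"
        by (simp add: cos_of_real[symmetric] cos_exp_eq right_diff_distrib)
      also have "iexp (t - \<phi>) = iexp (- \<phi>) * iexp t"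
        by (simp add: exp_add[symmetric] algebra_simps)
      also have "iexp (\<phi> - t) = iexp \<phi> * iexp (- t)"
        by (simp add: exp_add[symmetric] algebra_simps)
      finally have c: "complex_of_real (cos (t - \<phi>)) = (iexp (- \<phi>) * iexp t + iexp \<phi> * iexp (- t)) / 2" .
      have e: "iexp (1 * t + r) = iexp t * iexp r" "iexp ((-1) * t + r) = iexp (- t) * iexp r" "iexp (0 * t + r) = iexp r"
        by (simp_all add: exp_add[symmetric] algebra_simps)
      show ?thesis
        unfolding e unfolding scaleR_conv_of_real of_real_mult of_real_add c by (simp add: field_simps)
    qed
    have b0: "0 \<le> 1 + cos a" for a :: real
      using cos_ge_minus_one[of a] by linarith
    have b2: "\<bar>u * (1 + cos a)\<bar> \<le> 2" if "0 \<le> u" "u \<le> 1" for u a :: real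
    proof -
      have "0 \<le> 1 + cos a" "1 + cos a \<le> 2"
        using cos_ge_minus_one[of a] cos_le_one[of a] by linarith+
      then show ?thesis using mult_mono[of u 1 "1 + cos a" 2] that by (simp add: abs_mult)
    qed
    have lin: "(\<integral>x. f x + c * g x + d * h x \<partial>K) = (\<integral>x. f x \<partial>K) + c * (\<integral>x. g x \<partial>K) + d * (\<integral>x. h x \<partial>K)"
      if "integrable K f" "integrable K g" "integrable K h" for K :: "'z measure" and f g h :: "'z \<Rightarrow> complex" and c d
      using that by simp
    \<comment> \<open>the induction hypothesis, at 1, 0 and -1 times \<open>T\<close>, gives the characteristic functions of the shifted cosine weights\<close>
    have key: "(\<integral>x. wM x * (1 + cos (T x - \<phi>)) * indicator (B k) (Y k x) \<partial>M)
        = (\<integral>x. wN x * (1 + cos (T' x - \<phi>)) * indicator (B k) (Y' k x) \<partial>N)" for \<phi>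
    proof (rule weighted_Levy_uniqueness)
      show "integrable M (\<lambda>x. wM x * (1 + cos (T x - \<phi>)))"
        using w01 by (intro M.integrable_const_bound[of _ 2]) (simp_all add: b2)
      show "integrable N (\<lambda>x. wN x * (1 + cos (T' x - \<phi>)))"
        using w01 by (intro N.integrable_const_bound[of _ 2]) (simp_all add: b2)
      show "0 \<le> wM x * (1 + cos (T x - \<phi>))" for x
        using w01(1) b0 by (rule mult_nonneg_nonneg)
      show "0 \<le> wN x * (1 + cos (T' x - \<phi>))" for x
        using w01(3) b0 by (rule mult_nonneg_nonneg)
      show "(\<integral>x. (wM x * (1 + cos (T x - \<phi>))) *\<^sub>R iexp (s * Y k x) \<partial>M)
          = (\<integral>x. (wN x * (1 + cos (T' x - \<phi>))) *\<^sub>R iexp (s * Y' k x) \<partial>N)" for s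
      proof -
        have "(\<integral>x. (wM x * (1 + cos (T x - \<phi>))) *\<^sub>R iexp (s * Y k x) \<partial>M)
            = (\<integral>x. wM x *\<^sub>R iexp (0 * T x + s * Y k x) \<partial>M) + (iexp (- \<phi>) / 2) * (\<integral>x. wM x *\<^sub>R iexp (1 * T x + s * Y k x) \<partial>M)
              + (iexp \<phi> / 2) * (\<integral>x. wM x *\<^sub>R iexp ((-1) * T x + s * Y k x) \<partial>M)"
          unfolding split by (intro lin iM) measurable
        also have "\<dots> = (\<integral>x. wN x *\<^sub>R iexp (0 * T' x + s * Y' k x) \<partial>N) + (iexp (- \<phi>) / 2) * (\<integral>x. wN x *\<^sub>R iexp (1 * T' x + s * Y' k x) \<partial>N)
              + (iexp \<phi> / 2) * (\<integral>x. wN x *\<^sub>R iexp ((-1) * T' x + s * Y' k x) \<partial>N)"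
          by (simp only: IH)
        also have "\<dots> = (\<integral>x. (wN x * (1 + cos (T' x - \<phi>))) *\<^sub>R iexp (s * Y' k x) \<partial>N)"
          unfolding split by (intro lin[symmetric] iN) measurable
        finally show ?thesis .
      qed
    qed (use B in auto)
    \<comment> \<open>the constant weight is subtracted again to isolate the cosine\<close>
    have key0: "(\<integral>x. wM x * indicator (B k) (Y k x) \<partial>M) = (\<integral>x. wN x * indicator (B k) (Y' k x) \<partial>N)"
    proof (rule weighted_Levy_uniqueness)
      show "integrable M wM" "integrable N wN"
        using w01 by (auto intro!: M.integrable_const_bound[of _ 1] N.integrable_const_bound[of _ 1])
      show "(\<integral>x. wM x *\<^sub>R iexp (s * Y k x) \<partial>M) = (\<integral>x. wN x *\<^sub>R iexp (s * Y' k x) \<partial>N)" for s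
        using IH[of 0 s] by simp
    qed (use B w01 in auto)
    define vM where "vM x = wM x * indicator (B k) (Y k x)" for x
    define vN where "vN x = wN x * indicator (B k) (Y' k x)" for x
    have [measurable]: "vM \<in> borel_measurable M" "vN \<in> borel_measurable N"
      unfolding vM_def vN_def by measurable
    have v01: "0 \<le> vM x" "vM x \<le> 1" "0 \<le> vN y" "vN y \<le> 1" for x y
      using w01 by (auto simp: vM_def vN_def indicator_def)
    have jM: "integrable M (\<lambda>x. vM x * g x)" if [measurable]: "g \<in> borel_measurable M" and "\<And>x. \<bar>g x\<bar> \<le> 1" for g :: "'a \<Rightarrow> real"
      using v01 that(2) by (intro M.integrable_const_bound[of _ 1]) (auto simp: abs_mult intro!: mult_le_one)
    have jN: "integrable N (\<lambda>x. vN x * g x)" if [measurable]: "g \<in> borel_measurable N" and "\<And>x. \<bar>g x\<bar> \<le> 1" for g :: "'b \<Rightarrow> real"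
      using v01 that(2) by (intro N.integrable_const_bound[of _ 1]) (auto simp: abs_mult intro!: mult_le_one)
    have trig: "(\<integral>x. vM x * cos (T x - \<phi>) \<partial>M) = (\<integral>x. vN x * cos (T' x - \<phi>) \<partial>N)" for \<phi>
    proof -
      have "(\<integral>x. wM x * (1 + cos (T x - \<phi>)) * indicator (B k) (Y k x) \<partial>M) = (\<integral>x. vM x * 1 + vM x * cos (T x - \<phi>) \<partial>M)"
        by (intro Bochner_Integration.integral_cong) (auto simp: vM_def algebra_simps)
      also have "\<dots> = (\<integral>x. vM x * 1 \<partial>M) + (\<integral>x. vM x * cos (T x - \<phi>) \<partial>M)"
        by (intro Bochner_Integration.integral_add jM) auto
      finally have 1: "(\<integral>x. wM x * (1 + cos (T x - \<phi>)) * indicator (B k) (Y k x) \<partial>M) = (\<integral>x. vM x * 1 \<partial>M) + (\<integral>x. vM x * cos (T x - \<phi>) \<partial>M)" .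
      have "(\<integral>x. wN x * (1 + cos (T' x - \<phi>)) * indicator (B k) (Y' k x) \<partial>N) = (\<integral>x. vN x * 1 + vN x * cos (T' x - \<phi>) \<partial>N)"
        by (intro Bochner_Integration.integral_cong) (auto simp: vN_def algebra_simps)
      also have "\<dots> = (\<integral>x. vN x * 1 \<partial>N) + (\<integral>x. vN x * cos (T' x - \<phi>) \<partial>N)"
        by (intro Bochner_Integration.integral_add jN) auto
      finally show ?thesis using key[of \<phi>] key0 1 by (simp add: vM_def vN_def)
    qed
    have iexp_split: "u *\<^sub>R iexp t = complex_of_real (u * cos (t - 0)) + \<i> * complex_of_real (u * cos (t - pi / 2))" for u t :: real
      by (simp add: cis_conv_exp[symmetric] complex_eq_iff cos_diff)
    have "(\<integral>x. vM x *\<^sub>R iexp (T x) \<partial>M) = complex_of_real (\<integral>x. vM x * cos (T x - 0) \<partial>M) + \<i> * complex_of_real (\<integral>x. vM x * cos (T x - pi / 2) \<partial>M)"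
      unfolding iexp_split
      by (subst Bochner_Integration.integral_add) (auto intro!: jM integrable_of_real integrable_mult_right simp del: of_real_mult)
    moreover have "(\<integral>x. vN x *\<^sub>R iexp (T' x) \<partial>N) = complex_of_real (\<integral>x. vN x * cos (T' x - 0) \<partial>N) + \<i> * complex_of_real (\<integral>x. vN x * cos (T' x - pi / 2) \<partial>N)"
      unfolding iexp_split
      by (subst Bochner_Integration.integral_add) (auto intro!: jN integrable_of_real integrable_mult_right simp del: of_real_mult)
    ultimately have "(\<integral>x. vM x *\<^sub>R iexp (T x) \<partial>M) = (\<integral>x. vN x *\<^sub>R iexp (T' x) \<partial>N)"
      by (simp only: trig)
    moreover have "W B (insert k D) (\<lambda>j. Y j x) = vM x" for x
      using k D by (simp add: W_def vM_def wM_def)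
    moreover have "W B (insert k D) (\<lambda>j. Y' j x) = vN x" for x
      using k D by (simp add: W_def vN_def wN_def)
    ultimately show ?case by (simp add: R_def[symmetric] T_def T'_def)
  qed
  show ?thesis
  proof (rule measure_eqI_PiM_finite[OF J])
    fix A :: "'j \<Rightarrow> real set" assume A: "\<And>i. i \<in> J \<Longrightarrow> A i \<in> sets borel"
    define B where "B j = (if j \<in> J then A j else {})" for j
    have B: "B j \<in> sets borel" for j using A by (auto simp: B_def)
    have PE: "Pi\<^sub>E J A = Pi\<^sub>E J B" by (auto simp: B_def PiE_def Pi_def)
    have E1: "{x \<in> space M. \<forall>j\<in>J. Y j x \<in> B j} \<in> sets M"
      using J B by (intro sets.sets_Collect_finite_All) (auto intro!: measurable_sets_Collect[OF Y] pred_sets2)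
    have E2: "{x \<in> space N. \<forall>j\<in>J. Y' j x \<in> B j} \<in> sets N"
      using J B by (intro sets.sets_Collect_finite_All) (auto intro!: measurable_sets_Collect[OF Y'] pred_sets2)
    have W1: "W B J (\<lambda>j. Y j x) = indicator {x \<in> space M. \<forall>j\<in>J. Y j x \<in> B j} x" if "x \<in> space M" for x
      using J that by (auto simp: W_def indicator_def prod.neutral intro!: prod_zero)
    have W2: "W B J (\<lambda>j. Y' j x) = indicator {x \<in> space N. \<forall>j\<in>J. Y' j x \<in> B j} x" if "x \<in> space N" for x
      using J that by (auto simp: W_def indicator_def prod.neutral intro!: prod_zero)
    have "(\<integral>x. W B J (\<lambda>j. Y j x) *\<^sub>R iexp 0 \<partial>M) = (\<integral>x. W B J (\<lambda>j. Y' j x) *\<^sub>R iexp 0 \<partial>N)"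
      using main[of J B "\<lambda>_. 0"] J B by simp
    then have "complex_of_real (\<integral>x. W B J (\<lambda>j. Y j x) \<partial>M) = complex_of_real (\<integral>x. W B J (\<lambda>j. Y' j x) \<partial>N)"
      by (simp add: scaleR_conv_of_real)
    then have "(\<integral>x. W B J (\<lambda>j. Y j x) \<partial>M) = (\<integral>x. W B J (\<lambda>j. Y' j x) \<partial>N)"
      by (simp only: of_real_eq_iff)
    then have eqm: "M.prob {x \<in> space M. \<forall>j\<in>J. Y j x \<in> B j} = N.prob {x \<in> space N. \<forall>j\<in>J. Y' j x \<in> B j}"
      using E1 E2 by (simp add: W1 W2 cong: Bochner_Integration.integral_cong)
    have v1: "(\<lambda>x. \<lambda>j\<in>J. Y j x) -` Pi\<^sub>E J B \<inter> space M = {x \<in> space M. \<forall>j\<in>J. Y j x \<in> B j}"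
      by auto
    have v2: "(\<lambda>x. \<lambda>j\<in>J. Y' j x) -` Pi\<^sub>E J B \<inter> space N = {x \<in> space N. \<forall>j\<in>J. Y' j x \<in> B j}"
      by auto
    have PB: "Pi\<^sub>E J B \<in> sets (PiM J (\<lambda>_. borel))"
      using J B by (intro sets_PiM_I_finite) auto
    show "emeasure (distr M (Pi\<^sub>M J (\<lambda>_. borel)) (\<lambda>x. \<lambda>j\<in>J. Y j x)) (Pi\<^sub>E J A) =
          emeasure (distr N (Pi\<^sub>M J (\<lambda>_. borel)) (\<lambda>x. \<lambda>j\<in>J. Y' j x)) (Pi\<^sub>E J A)"
      unfolding PE by (subst (1 2) emeasure_distr)
        (auto simp: v1 v2 PB M.emeasure_eq_measure N.emeasure_eq_measure eqm intro!: measurable_restrict)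
  next
    show "range (\<lambda>_::nat. (\<Pi>\<^sub>E j\<in>J. UNIV :: real set)) \<subseteq> prod_algebra J (\<lambda>_. borel)"
      using J by (auto intro!: prod_algebraI_finite)
    show "emeasure (distr M (Pi\<^sub>M J (\<lambda>_. borel)) (\<lambda>x. \<lambda>j\<in>J. Y j x)) (\<Pi>\<^sub>E j\<in>J. UNIV) \<noteq> \<infinity>" for i :: nat
    proof -
      interpret D: prob_space "distr M (Pi\<^sub>M J (\<lambda>_. borel)) (\<lambda>x. \<lambda>j\<in>J. Y j x)"
        by (intro M.prob_space_distr measurable_restrict Y)
      show ?thesis by simp
    qed
  qed (auto simp: space_PiM)
qed

section \<open>Matrices as functions of two indices\<close>

definition mat_app :: "nat \<Rightarrow> (nat \<Rightarrow> nat \<Rightarrow> real) \<Rightarrow> (nat \<Rightarrow> real) \<Rightarrow> nat \<Rightarrow> real" where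
  "mat_app p A x = (\<lambda>i. \<Sum>j<p. A i j * x j)"

definition dot :: "nat \<Rightarrow> (nat \<Rightarrow> real) \<Rightarrow> (nat \<Rightarrow> real) \<Rightarrow> real" where
  "dot p x y = (\<Sum>i<p. x i * y i)"

definition sq_len :: "nat \<Rightarrow> (nat \<Rightarrow> real) \<Rightarrow> real" where
  "sq_len p x = (\<Sum>i<p. (x i)\<^sup>2)"

definition frob_sq :: "nat \<Rightarrow> (nat \<Rightarrow> nat \<Rightarrow> real) \<Rightarrow> real" where
  "frob_sq p A = (\<Sum>i<p. \<Sum>j<p. (A i j)\<^sup>2)"

text \<open>The operator norm is at most \<open>a\<close>. Only upper bounds occur below, so no supremum has to be formed.\<close>

definition op_bound :: "nat \<Rightarrow> (nat \<Rightarrow> nat \<Rightarrow> real) \<Rightarrow> real \<Rightarrow> bool" where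
  "op_bound p A a \<longleftrightarrow> 0 \<le> a \<and> (\<forall>x. sq_len p (mat_app p A x) \<le> a\<^sup>2 * sq_len p x)"

definition sym_on :: "nat \<Rightarrow> (nat \<Rightarrow> nat \<Rightarrow> real) \<Rightarrow> bool" where
  "sym_on p A \<longleftrightarrow> (\<forall>i<p. \<forall>j<p. A i j = A j i)"

text \<open>The matrix \<open>2ASA\<close> for symmetric \<open>A\<close>, given by its columns.\<close>

definition sandwich :: "nat \<Rightarrow> (nat \<Rightarrow> nat \<Rightarrow> real) \<Rightarrow> (nat \<Rightarrow> nat \<Rightarrow> real) \<Rightarrow> nat \<Rightarrow> nat \<Rightarrow> real" where
  "sandwich p S A i j = 2 * mat_app p A (mat_app p S (\<lambda>l. A l j)) i"

lemma sq_len_nonneg: "0 \<le> sq_len p x"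
  by (simp add: sq_len_def sum_nonneg)

lemma frob_sq_nonneg: "0 \<le> frob_sq p A"
  by (simp add: frob_sq_def sum_nonneg)

lemma frob_sq_cols: "frob_sq p A = (\<Sum>j<p. sq_len p (\<lambda>i. A i j))"
  unfolding frob_sq_def sq_len_def by (rule sum.swap)

lemma dot_commute: "dot p x y = dot p y x"
  by (simp add: dot_def mult.commute)

lemma dot_square_le: "(dot p x y)\<^sup>2 \<le> sq_len p x * sq_len p y"
  unfolding dot_def sq_len_def by (rule Cauchy_Schwarz_ineq_sum)

lemma mat_app_cong: "(\<And>j. j < p \<Longrightarrow> x j = y j) \<Longrightarrow> mat_app p A x = mat_app p A y"
  by (simp add: mat_app_def)

lemma dot_mat_app_sym:
  assumes "sym_on p A"
  shows "dot p x (mat_app p A y) = dot p (mat_app p A x) y"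
proof -
  have "dot p x (mat_app p A y) = (\<Sum>i<p. \<Sum>j<p. x i * A i j * y j)"
    by (simp add: dot_def mat_app_def sum_distrib_left mult.assoc)
  also have "\<dots> = (\<Sum>j<p. \<Sum>i<p. x i * A i j * y j)" by (rule sum.swap)
  also have "\<dots> = (\<Sum>j<p. \<Sum>i<p. A j i * x i * y j)"
    using assms by (intro sum.cong) (auto simp: sym_on_def)
  also have "\<dots> = dot p (mat_app p A x) y"
    by (simp add: dot_def mat_app_def sum_distrib_right)
  finally show ?thesis .
qed

lemma op_bound_quadratic:
  assumes "op_bound p A a"
  shows "\<bar>dot p x (mat_app p A x)\<bar> \<le> a * sq_len p x"
proof -
  have "(dot p x (mat_app p A x))\<^sup>2 \<le> sq_len p x * sq_len p (mat_app p A x)" by (rule dot_square_le)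
  also have "\<dots> \<le> sq_len p x * (a\<^sup>2 * sq_len p x)"
    using assms by (intro mult_left_mono) (auto simp: op_bound_def sq_len_nonneg)
  also have "\<dots> = (a * sq_len p x)\<^sup>2" by (simp add: power2_eq_square algebra_simps)
  finally have "\<bar>dot p x (mat_app p A x)\<bar> \<le> \<bar>a * sq_len p x\<bar>" by (simp only: abs_le_square_iff)
  then show ?thesis using assms by (simp add: op_bound_def sq_len_nonneg)
qed

lemma op_bound_mono:
  assumes "op_bound p A a" "a \<le> b"
  shows "op_bound p A b"
proof -
  have "a\<^sup>2 \<le> b\<^sup>2" using assms by (intro power_mono) (auto simp: op_bound_def)
  then have "a\<^sup>2 * sq_len p x \<le> b\<^sup>2 * sq_len p x" for x by (intro mult_right_mono sq_len_nonneg)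
  then show ?thesis using assms unfolding op_bound_def by (meson order.trans)
qed

lemma mat_app_sandwich: "mat_app p (sandwich p S A) x = (\<lambda>i. 2 * mat_app p A (mat_app p S (mat_app p A x)) i)"
proof
  fix i
  have "mat_app p (sandwich p S A) x i = (\<Sum>j<p. \<Sum>k<p. \<Sum>l<p. 2 * (A i k * (S k l * (A l j * x j))))"
    by (simp add: mat_app_def sandwich_def sum_distrib_left sum_distrib_right mult.assoc)
  also have "\<dots> = (\<Sum>k<p. \<Sum>j<p. \<Sum>l<p. 2 * (A i k * (S k l * (A l j * x j))))"
    by (rule sum.swap)
  also have "\<dots> = (\<Sum>k<p. \<Sum>l<p. \<Sum>j<p. 2 * (A i k * (S k l * (A l j * x j))))"
    by (intro sum.cong refl sum.swap)
  also have "\<dots> = 2 * mat_app p A (mat_app p S (mat_app p A x)) i"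
    by (simp add: mat_app_def sum_distrib_left mult.assoc)
  finally show "mat_app p (sandwich p S A) x i = 2 * mat_app p A (mat_app p S (mat_app p A x)) i" .
qed

lemma sq_len_scale: "sq_len p (\<lambda>i. c * x i) = c\<^sup>2 * sq_len p x"
  by (simp add: sq_len_def sum_distrib_left power_mult_distrib)

lemma dot_add: "dot p (\<lambda>i. a i + b i) x = dot p a x + dot p b x"
  by (simp add: dot_def algebra_simps sum.distrib)

lemma dot_diff: "dot p (\<lambda>i. a i - b i) x = dot p a x - dot p b x"
  by (simp add: dot_def algebra_simps sum_subtractf)

lemma dot_scale: "dot p (\<lambda>i. c * a i) x = c * dot p a x"
  by (simp add: dot_def sum_distrib_left mult.assoc)

lemma mat_app_add: "mat_app p A (\<lambda>i. a i + b i) = (\<lambda>i. mat_app p A a i + mat_app p A b i)"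
  by (simp add: mat_app_def algebra_simps sum.distrib)

lemma mat_app_diff: "mat_app p A (\<lambda>i. a i - b i) = (\<lambda>i. mat_app p A a i - mat_app p A b i)"
  by (simp add: mat_app_def algebra_simps sum_subtractf)

lemma mat_app_scale: "mat_app p A (\<lambda>i. c * a i) = (\<lambda>i. c * mat_app p A a i)"
  by (simp add: mat_app_def sum_distrib_left mult_ac)

lemma dot_add_right: "dot p x (\<lambda>i. a i + b i) = dot p x a + dot p x b"
  by (simp add: dot_commute[of p x] dot_add)

lemma dot_diff_right: "dot p x (\<lambda>i. a i - b i) = dot p x a - dot p x b"
  by (simp add: dot_commute[of p x] dot_diff)

lemma dot_scale_right: "dot p x (\<lambda>i. c * a i) = c * dot p x a"
  by (simp add: dot_commute[of p x] dot_scale)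

lemmas bilinear = dot_add dot_diff dot_scale mat_app_add mat_app_diff mat_app_scale dot_add_right dot_diff_right dot_scale_right

text \<open>The bound \<open>2\<psi>a\<^sup>2\<close> on \<open>2ASA\<close> says that \<open>2\<psi>a\<close> is squared, which makes the iteration
converge as soon as \<open>2\<psi>a < 1\<close>.\<close>

lemma op_bound_sandwich:
  assumes A: "op_bound p A a" and S: "op_bound p S \<psi>"
  shows "op_bound p (sandwich p S A) (2 * \<psi> * a\<^sup>2)"
proof -
  have "sq_len p (mat_app p (sandwich p S A) x) \<le> (2 * \<psi> * a\<^sup>2)\<^sup>2 * sq_len p x" for x
  proof -
    have "sq_len p (mat_app p (sandwich p S A) x) = 4 * sq_len p (mat_app p A (mat_app p S (mat_app p A x)))"
      by (simp add: mat_app_sandwich sq_len_scale)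
    also have "\<dots> \<le> 4 * (a\<^sup>2 * sq_len p (mat_app p S (mat_app p A x)))"
      using A by (simp add: op_bound_def)
    also have "\<dots> \<le> 4 * (a\<^sup>2 * (\<psi>\<^sup>2 * sq_len p (mat_app p A x)))"
      using S by (simp add: op_bound_def mult_left_mono)
    also have "\<dots> \<le> 4 * (a\<^sup>2 * (\<psi>\<^sup>2 * (a\<^sup>2 * sq_len p x)))"
      using A by (simp add: op_bound_def mult_left_mono)
    finally show ?thesis by (simp add: power2_eq_square algebra_simps)
  qed
  then show ?thesis using A S by (simp add: op_bound_def)
qed

lemma frob_sq_sandwich:
  assumes A: "op_bound p A a" and S: "op_bound p S \<psi>"
  shows "frob_sq p (sandwich p S A) \<le> 4 * a\<^sup>2 * \<psi>\<^sup>2 * frob_sq p A"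
proof -
  have "sq_len p (\<lambda>i. sandwich p S A i j) \<le> 4 * a\<^sup>2 * \<psi>\<^sup>2 * sq_len p (\<lambda>i. A i j)" for j
  proof -
    have "sq_len p (\<lambda>i. sandwich p S A i j) = 4 * sq_len p (mat_app p A (mat_app p S (\<lambda>l. A l j)))"
      by (simp add: sandwich_def sq_len_scale)
    also have "\<dots> \<le> 4 * (a\<^sup>2 * sq_len p (mat_app p S (\<lambda>l. A l j)))"
      using A by (simp add: op_bound_def)
    also have "\<dots> \<le> 4 * (a\<^sup>2 * (\<psi>\<^sup>2 * sq_len p (\<lambda>l. A l j)))"
      using S by (simp add: op_bound_def mult_left_mono)
    finally show ?thesis by (simp add: algebra_simps)
  qed
  then show ?thesis unfolding frob_sq_cols sum_distrib_left by (intro sum_mono) auto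
qed

lemma sym_on_sandwich:
  assumes A: "sym_on p A" and S: "sym_on p S"
  shows "sym_on p (sandwich p S A)"
proof -
  have "sandwich p S A i j = sandwich p S A j i" if "i < p" "j < p" for i j
  proof -
    have row: "mat_app p A y i = dot p (\<lambda>l. A l i) y" if "i < p" for y i
      using A that by (auto simp: mat_app_def dot_def sym_on_def intro!: sum.cong)
    show ?thesis
      using that dot_mat_app_sym[OF S, of "\<lambda>l. A l i" "\<lambda>l. A l j"]
      by (simp add: sandwich_def row dot_commute)
  qed
  then show ?thesis by (simp add: sym_on_def)
qed

text \<open>Schur's test: by Cauchy-Schwarz with respect to the weights \<open>A i j\<close>, each \<open>((A x) i)\<^sup>2\<close> is at most
\<open>r\<close> times the weighted sum of the \<open>(x j)\<^sup>2\<close>, and the column sums are again at most \<open>r\<close>.\<close>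

lemma op_bound_row_sums:
  assumes nonneg: "\<And>i j. 0 \<le> A i j" and sym: "\<And>i j. A i j = A j i"
    and row: "\<And>i. (\<Sum>j<p. A i j) \<le> r"
  shows "op_bound p A r"
proof -
  have r: "0 \<le> r" using row[of 0] sum_nonneg[of "{..<p}" "A 0"] nonneg by (meson order.trans)
  have "sq_len p (mat_app p A x) \<le> r\<^sup>2 * sq_len p x" for x
  proof -
    have "(mat_app p A x i)\<^sup>2 \<le> r * (\<Sum>j<p. A i j * (x j)\<^sup>2)" for i
    proof -
      have "mat_app p A x i = (\<Sum>j<p. sqrt (A i j) * (sqrt (A i j) * x j))"
        using nonneg by (simp add: mat_app_def mult.assoc[symmetric])
      then have "(mat_app p A x i)\<^sup>2 \<le> (\<Sum>j<p. (sqrt (A i j))\<^sup>2) * (\<Sum>j<p. (sqrt (A i j) * x j)\<^sup>2)"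
        by (simp only: Cauchy_Schwarz_ineq_sum)
      also have "\<dots> = (\<Sum>j<p. A i j) * (\<Sum>j<p. A i j * (x j)\<^sup>2)"
        using nonneg by (simp add: power_mult_distrib)
      also have "\<dots> \<le> r * (\<Sum>j<p. A i j * (x j)\<^sup>2)"
        using row nonneg by (intro mult_right_mono sum_nonneg) auto
      finally show ?thesis .
    qed
    then have "sq_len p (mat_app p A x) \<le> (\<Sum>i<p. r * (\<Sum>j<p. A i j * (x j)\<^sup>2))"
      unfolding sq_len_def by (intro sum_mono)
    also have "\<dots> = r * (\<Sum>i<p. \<Sum>j<p. A j i * (x j)\<^sup>2)"
      by (simp add: sum_distrib_left sym)
    also have "(\<Sum>i<p. \<Sum>j<p. A j i * (x j)\<^sup>2) = (\<Sum>j<p. (\<Sum>i<p. A j i) * (x j)\<^sup>2)"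
      by (subst sum.swap) (simp add: sum_distrib_right)
    also have "r * \<dots> \<le> r * (\<Sum>j<p. r * (x j)\<^sup>2)"
      using r row by (intro mult_left_mono sum_mono mult_right_mono) auto
    finally show ?thesis by (simp add: sq_len_def sum_distrib_left power2_eq_square mult.assoc)
  qed
  then show ?thesis using r by (simp add: op_bound_def)
qed

text \<open>For symmetric arguments this is the trace of the matrix product, hence the mean of \<open>x \<bullet> A x\<close>
under a centered law with covariance \<open>S\<close>.\<close>

definition trace_prod :: "nat \<Rightarrow> (nat \<Rightarrow> nat \<Rightarrow> real) \<Rightarrow> (nat \<Rightarrow> nat \<Rightarrow> real) \<Rightarrow> real" where
  "trace_prod p A S = (\<Sum>i<p. \<Sum>j<p. A i j * S i j)"

text \<open>With \<open>B = AS\<close> the trace of \<open>2ASAS\<close> is \<open>2 tr(BB)\<close>, at most twice the squared Frobenius norm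
of \<open>B\<close>. Thus, unlike \<open>tr(AS)\<close> itself, all traces collected after the first step are controlled by the Frobenius norm.\<close>

lemma trace_sandwich_le:
  assumes A: "sym_on p A" and S: "sym_on p S" "op_bound p S \<psi>"
  shows "trace_prod p (sandwich p S A) S \<le> 2 * \<psi>\<^sup>2 * frob_sq p A"
proof -
  define B where "B i k = mat_app p S (\<lambda>l. A l i) k" for i k
  have BS: "(\<Sum>j<p. B j k * S i j) = mat_app p S (\<lambda>j. B j k) i" for i k
    by (simp add: mat_app_def mult.commute)
  have fB: "(\<Sum>i<p. \<Sum>k<p. (B i k)\<^sup>2) \<le> \<psi>\<^sup>2 * frob_sq p A"
  proof -
    have "(\<Sum>i<p. \<Sum>k<p. (B i k)\<^sup>2) = (\<Sum>i<p. sq_len p (mat_app p S (\<lambda>l. A l i)))"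
      by (simp add: B_def sq_len_def)
    also have "\<dots> \<le> (\<Sum>i<p. \<psi>\<^sup>2 * sq_len p (\<lambda>l. A l i))"
      using S(2) by (intro sum_mono) (simp add: op_bound_def)
    finally show ?thesis by (simp add: frob_sq_cols sum_distrib_left)
  qed
  have AS: "(\<Sum>i<p. A i k * S i j) = B k j" if "k < p" "j < p" for k j
    unfolding B_def mat_app_def using A S(1) that by (intro sum.cong) (auto simp: sym_on_def mult.commute)
  have "trace_prod p (sandwich p S A) S = (\<Sum>i<p. \<Sum>j<p. \<Sum>k<p. 2 * (A i k * B j k * S i j))"
    by (simp add: trace_prod_def sandwich_def mat_app_def[of p A] B_def[symmetric] sum_distrib_left sum_distrib_right mult.assoc)
  also have "\<dots> = (\<Sum>j<p. \<Sum>i<p. \<Sum>k<p. 2 * (A i k * B j k * S i j))"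
    by (rule sum.swap)
  also have "\<dots> = (\<Sum>j<p. \<Sum>k<p. \<Sum>i<p. 2 * (A i k * B j k * S i j))"
    by (intro sum.cong refl sum.swap)
  also have "\<dots> = (\<Sum>j<p. \<Sum>k<p. 2 * (B j k * (\<Sum>i<p. A i k * S i j)))"
    by (simp add: sum_distrib_left mult_ac)
  also have "\<dots> = (\<Sum>j<p. \<Sum>k<p. 2 * (B j k * B k j))"
    by (intro sum.cong refl) (simp add: AS)
  also have "\<dots> \<le> (\<Sum>j<p. \<Sum>k<p. (B j k)\<^sup>2 + (B k j)\<^sup>2)"
    by (intro sum_mono) (use sum_squares_bound in \<open>auto simp: mult.assoc\<close>)
  also have "\<dots> = (\<Sum>j<p. \<Sum>k<p. (B j k)\<^sup>2) + (\<Sum>j<p. \<Sum>k<p. (B k j)\<^sup>2)"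
    by (simp add: sum.distrib)
  also have "(\<Sum>j<p. \<Sum>k<p. (B k j)\<^sup>2) = (\<Sum>j<p. \<Sum>k<p. (B j k)\<^sup>2)"
    by (rule sum.swap)
  finally show ?thesis using fB by simp
qed

definition std_unit :: "nat \<Rightarrow> nat \<Rightarrow> real" where "std_unit i j = (if i = j then 1 else 0)"

lemma sq_len_std_unit: "i < p \<Longrightarrow> sq_len p (std_unit i) = 1"
  by (simp add: sq_len_def std_unit_def if_distrib[of "\<lambda>x. x\<^sup>2"] cong: if_cong)

lemma dot_std_unit: "i < p \<Longrightarrow> dot p (std_unit i) x = x i"
  by (simp add: dot_def std_unit_def if_distrib[of "\<lambda>x. x * _"] cong: if_cong)

lemma mat_app_std_unit: "j < p \<Longrightarrow> mat_app p A (std_unit j) = (\<lambda>i. A i j)"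
  by (simp add: mat_app_def std_unit_def if_distrib[of "\<lambda>x. _ * x"] cong: if_cong)

lemma op_bound_diag: "op_bound p A a \<Longrightarrow> i < p \<Longrightarrow> \<bar>A i i\<bar> \<le> a"
  using op_bound_quadratic[of p A a "std_unit i"] by (simp add: sq_len_std_unit dot_std_unit mat_app_std_unit)

lemma trace_prod_ge:
  assumes A: "op_bound p A a" and S: "op_bound p S \<psi>"
  shows "- (real p * \<psi> * a) \<le> trace_prod p A S"
proof -
  have "- (\<psi> * a) \<le> dot p (\<lambda>i. A i j) (\<lambda>i. S i j)" if j: "j < p" for j
  proof -
    have "sq_len p (\<lambda>i. A i j) \<le> a\<^sup>2" "sq_len p (\<lambda>i. S i j) \<le> \<psi>\<^sup>2"
      using A S sq_len_std_unit[OF j] mat_app_std_unit[OF j] unfolding op_bound_def by (metis mult_cancel_left1 mult.right_neutral)+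
    then have "(dot p (\<lambda>i. A i j) (\<lambda>i. S i j))\<^sup>2 \<le> a\<^sup>2 * \<psi>\<^sup>2"
      by (intro order.trans[OF dot_square_le] mult_mono sq_len_nonneg) auto
    then have "(dot p (\<lambda>i. A i j) (\<lambda>i. S i j))\<^sup>2 \<le> (\<psi> * a)\<^sup>2"
      by (simp add: power_mult_distrib mult.commute)
    then have "\<bar>dot p (\<lambda>i. A i j) (\<lambda>i. S i j)\<bar> \<le> \<bar>\<psi> * a\<bar>"
      by (simp add: abs_le_square_iff)
    then show ?thesis using A S by (auto simp: op_bound_def)
  qed
  then have "(\<Sum>j<p. - (\<psi> * a)) \<le> (\<Sum>j<p. dot p (\<lambda>i. A i j) (\<lambda>i. S i j))"
    by (intro sum_mono) auto
  also have "\<dots> = trace_prod p A S"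
    unfolding trace_prod_def dot_def by (rule sum.swap)
  finally show ?thesis by (simp add: mult.assoc)
qed

section \<open>Exponential moments of Gaussian quadratic forms\<close>

locale gaussian_vector = prob_space \<mu> for \<mu> :: "(nat \<Rightarrow> real) measure" +
  fixes p :: nat and S :: "nat \<Rightarrow> nat \<Rightarrow> real"
  assumes sets_mu: "sets \<mu> = sets (PiM {..<p} (\<lambda>_. borel))"
    and sym_S: "sym_on p S"
    and psd_S: "0 \<le> dot p a (mat_app p S a)"
    and law: "distr \<mu> borel (dot p a) = normal_law 0 (dot p a (mat_app p S a))"
begin

lemma coordinate_measurable[measurable]: "i < p \<Longrightarrow> (\<lambda>x. x i) \<in> borel_measurable \<mu>"
  using measurable_component_singleton[of i "{..<p}" "\<lambda>_. borel"] sets_mu by (auto cong: measurable_cong_sets)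

lemma dot_measurable[measurable]: "dot p a \<in> borel_measurable \<mu>"
proof -
  have "dot p a = (\<lambda>x. \<Sum>i<p. a i * x i)" by (simp add: dot_def fun_eq_iff)
  then show ?thesis by (auto intro!: borel_measurable_sum)
qed

lemma quadratic_measurable[measurable]: "(\<lambda>x. dot p x (mat_app p A x)) \<in> borel_measurable \<mu>"
  unfolding dot_def mat_app_def by (auto intro!: borel_measurable_sum borel_measurable_times)

lemma mgf: "(\<integral>\<^sup>+x. ennreal (exp (dot p a x)) \<partial>\<mu>) = ennreal (exp (dot p a (mat_app p S a) / 2))"
  by (rule normal_mgf[OF law psd_S dot_measurable])

lemma cf: "(\<integral>x. iexp (dot p a x) \<partial>\<mu>) = complex_of_real (exp (- dot p a (mat_app p S a) / 2))"
  by (rule normal_cf[OF law psd_S dot_measurable])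

lemma pair_cf:
  "(\<integral>z. iexp (dot p a (fst z) + dot p b (snd z)) \<partial>(\<mu> \<Otimes>\<^sub>M \<mu>))
    = complex_of_real (exp (- (dot p a (mat_app p S a) + dot p b (mat_app p S b)) / 2))"
proof -
  interpret PP: pair_prob_space \<mu> \<mu> ..
  have "integrable (\<mu> \<Otimes>\<^sub>M \<mu>) (\<lambda>z. iexp (dot p a (fst z) + dot p b (snd z)))"
    by (rule PP.integrable_const_bound[of _ 1]) auto
  from PP.integral_fst'[OF this]
  have "(\<integral>z. iexp (dot p a (fst z) + dot p b (snd z)) \<partial>(\<mu> \<Otimes>\<^sub>M \<mu>))
      = (\<integral>x. (\<integral>y. iexp (dot p a x) * iexp (dot p b y) \<partial>\<mu>) \<partial>\<mu>)"
    by (simp add: exp_add algebra_simps)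
  also have "\<dots> = (\<integral>x. iexp (dot p a x) \<partial>\<mu>) * (\<integral>y. iexp (dot p b y) \<partial>\<mu>)"
    by simp
  finally show ?thesis
    by (simp add: cf exp_add[symmetric] of_real_mult[symmetric] add_divide_distrib del: of_real_mult)
qed

text \<open>The rotation by 45 degrees of two independent copies \<open>x\<close>, \<open>y\<close>, stated for the family of their \<open>2p\<close>
coordinates, which is indexed by a flag (\<open>True\<close> for \<open>x\<close>) and a position. The exponents of the two characteristic functions
agree by the parallelogram law for the quadratic form of \<open>S\<close>.\<close>

lemma rotation_invariance:
  assumes G[measurable]: "G \<in> borel_measurable (PiM (UNIV \<times> {..<p}) (\<lambda>_. borel))"
  shows "(\<integral>\<^sup>+z. G (\<lambda>(c, i)\<in>UNIV \<times> {..<p}. if c then fst z i else snd z i) \<partial>(\<mu> \<Otimes>\<^sub>M \<mu>))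
    = (\<integral>\<^sup>+z. G (\<lambda>(c, i)\<in>UNIV \<times> {..<p}. (if c then fst z i - snd z i else fst z i + snd z i) / sqrt 2) \<partial>(\<mu> \<Otimes>\<^sub>M \<mu>))"
proof -
  interpret PP: pair_prob_space \<mu> \<mu> ..
  let ?J = "(UNIV :: bool set) \<times> {..<p}"
  define Y where "Y j z = (case j of (c :: bool, i) \<Rightarrow> if c then fst z i else snd z i)" for j and z :: "(nat \<Rightarrow> real) \<times> (nat \<Rightarrow> real)"
  define Y' where "Y' j z = (case j of (c :: bool, i) \<Rightarrow> (if c then fst z i - snd z i else fst z i + snd z i) / sqrt 2)" for j and z :: "(nat \<Rightarrow> real) \<times> (nat \<Rightarrow> real)"
  have meas: "Y j \<in> borel_measurable (\<mu> \<Otimes>\<^sub>M \<mu>)" "Y' j \<in> borel_measurable (\<mu> \<Otimes>\<^sub>M \<mu>)" if "j \<in> ?J" for j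
    unfolding Y_def[abs_def] Y'_def[abs_def] using that by (auto split: prod.splits)
  have "distr (\<mu> \<Otimes>\<^sub>M \<mu>) (PiM ?J (\<lambda>_. borel)) (\<lambda>z. \<lambda>j\<in>?J. Y j z) = distr (\<mu> \<Otimes>\<^sub>M \<mu>) (PiM ?J (\<lambda>_. borel)) (\<lambda>z. \<lambda>j\<in>?J. Y' j z)"
  proof (rule joint_distribution_eqI_cf)
    fix b :: "bool \<times> nat \<Rightarrow> real"
    define s where "s = 1 / sqrt 2"
    have s: "s * s = 1 / 2" by (simp add: s_def)
    define b1 where "b1 i = b (True, i)" for i
    define b0 where "b0 i = b (False, i)" for i
    have sumJ: "(\<Sum>j\<in>?J. f j) = (\<Sum>i<p. f (True, i)) + (\<Sum>i<p. f (False, i))" for f :: "bool \<times> nat \<Rightarrow> real"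
      by (simp add: sum.cartesian_product[symmetric, of "\<lambda>c i. f (c, i)", simplified] UNIV_bool)
    have 1: "(\<Sum>j\<in>?J. b j * Y j z) = dot p b1 (fst z) + dot p b0 (snd z)" for z
      by (simp add: sumJ Y_def dot_def b1_def b0_def)
    have 2: "(\<Sum>j\<in>?J. b j * Y' j z) = dot p (\<lambda>i. s * (b1 i + b0 i)) (fst z) + dot p (\<lambda>i. s * (b0 i - b1 i)) (snd z)" for z
      by (simp add: sumJ Y'_def dot_def b1_def b0_def s_def sum.distrib[symmetric] field_simps)
    have "dot p b1 (mat_app p S b0) = dot p b0 (mat_app p S b1)"
      using dot_mat_app_sym[OF sym_S, of b1 b0] by (simp add: dot_commute)
    then have "dot p (\<lambda>i. s * (b1 i + b0 i)) (mat_app p S (\<lambda>i. s * (b1 i + b0 i))) + dot p (\<lambda>i. s * (b0 i - b1 i)) (mat_app p S (\<lambda>i. s * (b0 i - b1 i)))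
      = (s * s) * (2 * (dot p b1 (mat_app p S b1) + dot p b0 (mat_app p S b0)))"
      by (simp add: bilinear algebra_simps)
    then show "(\<integral>z. iexp (\<Sum>j\<in>?J. b j * Y j z) \<partial>(\<mu> \<Otimes>\<^sub>M \<mu>)) = (\<integral>z. iexp (\<Sum>j\<in>?J. b j * Y' j z) \<partial>(\<mu> \<Otimes>\<^sub>M \<mu>))"
      unfolding 1 2 pair_cf s by simp
  qed (use meas in \<open>auto intro: PP.prob_space_axioms\<close>)
  then have "(\<integral>\<^sup>+y. G y \<partial>distr (\<mu> \<Otimes>\<^sub>M \<mu>) (PiM ?J (\<lambda>_. borel)) (\<lambda>z. \<lambda>j\<in>?J. Y j z))
      = (\<integral>\<^sup>+y. G y \<partial>distr (\<mu> \<Otimes>\<^sub>M \<mu>) (PiM ?J (\<lambda>_. borel)) (\<lambda>z. \<lambda>j\<in>?J. Y' j z))"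
    by simp
  then have "(\<integral>\<^sup>+z. G (\<lambda>j\<in>?J. Y j z) \<partial>(\<mu> \<Otimes>\<^sub>M \<mu>)) = (\<integral>\<^sup>+z. G (\<lambda>j\<in>?J. Y' j z) \<partial>(\<mu> \<Otimes>\<^sub>M \<mu>))"
    using meas by (subst (asm) (1 2) nn_integral_distr) (auto intro!: measurable_restrict)
  then show ?thesis
    by (simp add: Y_def Y'_def case_prod_unfold)
qed

definition quad_mgf :: "(nat \<Rightarrow> nat \<Rightarrow> real) \<Rightarrow> ennreal" where
  "quad_mgf A = (\<integral>\<^sup>+x. ennreal (exp (dot p x (mat_app p A x))) \<partial>\<mu>)"

text \<open>The left-hand side is the exponential moment of \<open>x \<bullet> A x - y \<bullet> A y = (x - y) \<bullet> A (x + y)\<close>. By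
rotation invariance this is the exponential moment of \<open>2 x \<bullet> A y\<close>, which for fixed \<open>x\<close> is linear in
\<open>y\<close> and therefore integrates to \<open>exp(2 Ax \<bullet> S Ax) = exp(x \<bullet> (2ASA) x)\<close>. The identity is one between
extended nonnegative numbers, so no integrability has to be known beforehand.\<close>

lemma quad_mgf_sandwich:
  assumes A: "sym_on p A"
  shows "quad_mgf A * quad_mgf (\<lambda>i j. - A i j) = quad_mgf (sandwich p S A)"
proof -
  interpret PP: pair_prob_space \<mu> \<mu> ..
  define G where "G w = ennreal (exp (2 * (\<Sum>i<p. \<Sum>j<p. w (True, i) * A i j * w (False, j))))" for w :: "bool \<times> nat \<Rightarrow> real"
  have G: "G \<in> borel_measurable (PiM (UNIV \<times> {..<p}) (\<lambda>_. borel))"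
    unfolding G_def[abs_def] by (intro measurable_compose[OF _ measurable_ennreal] borel_measurable_exp measurable_compose[OF _ borel_measurable_exp] borel_measurable_times borel_measurable_sum borel_measurable_const measurable_component_singleton) auto
  have neg: "dot p y (mat_app p (\<lambda>i j. - A i j) y) = - dot p y (mat_app p A y)" for y
    by (simp add: dot_def mat_app_def sum_negf)
  have "quad_mgf A * quad_mgf (\<lambda>i j. - A i j)
      = (\<integral>\<^sup>+x. \<integral>\<^sup>+y. ennreal (exp (dot p x (mat_app p A x))) * ennreal (exp (- dot p y (mat_app p A y))) \<partial>\<mu> \<partial>\<mu>)"
    unfolding quad_mgf_def neg by (simp add: nn_integral_cmult nn_integral_multc)
  also have "\<dots> = (\<integral>\<^sup>+z. ennreal (exp (dot p (fst z) (mat_app p A (fst z)))) * ennreal (exp (- dot p (snd z) (mat_app p A (snd z)))) \<partial>(\<mu> \<Otimes>\<^sub>M \<mu>))"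
    by (subst nn_integral_fst[symmetric]) auto
  also have "\<dots> = (\<integral>\<^sup>+z. G (\<lambda>(c, i)\<in>UNIV \<times> {..<p}. (if c then fst z i - snd z i else fst z i + snd z i) / sqrt 2) \<partial>(\<mu> \<Otimes>\<^sub>M \<mu>))"
  proof (intro nn_integral_cong)
    fix z :: "(nat \<Rightarrow> real) \<times> (nat \<Rightarrow> real)"
    obtain x y where z: "z = (x, y)" by (cases z)
    have "2 * (\<Sum>i<p. \<Sum>j<p. (x i - y i) / sqrt 2 * A i j * ((x j + y j) / sqrt 2)) = dot p (\<lambda>i. x i - y i) (mat_app p A (\<lambda>j. x j + y j))"
      unfolding dot_def mat_app_def sum_distrib_left by (intro sum.cong refl) (simp add: field_simps)
    also have "\<dots> = dot p x (mat_app p A x) - dot p y (mat_app p A y)"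
      using dot_mat_app_sym[OF A, of x y] by (simp add: bilinear dot_commute)
    finally show "ennreal (exp (dot p (fst z) (mat_app p A (fst z)))) * ennreal (exp (- dot p (snd z) (mat_app p A (snd z))))
        = G (\<lambda>(c, i)\<in>UNIV \<times> {..<p}. (if c then fst z i - snd z i else fst z i + snd z i) / sqrt 2)"
      by (simp add: z G_def ennreal_mult[symmetric] exp_add[symmetric])
  qed
  also have "\<dots> = (\<integral>\<^sup>+z. G (\<lambda>(c, i)\<in>UNIV \<times> {..<p}. if c then fst z i else snd z i) \<partial>(\<mu> \<Otimes>\<^sub>M \<mu>))"
    by (rule rotation_invariance[OF G, symmetric])
  also have "\<dots> = (\<integral>\<^sup>+z. ennreal (exp (dot p (\<lambda>i. 2 * mat_app p A (fst z) i) (snd z))) \<partial>(\<mu> \<Otimes>\<^sub>M \<mu>))"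
  proof (intro nn_integral_cong)
    fix z :: "(nat \<Rightarrow> real) \<times> (nat \<Rightarrow> real)"
    obtain x y where z: "z = (x, y)" by (cases z)
    have "2 * (\<Sum>i<p. \<Sum>j<p. x i * A i j * y j) = 2 * dot p x (mat_app p A y)"
      unfolding dot_def mat_app_def sum_distrib_left by (intro sum.cong refl) (simp add: field_simps)
    also have "\<dots> = dot p (\<lambda>i. 2 * mat_app p A x i) y"
      by (simp add: bilinear dot_mat_app_sym[OF A])
    finally show "G (\<lambda>(c, i)\<in>UNIV \<times> {..<p}. if c then fst z i else snd z i) = ennreal (exp (dot p (\<lambda>i. 2 * mat_app p A (fst z) i) (snd z)))"
      by (simp add: z G_def)
  qed
  also have "\<dots> = (\<integral>\<^sup>+x. \<integral>\<^sup>+y. ennreal (exp (dot p (\<lambda>i. 2 * mat_app p A x i) y)) \<partial>\<mu> \<partial>\<mu>)"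
    by (subst nn_integral_fst[symmetric]) (auto simp: dot_def mat_app_def intro!: measurable_compose[OF _ measurable_ennreal] measurable_compose[OF _ borel_measurable_exp] borel_measurable_sum borel_measurable_times)
  also have "\<dots> = quad_mgf (sandwich p S A)"
    unfolding quad_mgf_def mgf
    by (intro nn_integral_cong) (simp add: mat_app_sandwich bilinear dot_mat_app_sym[OF A])
  finally show ?thesis .
qed

text \<open>Only second moments of linear functionals are given, so the mixed moments come from polarisation.\<close>

lemma covariance:
  assumes ij: "i < p" "j < p"
  shows "integrable \<mu> (\<lambda>x. x i * x j)" "(\<integral>x. x i * x j \<partial>\<mu>) = S i j"
proof -
  have ui: "dot p (std_unit k) = (\<lambda>x. x k)" if "k < p" for k using that by (simp add: dot_std_unit fun_eq_iff)
  have uij: "dot p (\<lambda>k. std_unit i k + std_unit j k) = (\<lambda>x. x i + x j)"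
    using ij by (simp add: dot_add dot_std_unit fun_eq_iff)
  note m2 = normal_second_moment[OF law psd_S dot_measurable]
  have q: "dot p (std_unit k) (mat_app p S (std_unit l)) = S k l" if "k < p" "l < p" for k l
    using that by (simp add: dot_std_unit mat_app_std_unit)
  have I: "integrable \<mu> (\<lambda>x. (x i)\<^sup>2)" "(\<integral>x. (x i)\<^sup>2 \<partial>\<mu>) = S i i"
    using m2[of "std_unit i"] ij unfolding q[OF ij(1) ij(1)] unfolding ui[OF ij(1)] by auto
  have J: "integrable \<mu> (\<lambda>x. (x j)\<^sup>2)" "(\<integral>x. (x j)\<^sup>2 \<partial>\<mu>) = S j j"
    using m2[of "std_unit j"] ij unfolding q[OF ij(2) ij(2)] unfolding ui[OF ij(2)] by auto
  have Sji: "S j i = S i j" using sym_S ij by (auto simp: sym_on_def)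
  have IJ: "integrable \<mu> (\<lambda>x. (x i + x j)\<^sup>2)" "(\<integral>x. (x i + x j)\<^sup>2 \<partial>\<mu>) = S i i + 2 * S i j + S j j"
    using m2[of "\<lambda>k. std_unit i k + std_unit j k"] ij Sji unfolding uij by (auto simp: bilinear mat_app_std_unit)
  have e: "x i * x j = ((x i + x j)\<^sup>2 - (x i)\<^sup>2 - (x j)\<^sup>2) / 2" for x :: "nat \<Rightarrow> real"
    by (simp add: power2_eq_square algebra_simps)
  show "integrable \<mu> (\<lambda>x. x i * x j)" unfolding e using I J IJ by simp
  show "(\<integral>x. x i * x j \<partial>\<mu>) = S i j" unfolding e using I J IJ by simp
qed

lemma quadratic_expectation:
  shows "integrable \<mu> (\<lambda>x. dot p x (mat_app p A x))" "(\<integral>x. dot p x (mat_app p A x) \<partial>\<mu>) = trace_prod p A S"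
proof -
  have e: "dot p x (mat_app p A x) = (\<Sum>i<p. \<Sum>j<p. A i j * (x i * x j))" for x
    by (simp add: dot_def mat_app_def sum_distrib_left mult_ac)
  show "integrable \<mu> (\<lambda>x. dot p x (mat_app p A x))"
    unfolding e using covariance by (intro Bochner_Integration.integrable_sum integrable_mult_right) auto
  show "(\<integral>x. dot p x (mat_app p A x) \<partial>\<mu>) = trace_prod p A S"
    unfolding e trace_prod_def using covariance
    by (subst Bochner_Integration.integral_sum, (intro Bochner_Integration.integrable_sum integrable_mult_right, auto)[1],
       intro sum.cong refl, subst Bochner_Integration.integral_sum) auto
qed

text \<open>Jensen's inequality, in the form that the exponential lies above its tangent at the mean.\<close>

lemma quad_mgf_ge: "ennreal (exp (trace_prod p A S)) \<le> quad_mgf A"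
proof -
  define \<tau> where "\<tau> = trace_prod p A S"
  define f where "f x = exp \<tau> * (1 + (dot p x (mat_app p A x) - \<tau>))" for x
  have f: "integrable \<mu> f" "(\<integral>x. f x \<partial>\<mu>) = exp \<tau>"
    unfolding f_def using quadratic_expectation[of A] by (auto simp: \<tau>_def prob_space)
  have "f x \<le> exp (dot p x (mat_app p A x))" for x
  proof -
    have "f x \<le> exp \<tau> * exp (dot p x (mat_app p A x) - \<tau>)"
      unfolding f_def by (intro mult_left_mono exp_ge_add_one_self) auto
    then show ?thesis by (simp add: exp_add[symmetric])
  qed
  then have "(\<integral>\<^sup>+x. ennreal (f x) \<partial>\<mu>) \<le> quad_mgf A"
    unfolding quad_mgf_def by (intro nn_integral_mono ennreal_leI)
  moreover have "ennreal (exp \<tau>) \<le> (\<integral>\<^sup>+x. ennreal (f x) \<partial>\<mu>)"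
  proof -
    have "(\<integral>x. f x \<partial>\<mu>) \<le> (\<integral>x. max 0 (f x) \<partial>\<mu>)"
      using f(1) by (intro integral_mono) auto
    then have "ennreal (exp \<tau>) \<le> ennreal (\<integral>x. max 0 (f x) \<partial>\<mu>)" using f by (intro ennreal_leI) simp
    also have "\<dots> = (\<integral>\<^sup>+x. ennreal (max 0 (f x)) \<partial>\<mu>)"
      using f(1) by (intro nn_integral_eq_integral[symmetric]) auto
    also have "\<dots> = (\<integral>\<^sup>+x. ennreal (f x) \<partial>\<mu>)"
      by (intro nn_integral_cong) (simp add: max_def ennreal_neg)
    finally show ?thesis .
  qed
  ultimately show ?thesis unfolding \<tau>_def by (rule order.trans[rotated])
qed

lemma quad_mgf_step:
  assumes A: "sym_on p A"
  shows "quad_mgf A \<le> ennreal (exp (trace_prod p A S)) * quad_mgf (sandwich p S A)"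
proof -
  define \<tau> where "\<tau> = trace_prod p A S"
  have "ennreal (exp (- \<tau>)) \<le> quad_mgf (\<lambda>i j. - A i j)"
    using quad_mgf_ge[of "\<lambda>i j. - A i j"] by (simp add: \<tau>_def trace_prod_def sum_negf)
  then have "quad_mgf A * ennreal (exp (- \<tau>)) \<le> quad_mgf (sandwich p S A)"
    unfolding quad_mgf_sandwich[OF A, symmetric] by (rule mult_left_mono) simp
  then have "ennreal (exp \<tau>) * (quad_mgf A * ennreal (exp (- \<tau>))) \<le> ennreal (exp \<tau>) * quad_mgf (sandwich p S A)"
    by (rule mult_left_mono) simp
  moreover have "ennreal (exp \<tau>) * (quad_mgf A * ennreal (exp (- \<tau>))) = quad_mgf A"
  proof -
    have "ennreal (exp \<tau>) * (quad_mgf A * ennreal (exp (- \<tau>))) = quad_mgf A * (ennreal (exp \<tau>) * ennreal (exp (- \<tau>)))"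
      by (simp add: mult_ac)
    also have "ennreal (exp \<tau>) * ennreal (exp (- \<tau>)) = 1"
      by (simp add: ennreal_mult[symmetric] exp_add[symmetric])
    finally show ?thesis by simp
  qed
  ultimately show ?thesis by (simp add: \<tau>_def)
qed

text \<open>A crude majorant for forms with small operator norm. Its dependence on \<open>p\<close> is harmless because it is
evaluated only at arguments tending to 0.\<close>

definition radial_mgf :: "real \<Rightarrow> ennreal" where
  "radial_mgf a = (\<integral>\<^sup>+x. ennreal (exp (a * sq_len p x)) \<partial>\<mu>)"

text \<open>Convexity of the exponential replaces the sum of the dependent squares by the average of the individual
exponentials, each of which is a one-dimensional Gaussian integral.\<close>

lemma radial_mgf_le:
  assumes S: "op_bound p S \<psi>" and a: "0 \<le> a" "2 * (real p * a) * \<psi> < 1" and p: "p > 0"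
  shows "radial_mgf a \<le> ennreal (1 / sqrt (1 - 2 * (real p * a) * \<psi>))"
proof -
  let ?c = "real p * a"
  have pt: "exp (a * sq_len p x) \<le> (\<Sum>i<p. (1 / real p) * exp (?c * (x i)\<^sup>2))" for x
  proof -
    have "exp (\<Sum>i\<in>{..<p}. (1 / real p) *\<^sub>R (?c * (x i)\<^sup>2)) \<le> (\<Sum>i\<in>{..<p}. (1 / real p) * exp (?c * (x i)\<^sup>2))"
      using p by (intro convex_on_sum[OF _ _ exp_convex]) auto
    moreover have "(\<Sum>i\<in>{..<p}. (1 / real p) *\<^sub>R (?c * (x i)\<^sup>2)) = a * sq_len p x"
      using p by (simp add: sq_len_def sum_distrib_left)
    ultimately show ?thesis by simp
  qed
  have "radial_mgf a \<le> (\<integral>\<^sup>+x. (\<Sum>i<p. ennreal (1 / real p) * ennreal (exp (?c * (x i)\<^sup>2))) \<partial>\<mu>)"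
    unfolding radial_mgf_def
    by (intro nn_integral_mono) (use pt in \<open>simp add: ennreal_mult[symmetric] sum_ennreal ennreal_leI\<close>)
  also have "\<dots> = (\<Sum>i<p. ennreal (1 / real p) * (\<integral>\<^sup>+x. ennreal (exp (?c * (x i)\<^sup>2)) \<partial>\<mu>))"
    by (subst nn_integral_sum) (auto simp: nn_integral_cmult)
  also have "\<dots> \<le> (\<Sum>i<p. ennreal (1 / real p) * ennreal (1 / sqrt (1 - 2 * ?c * \<psi>)))"
  proof (intro sum_mono mult_left_mono)
    fix i assume "i \<in> {..<p}"
    then have i: "i < p" by simp
    have v: "dot p (std_unit i) (mat_app p S (std_unit i)) = S i i" using i by (simp add: dot_std_unit mat_app_std_unit)
    have Sii: "0 \<le> S i i" "S i i \<le> \<psi>"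
      using psd_S[of "std_unit i"] op_bound_diag[OF S i] v by auto
    then have le: "2 * ?c * S i i \<le> 2 * ?c * \<psi>" using a by (intro mult_left_mono) auto
    have "(\<integral>\<^sup>+x. ennreal (exp (?c * (x i)\<^sup>2)) \<partial>\<mu>) = ennreal (1 / sqrt (1 - 2 * ?c * S i i))"
      using normal_exp_quadratic[OF law psd_S dot_measurable, of ?c "std_unit i"] le a i
      by (simp add: v dot_std_unit)
    also have "\<dots> \<le> ennreal (1 / sqrt (1 - 2 * ?c * \<psi>))"
      using le a by (intro ennreal_leI divide_left_mono) auto
    finally show "(\<integral>\<^sup>+x. ennreal (exp (?c * (x i)\<^sup>2)) \<partial>\<mu>) \<le> ennreal (1 / sqrt (1 - 2 * ?c * \<psi>))" .
  qed simp
  also have "\<dots> = ennreal (1 / sqrt (1 - 2 * ?c * \<psi>))"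
  proof -
    have "of_nat p * ennreal (1 / real p) = 1"
      using p by (simp add: ennreal_of_nat_eq_real_of_nat ennreal_mult[symmetric])
    then show ?thesis by (simp add: mult.assoc[symmetric])
  qed
  finally show ?thesis .
qed

text \<open>After \<open>K\<close> steps the operator norm has dropped to at most \<open>a / 2^K\<close>, as \<open>4\<psi>a \<le> 1\<close> makes each step at least
halve it. The constant 8/3 is the fixed point of the recursion: a step contributes a trace of at most \<open>2\<psi>\<^sup>2\<close> times the
squared Frobenius norm and divides the latter by at least 4, and \<open>2 + 1/4 \<cdot> 8/3 = 8/3\<close>. The factor
\<open>exp (p\<psi>a / 2^K)\<close> is there because the trace may be negative when the iteration stops.\<close>

lemma quad_mgf_iterated:
  assumes S: "op_bound p S \<psi>" 
    and "sym_on p A" "op_bound p A a" "4 * \<psi> * a \<le> 1"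
  shows "quad_mgf A \<le> ennreal (exp (trace_prod p A S + 8 / 3 * \<psi>\<^sup>2 * frob_sq p A))
           * (ennreal (exp (real p * \<psi> * (a / 2 ^ K))) * radial_mgf (a / 2 ^ K))"
  using assms(2-)
proof (induction K arbitrary: A a)
  case 0
  have "dot p x (mat_app p A x) \<le> a * sq_len p x" for x
    using op_bound_quadratic[OF 0(2), of x] by auto
  then have "quad_mgf A \<le> radial_mgf a"
    unfolding quad_mgf_def radial_mgf_def by (intro nn_integral_mono ennreal_leI) simp
  also have "\<dots> = 1 * radial_mgf a" by simp
  also have "\<dots> \<le> ennreal (exp (trace_prod p A S + 8 / 3 * \<psi>\<^sup>2 * frob_sq p A) * exp (real p * \<psi> * a)) * radial_mgf a"
  proof (intro mult_right_mono)
    have "0 \<le> 8 / 3 * \<psi>\<^sup>2 * frob_sq p A" by (simp add: frob_sq_nonneg)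
    then have "0 \<le> trace_prod p A S + 8 / 3 * \<psi>\<^sup>2 * frob_sq p A + real p * \<psi> * a"
      using trace_prod_ge[OF 0(2) S] by linarith
    then show "1 \<le> ennreal (exp (trace_prod p A S + 8 / 3 * \<psi>\<^sup>2 * frob_sq p A) * exp (real p * \<psi> * a))"
      by (simp add: exp_add[symmetric])
  qed simp
  finally show ?case by (simp add: ennreal_mult mult.assoc)
next
  case (Suc K)
  let ?A = "sandwich p S A"
  note A = Suc.prems(1,2)
  have pos: "0 \<le> a" "0 \<le> \<psi>" using A S by (auto simp: op_bound_def)
  have opA: "op_bound p ?A (a / 2)"
  proof (rule op_bound_mono[OF op_bound_sandwich[OF A(2) S]])
    show "2 * \<psi> * a\<^sup>2 \<le> a / 2"
      using mult_right_mono[OF Suc.prems(3) pos(1)] by (simp add: power2_eq_square algebra_simps)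
  qed
  have "4 * \<psi> * (a / 2) \<le> 1" using Suc.prems(3) pos by simp
  note IH = Suc.IH[OF sym_on_sandwich[OF A(1) sym_S] opA this]
  have f: "\<psi>\<^sup>2 * frob_sq p ?A \<le> \<psi>\<^sup>2 * (frob_sq p A / 4)"
  proof (rule mult_left_mono)
    have "(4 * \<psi> * a)\<^sup>2 \<le> 1" using Suc.prems(3) pos by (simp add: power_le_one)
    then have "4 * a\<^sup>2 * \<psi>\<^sup>2 \<le> 1 / 4" by (simp add: power_mult_distrib mult_ac)
    then have "4 * a\<^sup>2 * \<psi>\<^sup>2 * frob_sq p A \<le> 1 / 4 * frob_sq p A" by (intro mult_right_mono frob_sq_nonneg)
    then show "frob_sq p ?A \<le> frob_sq p A / 4" using frob_sq_sandwich[OF A(2) S] by simp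
  qed simp
  have le: "trace_prod p ?A S + 8 / 3 * \<psi>\<^sup>2 * frob_sq p ?A \<le> 8 / 3 * \<psi>\<^sup>2 * frob_sq p A"
    using trace_sandwich_le[OF A(1) sym_S S] f by (simp add: mult.assoc)
  let ?R = "ennreal (exp (real p * \<psi> * (a / 2 ^ Suc K))) * radial_mgf (a / 2 ^ Suc K)"
  have "quad_mgf A \<le> ennreal (exp (trace_prod p A S)) * quad_mgf ?A"
    by (rule quad_mgf_step[OF A(1)])
  also have "\<dots> \<le> ennreal (exp (trace_prod p A S)) * (ennreal (exp (trace_prod p ?A S + 8 / 3 * \<psi>\<^sup>2 * frob_sq p ?A)) * ?R)"
    using IH by (intro mult_left_mono) (simp_all add: mult.assoc)
  also have "\<dots> \<le> ennreal (exp (trace_prod p A S)) * (ennreal (exp (8 / 3 * \<psi>\<^sup>2 * frob_sq p A)) * ?R)"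
    using le by (intro mult_left_mono mult_right_mono ennreal_leI) auto
  also have "\<dots> = ennreal (exp (trace_prod p A S + 8 / 3 * \<psi>\<^sup>2 * frob_sq p A)) * ?R"
    by (simp add: exp_add ennreal_mult mult.assoc)
  finally show ?case .
qed

theorem quad_mgf_le:
  assumes S: "op_bound p S \<psi>" and p: "p > 0"
    and A: "sym_on p A" "op_bound p A a" "4 * \<psi> * a \<le> 1"
  shows "quad_mgf A \<le> ennreal (exp (trace_prod p A S + 8 / 3 * \<psi>\<^sup>2 * frob_sq p A))"
proof -
  define C where "C = exp (trace_prod p A S + 8 / 3 * \<psi>\<^sup>2 * frob_sq p A)"
  define b where "b K = a / 2 ^ K" for K :: nat
  have pos: "0 \<le> a" "0 \<le> \<psi>" using A S by (auto simp: op_bound_def)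
  have b0: "b \<longlonglongrightarrow> 0" unfolding b_def by real_asymp
  have "(\<lambda>K. 2 * (real p * b K) * \<psi>) \<longlonglongrightarrow> 2 * (real p * 0) * \<psi>"
    by (intro tendsto_intros b0)
  then have ev: "\<forall>\<^sub>F K in sequentially. 2 * (real p * b K) * \<psi> < 1"
    by (rule order_tendstoD) simp
  define r where "r K = C * (exp (real p * \<psi> * b K) * (1 / sqrt (1 - 2 * (real p * b K) * \<psi>)))" for K
  have "r \<longlonglongrightarrow> C * (exp (real p * \<psi> * 0) * (1 / sqrt (1 - 2 * (real p * 0) * \<psi>)))"
    unfolding r_def by (intro tendsto_intros b0) auto
  then have lim: "(\<lambda>K. ennreal (r K)) \<longlonglongrightarrow> ennreal C"
    by (intro tendsto_ennrealI) simp
  have "\<forall>\<^sub>F K in sequentially. quad_mgf A \<le> ennreal (r K)"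
    using ev
  proof eventually_elim
    case (elim K)
    have "b K \<ge> 0" using pos by (simp add: b_def)
    have "quad_mgf A \<le> ennreal C * (ennreal (exp (real p * \<psi> * b K)) * radial_mgf (b K))"
      unfolding C_def b_def by (rule quad_mgf_iterated[OF S A])
    also have "\<dots> \<le> ennreal C * (ennreal (exp (real p * \<psi> * b K)) * ennreal (1 / sqrt (1 - 2 * (real p * b K) * \<psi>)))"
      using radial_mgf_le[OF S \<open>b K \<ge> 0\<close> elim p] by (intro mult_left_mono) auto
    also have "\<dots> = ennreal (r K)"
      using elim by (simp add: r_def ennreal_mult[symmetric] C_def)
    finally show ?case .
  qed
  then show ?thesis
    using tendsto_lowerbound[OF lim] by (simp add: C_def)
qed

end

section \<open>Averaging over a group of permutations\<close>

locale vertex_group =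
  fixes p :: nat and G :: "(nat \<Rightarrow> nat) set"
  assumes subgroup: "subgroup G (sym_grp p)"
begin

lemma permutes: "g \<in> G \<Longrightarrow> g permutes {..<p}"
  using subgroup.subset[OF subgroup] by (auto simp: sym_grp_def)

lemma less_iff: "g \<in> G \<Longrightarrow> g i < p \<longleftrightarrow> i < p"
  using permutes_in_image[OF permutes, of g i] by simp

lemma id_in: "id \<in> G"
  using subgroup.one_closed[OF subgroup] by (simp add: sym_grp_def)

lemma comp_in: "g \<in> G \<Longrightarrow> h \<in> G \<Longrightarrow> g \<circ> h \<in> G"
  using subgroup.m_closed[OF subgroup, of g h] by (simp add: sym_grp_def)

lemma finite_G: "finite G"
  using finite_permutations[of "{..<p}"] permutes
  by (intro finite_subset[of G "{g. g permutes {..<p}}"]) auto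

lemma card_G: "card G > 0"
  using finite_G id_in by (auto simp: card_gt_0_iff)

text \<open>An injective self-map of a finite set is onto; this stands in for the inverse of \<open>g\<close> in all reindexings of
sums over \<open>G\<close>.\<close>

lemma bij_comp_right:
  assumes "g \<in> G"
  shows "bij_betw (\<lambda>h. h \<circ> g) G G"
proof -
  have "surj g" using permutes_surj[OF permutes[OF assms]] .
  then have inj: "inj_on (\<lambda>h. h \<circ> g) G" by (auto intro!: inj_onI simp: fun_eq_iff) (metis surjD)
  have "(\<lambda>h. h \<circ> g) ` G = G"
    using comp_in assms inj by (intro endo_inj_surj finite_G) auto
  then show ?thesis using inj by (simp add: bij_betw_def)
qed

definition group_avg :: "(nat \<Rightarrow> nat \<Rightarrow> real) \<Rightarrow> nat \<Rightarrow> nat \<Rightarrow> real" where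
  "group_avg B i j = (\<Sum>g\<in>G. B (g i) (g j)) / card G"

lemma group_avg_shift:
  assumes "g \<in> G"
  shows "group_avg B (g i) (g j) = group_avg B i j"
proof -
  have "(\<Sum>h\<in>G. B (h (g i)) (h (g j))) = (\<Sum>h\<in>G. B (h i) (h j))"
    using sum.reindex_bij_betw[OF bij_comp_right[OF assms], of "\<lambda>h. B (h i) (h j)"] by simp
  then show ?thesis by (simp add: group_avg_def)
qed

lemma group_avg_invariant:
  assumes "\<And>g. g \<in> G \<Longrightarrow> B (g i) (g j) = B i j"
  shows "group_avg B i j = B i j"
  using assms card_G by (simp add: group_avg_def)

lemma invariant_mat_iff:
  assumes A: "A \<in> carrier_mat p p"
  shows "invariant_mat p G A \<longleftrightarrow> (\<forall>g\<in>G. \<forall>i<p. \<forall>j<p. A $$ (g i, g j) = A $$ (i, j))"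
proof -
  have entry: "(perm_mat p g * A * transpose_mat (perm_mat p g)) $$ (g i, g j) = A $$ (i, j)"
    if g: "g \<in> G" and ij: "i < p" "j < p" for g i j
  proof -
    have inj: "g a = g b \<longleftrightarrow> a = b" for a b
      using permutes_inj[OF permutes[OF g]] by (auto dest: injD)
    have gl: "g i < p" "g j < p" using ij less_iff[OF g] by auto
    have P: "perm_mat p g \<in> carrier_mat p p" by (simp add: perm_mat_def)
    define Q where "Q = perm_mat p g * A"
    have Q: "Q \<in> carrier_mat p p" using P A by (simp add: Q_def)
    have row: "Q $$ (g i, c) = A $$ (i, c)" if "c < p" for c
      using A P gl ij that unfolding Q_def
      by (simp add: scalar_prod_def perm_mat_def inj if_distrib[of "\<lambda>x. x * _"] cong: if_cong)
    have "(perm_mat p g * A * transpose_mat (perm_mat p g)) $$ (g i, g j)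
        = (\<Sum>c<p. Q $$ (g i, c) * perm_mat p g $$ (g j, c))"
      using Q P gl unfolding Q_def[symmetric] by (simp add: scalar_prod_def lessThan_atLeast0)
    also have "\<dots> = (\<Sum>c<p. A $$ (i, c) * (if j = c then 1 else 0))"
      using gl row by (intro sum.cong) (auto simp: perm_mat_def inj)
    also have "\<dots> = A $$ (i, j)"
      using ij by (simp add: if_distrib[of "\<lambda>x. _ * x"] cong: if_cong)
    finally show ?thesis .
  qed
  show ?thesis
  proof
    assume inv: "invariant_mat p G A"
    show "\<forall>g\<in>G. \<forall>i<p. \<forall>j<p. A $$ (g i, g j) = A $$ (i, j)"
      using inv entry by (auto simp: invariant_mat_def)
  next
    assume inv: "\<forall>g\<in>G. \<forall>i<p. \<forall>j<p. A $$ (g i, g j) = A $$ (i, j)"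
    show "invariant_mat p G A"
      unfolding invariant_mat_def
    proof (intro ballI eq_matI)
      fix g a b assume g: "g \<in> G" and ab: "a < dim_row A" "b < dim_col A"
      have "g ` {..<p} = {..<p}" using permutes_image[OF permutes[OF g]] .
      moreover have "a \<in> {..<p}" "b \<in> {..<p}" using ab A by auto
      ultimately have "a \<in> g ` {..<p}" "b \<in> g ` {..<p}" by simp_all
      then obtain i j where "i < p" "j < p" "a = g i" "b = g j" by auto
      then show "(perm_mat p g * A * transpose_mat (perm_mat p g)) $$ (a, b) = A $$ (a, b)"
        using entry[OF g] inv g by simp
    qed (use A in \<open>auto simp: perm_mat_def\<close>)
  qed
qed

text \<open>The average is invariant, and reindexing the entries by \<open>g\<close> shows that it has the same inner product as \<open>A\<close>
with every invariant matrix; both properties together characterise the projection.\<close>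

lemma frob_proj_eq_group_avg:
  assumes A: "A \<in> carrier_mat p p"
  shows "frob_proj p (invariant_subspace p G) A = mat p p (\<lambda>(i, j). group_avg (\<lambda>a b. A $$ (a, b)) i j)"
proof -
  let ?W = "invariant_subspace p G"
  define B where "B = mat p p (\<lambda>(i, j). group_avg (\<lambda>a b. A $$ (a, b)) i j)"
  have B: "B \<in> carrier_mat p p" by (simp add: B_def)
  have Wiff: "C \<in> ?W \<longleftrightarrow> C \<in> carrier_mat p p \<and> (\<forall>g\<in>G. \<forall>i<p. \<forall>j<p. C $$ (g i, g j) = C $$ (i, j))" for C
    using invariant_mat_iff by (auto simp: invariant_subspace_def)
  have BW: "B \<in> ?W" unfolding Wiff using B group_avg_shift by (auto simp: B_def less_iff)
  have diff: "frob_inner p (C - D) E = frob_inner p C E - frob_inner p D E"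
    if "C \<in> carrier_mat p p" "D \<in> carrier_mat p p" for C D E
    using that by (simp add: frob_inner_def sum_subtractf[symmetric] left_diff_distrib)
  have orth: "frob_inner p (A - B) C = 0" if C: "C \<in> ?W" for C
  proof -
    have re: "(\<Sum>i<p. \<Sum>j<p. A $$ (g i, g j) * C $$ (i, j)) = frob_inner p A C" if g: "g \<in> G" for g
    proof -
      have bij: "bij_betw g {..<p} {..<p}" using permutes_imp_bij[OF permutes[OF g]] .
      have "(\<Sum>i<p. \<Sum>j<p. A $$ (g i, g j) * C $$ (i, j)) = (\<Sum>i<p. \<Sum>j<p. A $$ (g i, g j) * C $$ (g i, g j))"
        using C g by (intro sum.cong refl) (auto simp: Wiff)
      also have "\<dots> = (\<Sum>i<p. \<Sum>j<p. A $$ (g i, j) * C $$ (g i, j))"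
        by (intro sum.cong refl sum.reindex_bij_betw[OF bij])
      also have "\<dots> = (\<Sum>i<p. \<Sum>j<p. A $$ (i, j) * C $$ (i, j))"
        by (rule sum.reindex_bij_betw[OF bij, of "\<lambda>i. \<Sum>j<p. A $$ (i, j) * C $$ (i, j)"])
      finally show ?thesis by (simp add: frob_inner_def)
    qed
    have "frob_inner p B C = (\<Sum>i<p. \<Sum>j<p. \<Sum>g\<in>G. A $$ (g i, g j) * C $$ (i, j) / card G)"
      by (simp add: frob_inner_def B_def group_avg_def sum_distrib_right sum_divide_distrib)
    also have "\<dots> = (\<Sum>i<p. \<Sum>g\<in>G. \<Sum>j<p. A $$ (g i, g j) * C $$ (i, j) / card G)"
      by (intro sum.cong refl sum.swap)
    also have "\<dots> = (\<Sum>g\<in>G. \<Sum>i<p. \<Sum>j<p. A $$ (g i, g j) * C $$ (i, j) / card G)"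
      by (rule sum.swap)
    also have "\<dots> = (\<Sum>g\<in>G. frob_inner p A C / card G)"
      by (intro sum.cong refl) (simp add: re[symmetric] sum_divide_distrib)
    also have "\<dots> = frob_inner p A C" using card_G by simp
    finally show ?thesis using diff[OF A B] by simp
  qed
  show ?thesis
    unfolding frob_proj_def B_def[symmetric]
  proof (rule the_equality)
    show "B \<in> ?W \<and> (\<forall>C\<in>?W. frob_inner p (A - B) C = 0)" using BW orth by blast
  next
    fix B' assume B': "B' \<in> ?W \<and> (\<forall>C\<in>?W. frob_inner p (A - B') C = 0)"
    then have B'c: "B' \<in> carrier_mat p p" by (simp add: Wiff)
    define D where "D = B - B'"
    have D: "D \<in> ?W" using BW B' B B'c by (auto simp: Wiff D_def less_iff)
    have "frob_inner p D D = frob_inner p (A - B') D - frob_inner p (A - B) D"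
      using diff[OF A B'c, of D] diff[OF A B, of D] diff[OF B B'c, of D] by (simp add: D_def)
    also have "\<dots> = 0" using D B' orth by simp
    finally have "(\<Sum>i<p. \<Sum>j<p. (D $$ (i, j))\<^sup>2) = 0" by (simp add: frob_inner_def power2_eq_square)
    then have "\<forall>i<p. \<forall>j<p. D $$ (i, j) = 0"
      by (subst (asm) sum_nonneg_eq_0_iff) (auto simp: sum_nonneg sum_nonneg_eq_0_iff)
    then show "B' = B" using B B'c by (intro eq_matI) (auto simp: D_def)
  qed
qed

text \<open>The symmetric matrix whose pairing with a symmetric \<open>B\<close> averages \<open>B\<close> over the orbit of \<open>(i, j)\<close>. Counting group elements instead of
edges treats loops and proper edges alike.\<close>

definition orbit_weight :: "nat \<Rightarrow> nat \<Rightarrow> nat \<Rightarrow> nat \<Rightarrow> real" where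
  "orbit_weight i j a b = (card {g\<in>G. g i = a \<and> g j = b} + card {g\<in>G. g i = b \<and> g j = a}) / (2 * card G)"

lemma orbit_weight_nonneg: "0 \<le> orbit_weight i j a b"
  by (simp add: orbit_weight_def)

lemma orbit_weight_sym: "orbit_weight i j a b = orbit_weight i j b a"
  by (simp add: orbit_weight_def add.commute)

lemma trace_orbit_weight:
  assumes ij: "i < p" "j < p" and B: "sym_on p B"
  shows "trace_prod p (orbit_weight i j) B = group_avg B i j"
proof -
  have count: "(\<Sum>a<p. \<Sum>b<p. card {g\<in>G. g i = a \<and> g j = b} * B a b) = (\<Sum>g\<in>G. B (g i) (g j))" if "i < p" "j < p" for i j
  proof -
    have "(\<Sum>a<p. \<Sum>b<p. card {g\<in>G. g i = a \<and> g j = b} * B a b)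
        = (\<Sum>a<p. \<Sum>b<p. \<Sum>g\<in>G. if g i = a \<and> g j = b then B a b else 0)"
      using finite_G by (intro sum.cong refl) (simp add: sum.If_cases Int_def)
    also have "\<dots> = (\<Sum>a<p. \<Sum>g\<in>G. \<Sum>b<p. if g i = a \<and> g j = b then B a b else 0)"
      by (intro sum.cong refl sum.swap)
    also have "\<dots> = (\<Sum>g\<in>G. \<Sum>a<p. \<Sum>b<p. if g i = a \<and> g j = b then B a b else 0)"
      by (rule sum.swap)
    also have "\<dots> = (\<Sum>g\<in>G. B (g i) (g j))"
    proof (intro sum.cong refl)
      fix g assume g: "g \<in> G"
      have "(\<Sum>a<p. \<Sum>b<p. if g i = a \<and> g j = b then B a b else 0)
          = (\<Sum>a<p. if g i = a then (\<Sum>b<p. if g j = b then B a b else 0) else 0)"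
        by (intro sum.cong refl) auto
      also have "\<dots> = B (g i) (g j)" using that less_iff[OF g] by simp
      finally show "(\<Sum>a<p. \<Sum>b<p. if g i = a \<and> g j = b then B a b else 0) = B (g i) (g j)" .
    qed
    finally show ?thesis .
  qed
  have sym: "(\<Sum>g\<in>G. B (g j) (g i)) = (\<Sum>g\<in>G. B (g i) (g j))"
    using B ij by (intro sum.cong) (auto simp: sym_on_def less_iff)
  have "trace_prod p (orbit_weight i j) B
      = ((\<Sum>a<p. \<Sum>b<p. card {g\<in>G. g i = a \<and> g j = b} * B a b) + (\<Sum>a<p. \<Sum>b<p. card {g\<in>G. g j = a \<and> g i = b} * B a b)) / (2 * card G)"
    by (simp add: trace_prod_def orbit_weight_def sum_divide_distrib sum.distrib[symmetric] algebra_simps add_divide_distrib conj_commute)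
  also have "\<dots> = (2 * (\<Sum>g\<in>G. B (g i) (g j))) / (2 * card G)"
    unfolding count[OF ij] count[OF ij(2,1)] sym by simp
  finally show ?thesis by (simp add: group_avg_def)
qed

lemma orbit_weight_sum:
  assumes ij: "i < p" "j < p"
  shows "(\<Sum>a<p. \<Sum>b<p. orbit_weight i j a b) = 1"
  using trace_orbit_weight[OF ij, of "\<lambda>_ _. 1"] card_G by (simp add: sym_on_def group_avg_def trace_prod_def)

lemma finite_edge_orbit: "finite (edge_orbit G i j)"
  using finite_G by (simp add: edge_orbit_def)

lemma edge_in_orbit: "{i, j} \<in> edge_orbit G i j"
  unfolding edge_orbit_def by (rule image_eqI[of _ _ id]) (use id_in in auto)

lemma card_edge_orbit: "card (edge_orbit G i j) > 0"
  using finite_edge_orbit edge_in_orbit[of i j] by (auto simp: card_gt_0_iff)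

text \<open>Orbit-stabiliser: left composition with a suitable group element maps the fibre over one edge injectively into the
fibre over any other, so all fibres of \<open>g \<mapsto> {g i, g j}\<close> have the same size.\<close>

lemma fibre_card:
  assumes e: "e \<in> edge_orbit G i j"
  shows "card (edge_orbit G i j) * card {g\<in>G. {g i, g j} = e} = card G"
proof -
  let ?F = "\<lambda>e. {g\<in>G. {g i, g j} = e}"
  have le: "card (?F e) \<le> card (?F e')" if e: "e \<in> edge_orbit G i j" and e': "e' \<in> edge_orbit G i j" for e e'
  proof -
    obtain g g' where g: "g \<in> G" "e = {g i, g j}" and g': "g' \<in> G" "e' = {g' i, g' j}"
      using e e' by (auto simp: edge_orbit_def)
    obtain k where k: "k \<in> G" "k \<circ> g = g'"
      using bij_comp_right[OF g(1)] g'(1) by (metis (no_types, lifting) bij_betw_def image_iff)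
    have "inj_on (\<lambda>h. k \<circ> h) (?F e)"
    proof (rule inj_onI)
      fix x y assume "k \<circ> x = k \<circ> y"
      then have "k (x a) = k (y a)" for a by (metis comp_apply)
      then show "x = y" using permutes_inj[OF permutes[OF k(1)]] by (simp add: inj_eq fun_eq_iff)
    qed
    moreover have "(\<lambda>h. k \<circ> h) ` ?F e \<subseteq> ?F e'"
    proof (rule image_subsetI)
      fix h assume "h \<in> ?F e"
      then have h: "h \<in> G" "{h i, h j} = {g i, g j}" using g by simp_all
      then have "k ` {h i, h j} = k ` {g i, g j}" by simp
      then have "{(k \<circ> h) i, (k \<circ> h) j} = {(k \<circ> g) i, (k \<circ> g) j}" by simp
      then show "k \<circ> h \<in> ?F e'" using comp_in[OF k(1) h(1)] by (simp add: k(2) g'(2))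
    qed
    ultimately show ?thesis using finite_G by (intro card_inj_on_le) auto
  qed
  have "card G = (\<Sum>e'\<in>edge_orbit G i j. card (?F e'))"
  proof -
    have "G = (\<Union>e'\<in>edge_orbit G i j. ?F e')" by (auto simp: edge_orbit_def)
    then have "card G = card (\<Union>e'\<in>edge_orbit G i j. ?F e')" by simp
    also have "\<dots> = (\<Sum>e'\<in>edge_orbit G i j. card (?F e'))"
      using finite_G finite_edge_orbit by (intro card_UN_disjoint) auto
    finally show ?thesis .
  qed
  also have "\<dots> = (\<Sum>e'\<in>edge_orbit G i j. card (?F e))"
    using le e by (intro sum.cong refl antisym) auto
  finally show ?thesis by simp
qed

lemma orbit_weight_le: "orbit_weight i j a b \<le> (if {a, b} \<in> edge_orbit G i j then 1 / card (edge_orbit G i j) else 0)"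
proof (cases "{a, b} \<in> edge_orbit G i j")
  case True
  let ?F = "{g\<in>G. {g i, g j} = {a, b}}"
  have "{g\<in>G. g i = a \<and> g j = b} \<subseteq> ?F" "{g\<in>G. g i = b \<and> g j = a} \<subseteq> ?F"
    by auto
  then have "card {g\<in>G. g i = a \<and> g j = b} \<le> card ?F" "card {g\<in>G. g i = b \<and> g j = a} \<le> card ?F"
    using finite_G by (simp_all add: card_mono)
  then have "orbit_weight i j a b \<le> (2 * real (card ?F)) / (2 * card G)"
    unfolding orbit_weight_def by (intro divide_right_mono) auto
  also have "\<dots> = real (card ?F) / card G" by simp
  also have "\<dots> = 1 / card (edge_orbit G i j)"
  proof -
    have "real (card (edge_orbit G i j)) * real (card ?F) = real (card G)"
      by (simp only: of_nat_mult[symmetric] fibre_card[OF True])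
    then show ?thesis using card_G card_edge_orbit[of i j] by (simp add: field_simps)
  qed
  finally show ?thesis using True by simp
next
  case False
  then have e: "{g\<in>G. g i = a \<and> g j = b} = {}" "{g\<in>G. g i = b \<and> g j = a} = {}"
    by (auto simp: edge_orbit_def insert_commute)
  have "orbit_weight i j a b = 0" unfolding orbit_weight_def e by simp
  then show ?thesis using False by simp
qed

text \<open>The sum of the squares is at most the largest entry times the total mass, which is one.\<close>

lemma frob_sq_orbit_weight:
  assumes ij: "i < p" "j < p"
  shows "frob_sq p (orbit_weight i j) \<le> 1 / card (edge_orbit G i j)"
proof -
  have "frob_sq p (orbit_weight i j) \<le> (\<Sum>a<p. \<Sum>b<p. 1 / card (edge_orbit G i j) * orbit_weight i j a b)"
    unfolding frob_sq_def power2_eq_square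
  proof (intro sum_mono mult_right_mono orbit_weight_nonneg)
    show "orbit_weight i j a b \<le> 1 / card (edge_orbit G i j)" for a b
      using orbit_weight_le[of i j a b] by (auto split: if_splits intro: order.trans)
  qed
  also have "\<dots> = 1 / card (edge_orbit G i j)"
    by (simp only: sum_distrib_left[symmetric] orbit_weight_sum[OF ij])
  finally show ?thesis .
qed

lemma finite_orbit_nodes: "finite (orbit_nodes G i j)"
  using finite_edge_orbit by (auto simp: orbit_nodes_def edge_orbit_def)

lemma orbit_degree_ge:
  assumes "a \<in> orbit_nodes G i j"
  shows "card {l \<in> orbit_nodes G i j. {a, l} \<in> edge_orbit G i j} \<le> orbit_degree G i j"
  unfolding orbit_degree_def using finite_orbit_nodes assms by (intro Max_ge) auto

lemma orbit_degree_pos: "orbit_degree G i j > 0"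
proof -
  have ij: "i \<in> orbit_nodes G i j" "j \<in> orbit_nodes G i j"
    using edge_in_orbit by (auto simp: orbit_nodes_def)
  then have "j \<in> {l \<in> orbit_nodes G i j. {i, l} \<in> edge_orbit G i j}" using edge_in_orbit by simp
  then have "card {l \<in> orbit_nodes G i j. {i, l} \<in> edge_orbit G i j} > 0"
    unfolding card_gt_0_iff by (intro conjI finite_subset[OF _ finite_orbit_nodes[of i j]]) auto
  with orbit_degree_ge[OF ij(1)] show ?thesis by linarith
qed

text \<open>The nonzero entries of row \<open>a\<close> belong to the neighbours of \<open>a\<close> in the graph formed by the orbit.\<close>

lemma orbit_weight_row_sum:
  shows "(\<Sum>b<p. orbit_weight i j a b) \<le> orbit_degree G i j / card (edge_orbit G i j)"
proof -
  let ?N = "{b. b < p \<and> {a, b} \<in> edge_orbit G i j}"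
  have "(\<Sum>b<p. orbit_weight i j a b) \<le> (\<Sum>b<p. if {a, b} \<in> edge_orbit G i j then 1 / card (edge_orbit G i j) else 0)"
    by (intro sum_mono orbit_weight_le)
  also have "\<dots> = real (card ?N) / card (edge_orbit G i j)"
    by (simp add: sum.If_cases Int_def lessThan_def)
  also have "\<dots> \<le> orbit_degree G i j / card (edge_orbit G i j)"
  proof (cases "?N = {}")
    case True
    then show ?thesis by (simp only: True) simp
  next
    case False
    then have a: "a \<in> orbit_nodes G i j" by (auto simp: orbit_nodes_def)
    have "card ?N \<le> card {l \<in> orbit_nodes G i j. {a, l} \<in> edge_orbit G i j}"
      by (intro card_mono finite_subset[OF _ finite_orbit_nodes[of i j]]) (auto simp: orbit_nodes_def)
    with orbit_degree_ge[OF a] show ?thesis by (intro divide_right_mono) auto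
  qed
  finally show ?thesis .
qed

lemma op_bound_orbit_weight:
  "op_bound p (orbit_weight i j) (orbit_degree G i j / card (edge_orbit G i j))"
  by (rule op_bound_row_sums[OF orbit_weight_nonneg orbit_weight_sym orbit_weight_row_sum])

lemma min_orbit_le: "i < p \<Longrightarrow> j < p \<Longrightarrow> min_orbit p G \<le> card (edge_orbit G i j)"
  unfolding min_orbit_def
  by (intro Min_le finite_subset[OF _ finite_imageI[OF finite_cartesian_product[OF finite_lessThan[of p] finite_lessThan[of p]], of "\<lambda>(i, j). card (edge_orbit G i j)"]]) force+

lemma min_orbit_deg_le: "i < p \<Longrightarrow> j < p \<Longrightarrow> min_orbit_deg p G \<le> card (edge_orbit G i j) / orbit_degree G i j"
  unfolding min_orbit_deg_def
  by (intro Min_le finite_subset[OF _ finite_imageI[OF finite_cartesian_product[OF finite_lessThan[of p] finite_lessThan[of p]], of "\<lambda>(i, j). real (card (edge_orbit G i j)) / real (orbit_degree G i j)"]]) force+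

lemma finite_orbits: "finite {edge_orbit G i j | i j. i < p \<and> j < p}"
  by (intro finite_subset[OF _ finite_imageI[OF finite_cartesian_product[OF finite_lessThan[of p] finite_lessThan[of p]], of "\<lambda>(i, j). edge_orbit G i j"]]) force

text \<open>A loop is never in the orbit of a proper edge.\<close>

lemma num_orbits_ge_2:
  assumes "p \<ge> 2"
  shows "num_orbits p G \<ge> 2"
proof -
  have "edge_orbit G 0 0 \<noteq> edge_orbit G 0 1"
  proof
    assume "edge_orbit G 0 0 = edge_orbit G 0 1"
    then have "{0, 1} \<in> edge_orbit G 0 0" using edge_in_orbit by metis
    then obtain g where "{0, 1 :: nat} = {g 0}" by (auto simp: edge_orbit_def)
    then have "0 = g 0" "1 = g 0" by blast+
    then show False by simp
  qed
  then have "card {edge_orbit G 0 0, edge_orbit G 0 1} = 2" by simp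
  moreover have "card {edge_orbit G 0 0, edge_orbit G 0 1} \<le> num_orbits p G"
    unfolding num_orbits_def using assms by (intro card_mono finite_orbits) force
  ultimately show ?thesis by simp
qed

lemma group_avg_edge_orbit_cong:
  assumes ij: "i < p" "j < p" "i' < p" "j' < p" and eq: "edge_orbit G i j = edge_orbit G i' j'" and B: "sym_on p B"
  shows "group_avg B i j = group_avg B i' j'"
proof -
  have "{i', j'} \<in> edge_orbit G i j" using edge_in_orbit eq by metis
  then obtain g where g: "g \<in> G" "{i', j'} = {g i, g j}" by (auto simp: edge_orbit_def)
  have "group_avg B j i = group_avg B i j"
    unfolding group_avg_def using B ij by (auto intro!: arg_cong[of _ _ "\<lambda>x. x / _"] sum.cong simp: sym_on_def less_iff)
  then show ?thesis
    using g group_avg_shift[OF g(1), of B i j] group_avg_shift[OF g(1), of B j i] by (auto simp: doubleton_eq_iff)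
qed

end

section \<open>Small-ball probability of the chi-square law\<close>

text \<open>Rescaling a standard normal variable by \<open>exp(\<theta>/2)\<close> changes its density by a factor that depends only on
its square. Hence the same is true of sums of squares of independent variables.\<close>

lemma std_normal_square_rescale:
  fixes \<theta> :: real
  assumes [measurable]: "f \<in> borel_measurable borel"
  shows "(\<integral>\<^sup>+y. f (exp \<theta> * y\<^sup>2) \<partial>std_normal_distribution)
    = (\<integral>\<^sup>+y. f (y\<^sup>2) * ennreal (exp (- \<theta> / 2 + (1 - exp (- \<theta>)) / 2 * y\<^sup>2)) \<partial>std_normal_distribution)"
proof -
  define c where "c = exp (\<theta> / 2)"
  have c: "c > 0" "c\<^sup>2 = exp \<theta>" by (simp_all add: c_def exp_double[symmetric])
  have e: "c * (std_normal_density (c * y) * exp (- \<theta> / 2 + (1 - exp (- \<theta>)) / 2 * (c * y)\<^sup>2)) = std_normal_density y" for y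
  proof -
    have "- (c * y)\<^sup>2 / 2 + (- \<theta> / 2 + (1 - exp (- \<theta>)) / 2 * (c * y)\<^sup>2) = - \<theta> / 2 + (- y\<^sup>2 / 2)"
    proof -
      have "exp (- \<theta>) * exp \<theta> = 1" by (simp add: exp_add[symmetric])
      moreover have "(1 - exp (- \<theta>)) / 2 * (c * y)\<^sup>2 = (exp \<theta> - exp (- \<theta>) * exp \<theta>) / 2 * y\<^sup>2"
        by (simp add: power_mult_distrib c(2) field_simps)
      ultimately have "(1 - exp (- \<theta>)) / 2 * (c * y)\<^sup>2 = (exp \<theta> - 1) / 2 * y\<^sup>2" by simp
      then show ?thesis by (simp add: power_mult_distrib c(2) algebra_simps)
    qed
    then have "exp (- (c * y)\<^sup>2 / 2) * exp (- \<theta> / 2 + (1 - exp (- \<theta>)) / 2 * (c * y)\<^sup>2) = exp (- \<theta> / 2) * exp (- y\<^sup>2 / 2)"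
      unfolding exp_add[symmetric] by (rule arg_cong)
    then have "std_normal_density (c * y) * exp (- \<theta> / 2 + (1 - exp (- \<theta>)) / 2 * (c * y)\<^sup>2) = exp (- \<theta> / 2) * std_normal_density y"
      unfolding std_normal_density_def by (simp only: mult.assoc mult.left_commute)
    moreover have "c * exp (- \<theta> / 2) = 1" by (simp add: c_def exp_add[symmetric])
    ultimately show ?thesis by (simp only: mult.assoc[symmetric] mult_1)
  qed
  have "(\<integral>\<^sup>+y. f (y\<^sup>2) * ennreal (exp (- \<theta> / 2 + (1 - exp (- \<theta>)) / 2 * y\<^sup>2)) \<partial>std_normal_distribution)
      = (\<integral>\<^sup>+y. f (y\<^sup>2) * ennreal (std_normal_density y * exp (- \<theta> / 2 + (1 - exp (- \<theta>)) / 2 * y\<^sup>2)) \<partial>lborel)"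
    by (subst nn_integral_density) (auto simp: ennreal_mult mult_ac)
  also have "\<dots> = ennreal \<bar>c\<bar> * (\<integral>\<^sup>+y. f ((0 + c * y)\<^sup>2) * ennreal (std_normal_density (0 + c * y) * exp (- \<theta> / 2 + (1 - exp (- \<theta>)) / 2 * (0 + c * y)\<^sup>2)) \<partial>lborel)"
    using c by (intro nn_integral_real_affine) auto
  also have "\<dots> = (\<integral>\<^sup>+y. ennreal c * (f ((c * y)\<^sup>2) * ennreal (std_normal_density (c * y) * exp (- \<theta> / 2 + (1 - exp (- \<theta>)) / 2 * (c * y)\<^sup>2))) \<partial>lborel)"
    using c by (subst nn_integral_cmult) auto
  also have "\<dots> = (\<integral>\<^sup>+y. f ((c * y)\<^sup>2) * ennreal (c * (std_normal_density (c * y) * exp (- \<theta> / 2 + (1 - exp (- \<theta>)) / 2 * (c * y)\<^sup>2))) \<partial>lborel)"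
    using c by (intro nn_integral_cong) (simp add: ennreal_mult mult_ac)
  also have "\<dots> = (\<integral>\<^sup>+y. f (exp \<theta> * y\<^sup>2) * ennreal (std_normal_density y) \<partial>lborel)"
    unfolding e by (simp add: power_mult_distrib c)
  also have "\<dots> = (\<integral>\<^sup>+y. f (exp \<theta> * y\<^sup>2) \<partial>std_normal_distribution)"
    by (subst nn_integral_density) (auto simp: mult_ac)
  finally show ?thesis by simp
qed

lemma product_normal_rescale:
  fixes \<theta> :: real
  assumes "finite I" and "h \<in> borel_measurable borel"
  shows "(\<integral>\<^sup>+x. h (exp \<theta> * (\<Sum>k\<in>I. (x k)\<^sup>2)) \<partial>PiM I (\<lambda>_. std_normal_distribution))
    = (\<integral>\<^sup>+x. h (\<Sum>k\<in>I. (x k)\<^sup>2) * ennreal (exp (- \<theta> / 2 * card I + (1 - exp (- \<theta>)) / 2 * (\<Sum>k\<in>I. (x k)\<^sup>2)))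
        \<partial>PiM I (\<lambda>_. std_normal_distribution))"
  using assms
proof (induction I arbitrary: h rule: finite_induct)
  case empty
  then show ?case by simp
next
  case (insert i I)
  note [measurable] = insert.prems
  interpret product_sigma_finite "\<lambda>_. std_normal_distribution"
    by (intro product_sigma_finite.intro prob_space_imp_sigma_finite prob_space_normal_density) simp
  define D where "D x = exp (- \<theta> / 2 * card I + (1 - exp (- \<theta>)) / 2 * (\<Sum>k\<in>I. (x k)\<^sup>2))" for x :: "'a \<Rightarrow> real"
  define q where "q x = (\<Sum>k\<in>I. (x k)\<^sup>2)" for x :: "'a \<Rightarrow> real"
  have upd: "q (x(i := y)) = q x" "D (x(i := y)) = D x" for x y
    using insert(2) by (auto simp: q_def D_def intro!: sum.cong arg_cong[of _ _ "\<lambda>s. _ * s"] arg_cong[of _ _ "\<lambda>s. _ + _ * s"])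
  have [measurable]: "q \<in> borel_measurable (PiM (insert i I) (\<lambda>_. std_normal_distribution))"
      "D \<in> borel_measurable (PiM (insert i I) (\<lambda>_. std_normal_distribution))"
      "(\<lambda>x. x i) \<in> borel_measurable (PiM (insert i I) (\<lambda>_. std_normal_distribution))"
      "q \<in> borel_measurable (PiM I (\<lambda>_. std_normal_distribution))"
    unfolding q_def[abs_def] D_def[abs_def]
    by (auto intro!: borel_measurable_sum borel_measurable_power measurable_compose[OF _ borel_measurable_exp] borel_measurable_add borel_measurable_times
         simp: measurable_component_singleton[of _ _ "\<lambda>_. std_normal_distribution", simplified])
  have s: "(\<Sum>k\<in>insert i I. (x k)\<^sup>2) = (x i)\<^sup>2 + q x" for x :: "'a \<Rightarrow> real"
    using insert by (simp add: q_def)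
  have "(\<integral>\<^sup>+x. h (exp \<theta> * (\<Sum>k\<in>insert i I. (x k)\<^sup>2)) \<partial>PiM (insert i I) (\<lambda>_. std_normal_distribution))
      = (\<integral>\<^sup>+x. h (exp \<theta> * (x i)\<^sup>2 + exp \<theta> * q x) \<partial>PiM (insert i I) (\<lambda>_. std_normal_distribution))"
    unfolding s by (simp add: distrib_left)
  also have "\<dots> = (\<integral>\<^sup>+y. \<integral>\<^sup>+x. h (exp \<theta> * y\<^sup>2 + exp \<theta> * q x) \<partial>PiM I (\<lambda>_. std_normal_distribution) \<partial>std_normal_distribution)"
    using insert by (subst product_nn_integral_insert_rev) (auto simp: upd)
  also have "\<dots> = (\<integral>\<^sup>+y. \<integral>\<^sup>+x. h (exp \<theta> * y\<^sup>2 + q x) * ennreal (D x) \<partial>PiM I (\<lambda>_. std_normal_distribution) \<partial>std_normal_distribution)"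
    unfolding q_def D_def by (intro nn_integral_cong insert.IH[of "\<lambda>s. h (exp \<theta> * y\<^sup>2 + s)" for y]) auto
  also have "\<dots> = (\<integral>\<^sup>+x. h (exp \<theta> * (x i)\<^sup>2 + q x) * ennreal (D x) \<partial>PiM (insert i I) (\<lambda>_. std_normal_distribution))"
    using insert by (subst product_nn_integral_insert_rev) (auto simp: upd)
  also have "\<dots> = (\<integral>\<^sup>+x. \<integral>\<^sup>+y. h (exp \<theta> * y\<^sup>2 + q x) * ennreal (D x) \<partial>std_normal_distribution \<partial>PiM I (\<lambda>_. std_normal_distribution))"
    using insert by (subst product_nn_integral_insert) (auto simp: upd)
  also have "\<dots> = (\<integral>\<^sup>+x. \<integral>\<^sup>+y. h (y\<^sup>2 + q x) * ennreal (D x) * ennreal (exp (- \<theta> / 2 + (1 - exp (- \<theta>)) / 2 * y\<^sup>2)) \<partial>std_normal_distribution \<partial>PiM I (\<lambda>_. std_normal_distribution))"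
    by (intro nn_integral_cong std_normal_square_rescale[of "\<lambda>s. h (s + q x) * ennreal (D x)" for x]) auto
  also have "\<dots> = (\<integral>\<^sup>+x. h ((x i)\<^sup>2 + q x) * ennreal (D x) * ennreal (exp (- \<theta> / 2 + (1 - exp (- \<theta>)) / 2 * (x i)\<^sup>2)) \<partial>PiM (insert i I) (\<lambda>_. std_normal_distribution))"
    using insert by (subst product_nn_integral_insert) (auto simp: upd)
  also have "\<dots> = (\<integral>\<^sup>+x. h (\<Sum>k\<in>insert i I. (x k)\<^sup>2) * ennreal (exp (- \<theta> / 2 * card (insert i I) + (1 - exp (- \<theta>)) / 2 * (\<Sum>k\<in>insert i I. (x k)\<^sup>2)))
        \<partial>PiM (insert i I) (\<lambda>_. std_normal_distribution))"
  proof (intro nn_integral_cong)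
    fix x :: "'a \<Rightarrow> real"
    have "D x * exp (- \<theta> / 2 + (1 - exp (- \<theta>)) / 2 * (x i)\<^sup>2)
        = exp (- \<theta> / 2 * card (insert i I) + (1 - exp (- \<theta>)) / 2 * ((x i)\<^sup>2 + q x))"
      using insert(1,2) unfolding D_def q_def[symmetric] exp_add[symmetric]
      by (intro arg_cong[of _ _ exp]) (simp add: field_simps)
    then show "h ((x i)\<^sup>2 + q x) * ennreal (D x) * ennreal (exp (- \<theta> / 2 + (1 - exp (- \<theta>)) / 2 * (x i)\<^sup>2))
        = h (\<Sum>k\<in>insert i I. (x k)\<^sup>2) * ennreal (exp (- \<theta> / 2 * card (insert i I) + (1 - exp (- \<theta>)) / 2 * (\<Sum>k\<in>insert i I. (x k)\<^sup>2)))"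
      unfolding s by (simp add: D_def mult.assoc ennreal_mult[symmetric])
  qed
  finally show ?case .
qed

lemma exp_minus_lower:
  fixes x :: real
  assumes "0 \<le> x"
  shows "x\<^sup>2 / (2 + x) \<le> x - 1 + exp (- x)"
proof -
  have "(2 + 0) * exp (- 0) - (2 - 0) \<le> (2 + x) * exp (- x) - (2 - x)"
  proof (rule DERIV_nonneg_imp_nondecreasing[OF assms])
    fix y :: real assume "0 \<le> y" "y \<le> x"
    have "(1 + y) * exp (- y) \<le> exp y * exp (- y)"
      by (intro mult_right_mono) (auto simp: exp_ge_add_one_self)
    then have "0 \<le> 1 - (1 + y) * exp (- y)" by (simp add: exp_add[symmetric])
    moreover have "((\<lambda>x. (2 + x) * exp (- x) - (2 - x)) has_real_derivative 1 - (1 + y) * exp (- y)) (at y)"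
      by (auto intro!: derivative_eq_intros simp: algebra_simps)
    ultimately show "\<exists>d. ((\<lambda>x. (2 + x) * exp (- x) - (2 - x)) has_real_derivative d) (at y) \<and> 0 \<le> d"
      by blast
  qed
  then have "x\<^sup>2 \<le> (x - 1 + exp (- x)) * (2 + x)" by (simp add: power2_eq_square algebra_simps)
  then show ?thesis using assms by (simp add: divide_le_eq)
qed

text \<open>Below, \<open>T\<close> is a chi-square variable with \<open>n\<close> degrees of freedom.\<close>

context prob_space
begin

context
  fixes n :: nat and Y :: "nat \<Rightarrow> 'a \<Rightarrow> real" and T :: "'a \<Rightarrow> real"
  assumes n: "n \<ge> 1" and indep: "indep_vars (\<lambda>_. borel) Y {1..n}"
    and law: "\<And>k. k \<in> {1..n} \<Longrightarrow> distr M borel (Y k) = std_normal_distribution"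
    and T_def: "T = (\<lambda>\<omega>. \<Sum>k=1..n. (Y k \<omega>)\<^sup>2)"
begin

lemma Y_measurable: "k \<in> {1..n} \<Longrightarrow> Y k \<in> borel_measurable M"
  using indep by (auto simp: indep_vars_def)

lemma chi_square_measurable: "T \<in> borel_measurable M"
  unfolding T_def by (auto intro!: borel_measurable_sum borel_measurable_power Y_measurable)

lemma chi_square_tilt:
  assumes h[measurable]: "h \<in> borel_measurable borel"
  shows "(\<integral>\<^sup>+\<omega>. h (exp \<theta> * T \<omega>) \<partial>M)
    = (\<integral>\<^sup>+\<omega>. h (T \<omega>) * ennreal (exp (- \<theta> / 2 * n + (1 - exp (- \<theta>)) / 2 * T \<omega>)) \<partial>M)"
proof -
  note Y_measurable[measurable] chi_square_measurable[measurable]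
  have "distr M (PiM {1..n} (\<lambda>_. borel)) (\<lambda>\<omega>. \<lambda>k\<in>{1..n}. Y k \<omega>) = PiM {1..n} (\<lambda>k. distr M borel (Y k))"
    using indep n by (subst (asm) indep_vars_iff_distr_eq_PiM') auto
  also have "\<dots> = PiM {1..n} (\<lambda>_. std_normal_distribution)"
    by (intro PiM_cong law) auto
  finally have D: "distr M (PiM {1..n} (\<lambda>_. borel)) (\<lambda>\<omega>. \<lambda>k\<in>{1..n}. Y k \<omega>) = PiM {1..n} (\<lambda>_. std_normal_distribution)" .
  have tr: "(\<integral>\<^sup>+x. f (\<Sum>k\<in>{1..n}. (x k)\<^sup>2) \<partial>PiM {1..n} (\<lambda>_. std_normal_distribution)) = (\<integral>\<^sup>+\<omega>. f (T \<omega>) \<partial>M)"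
    if [measurable]: "f \<in> borel_measurable borel" for f :: "real \<Rightarrow> ennreal"
    unfolding D[symmetric] T_def
    by (subst nn_integral_distr) (auto intro!: measurable_restrict measurable_compose[OF _ that] borel_measurable_sum borel_measurable_power measurable_component_singleton)
  show ?thesis
    using product_normal_rescale[OF _ h, of "{1..n}" \<theta>] tr[of "\<lambda>s. h (exp \<theta> * s)"]
      tr[of "\<lambda>s. h s * ennreal (exp (- \<theta> / 2 * n + (1 - exp (- \<theta>)) / 2 * s))"]
    by simp
qed

text \<open>The tilting density integrates to one, which is Chernoff's bound for both tails: positive \<open>\<theta>\<close> serves
the upper tail, negative \<open>\<theta>\<close> the lower one.\<close>

lemma chi_square_markov:
  assumes "\<And>\<omega>. \<omega> \<in> E \<Longrightarrow> a \<le> - \<theta> / 2 * n + (1 - exp (- \<theta>)) / 2 * T \<omega>" and E: "E \<in> sets M"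
  shows "prob E \<le> exp (- a)"
proof -
  note Y_measurable[measurable] chi_square_measurable[measurable]
  have "ennreal (exp a) * emeasure M E = (\<integral>\<^sup>+\<omega>. ennreal (exp a) * indicator E \<omega> \<partial>M)"
    using E by (subst nn_integral_cmult_indicator) auto
  also have "\<dots> \<le> (\<integral>\<^sup>+\<omega>. 1 * ennreal (exp (- \<theta> / 2 * n + (1 - exp (- \<theta>)) / 2 * T \<omega>)) \<partial>M)"
    using assms(1) by (intro nn_integral_mono) (auto simp: indicator_def intro!: ennreal_leI)
  also have "\<dots> = 1"
    by (subst chi_square_tilt[of "\<lambda>_. 1", symmetric]) (auto simp: emeasure_space_1)
  finally have "exp a * prob E \<le> 1"
    by (simp add: emeasure_eq_measure ennreal_mult[symmetric])
  then show ?thesis by (simp add: exp_minus field_simps)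
qed

text \<open>In the logarithmic scale the window of width \<open>8/\<surd>n\<close> works for every \<open>n\<close>; in the linear scale
the lower end would be negative for small \<open>n\<close>. The number 8 makes both tails at most \<open>exp(-2) \<le> 1/4\<close>.\<close>

lemma chi_square_window:
  assumes \<beta>: "\<beta> = 8 / sqrt n"
  shows "prob {\<omega>\<in>space M. n * exp (- \<beta>) \<le> T \<omega> \<and> T \<omega> \<le> n * exp \<beta>} \<ge> 1 / 2"
proof -
  note Y_measurable[measurable] chi_square_measurable[measurable]
  have sn: "sqrt n \<ge> 1" "sqrt n > 0" using n by auto
  have b: "0 < \<beta>" "\<beta> \<le> 8" "n * \<beta>\<^sup>2 = 64" using sn n unfolding \<beta> by (auto simp: field_simps power_divide)
  let ?U = "{\<omega>\<in>space M. n * exp \<beta> < T \<omega>}" and ?L = "{\<omega>\<in>space M. T \<omega> < n * exp (- \<beta>)}"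
  have "prob ?U \<le> exp (- 2)"
  proof (rule chi_square_markov[of _ _ \<beta>])
    fix \<omega> assume "\<omega> \<in> ?U"
    then have "(1 - exp (- \<beta>)) / 2 * (n * exp \<beta>) \<le> (1 - exp (- \<beta>)) / 2 * T \<omega>"
      using b by (intro mult_left_mono) auto
    moreover have "(1 - exp (- \<beta>)) / 2 * (n * exp \<beta>) = n / 2 * (exp \<beta> - 1)"
      by (simp add: exp_minus field_simps)
    moreover have "n / 2 * (1 + \<beta> + \<beta>\<^sup>2 / 2) \<le> n / 2 * exp \<beta>"
      using b by (intro mult_left_mono exp_lower_Taylor_quadratic) auto
    ultimately show "2 \<le> - \<beta> / 2 * n + (1 - exp (- \<beta>)) / 2 * T \<omega>"
      using b(3) by (simp add: algebra_simps)
  qed measurable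
  moreover have "prob ?L \<le> exp (- 2)"
  proof (rule chi_square_markov[of _ _ "- \<beta>"])
    fix \<omega> assume "\<omega> \<in> ?L"
    then have "(1 - exp \<beta>) / 2 * (n * exp (- \<beta>)) \<le> (1 - exp \<beta>) / 2 * T \<omega>"
      using b by (intro mult_left_mono_neg) auto
    moreover have "(1 - exp \<beta>) / 2 * (n * exp (- \<beta>)) = n / 2 * (exp (- \<beta>) - 1)"
      by (simp add: exp_minus field_simps)
    moreover have "n / 2 * (\<beta>\<^sup>2 / (2 + \<beta>)) \<le> n / 2 * (\<beta> - 1 + exp (- \<beta>))"
      using b by (intro mult_left_mono exp_minus_lower) auto
    moreover have "2 \<le> n / 2 * (\<beta>\<^sup>2 / (2 + \<beta>))"
      using b by (simp add: field_simps)
    moreover have algebra: "n / 2 * (\<beta> - 1 + exp (- \<beta>)) = \<beta> / 2 * n + n / 2 * (exp (- \<beta>) - 1)"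
      by (simp add: field_simps)
    ultimately show "2 \<le> - (- \<beta>) / 2 * n + (1 - exp (- (- \<beta>))) / 2 * T \<omega>"
      unfolding minus_minus by linarith
  qed measurable
  moreover have "exp (- 2) \<le> (1 / 4 :: real)"
  proof -
    have "4 \<le> exp (2 :: real)" using exp_lower_Taylor_quadratic[of 2] by simp
    then show ?thesis by (simp add: exp_minus field_simps)
  qed
  moreover have "prob (space M - (?U \<union> ?L)) = 1 - prob (?U \<union> ?L)" by (intro prob_compl) measurable
  moreover have "prob (?U \<union> ?L) \<le> prob ?U + prob ?L" by (intro measure_Un_le) measurable
  moreover have "space M - (?U \<union> ?L) = {\<omega>\<in>space M. n * exp (- \<beta>) \<le> T \<omega> \<and> T \<omega> \<le> n * exp \<beta>}" by auto
  ultimately show ?thesis by simp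
qed

text \<open>Let \<open>J\<close> be the window of half-width \<open>w\<surd>n\<close> around \<open>n\<close>. The probabilities of \<open>exp(\<theta>) T \<in> J\<close> are
integrated over \<open>|\<theta>| \<le> 9/\<surd>n\<close> in two ways. On the one hand, each is at most a constant times the
probability of \<open>T \<in> J\<close>, since the tilting density is bounded on \<open>J\<close>. On the other hand, by Fubini the
integral is the expected length of the set of those \<open>\<theta>\<close> that carry \<open>T\<close> into \<open>J\<close>, and this length is at least
\<open>w/(2\<surd>n)\<close> whenever \<open>T\<close> lies in the typical window of half-width \<open>8/\<surd>n\<close> in the logarithmic scale.\<close>

theorem chi_square_small_ball:
  assumes w: "0 < w" "w \<le> 1"
  shows "prob {\<omega>\<in>space M. \<bar>T \<omega> - n\<bar> \<le> w * sqrt n} \<ge> w / (72 * exp (9 / 2 * exp 9))"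
proof -
  note Y_measurable[measurable] chi_square_measurable[measurable]
  define r where "r = sqrt n"
  define b where "b = 9 / r"
  define C where "C = exp (9 / 2 * exp (9 :: real))"
  define J where "J = {n - w * r .. n + w * r}"
  define \<beta> where "\<beta> = 8 / r"
  have r: "r \<ge> 1" "r > 0" "r * r = n" using n by (auto simp: r_def)
  have b: "0 < b" "b \<le> 9" using r by (auto simp: b_def field_simps)
  have [measurable]: "J \<in> sets borel" by (simp add: J_def)
  define Good where "Good = {\<omega>\<in>space M. n * exp (- \<beta>) \<le> T \<omega> \<and> T \<omega> \<le> n * exp \<beta>}"
  have [measurable]: "Good \<in> sets M" unfolding Good_def by measurable
  have good: "prob Good \<ge> 1 / 2" unfolding Good_def by (rule chi_square_window) (simp add: \<beta>_def r_def)
  define E where "E = {\<omega>\<in>space M. T \<omega> \<in> J}"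
  have [measurable]: "E \<in> sets M" unfolding E_def by measurable
  have tilt: "(\<integral>\<^sup>+\<omega>. indicator J (exp \<theta> * T \<omega>) \<partial>M) \<le> ennreal C * emeasure M E" if \<theta>: "\<theta> \<in> {- b..b}" for \<theta>
  proof -
    have dens: "exp (- \<theta> / 2 * n + (1 - exp (- \<theta>)) / 2 * t) \<le> C" if t: "t \<in> J" for t
    proof -
      have "w * r \<le> 1 * r" using w r by (intro mult_right_mono) auto
      then have tr: "\<bar>t - n\<bar> \<le> r" using t by (auto simp: J_def)
      have e: "\<bar>1 - exp (- \<theta>)\<bar> \<le> b * exp 9"
      proof (cases "\<theta> \<ge> 0")
        case True
        have "1 - exp (- \<theta>) \<le> \<theta>" using exp_ge_add_one_self[of "- \<theta>"] by simp
        moreover have "exp (- \<theta>) \<le> 1" using True by simp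
        moreover have "b * 1 \<le> b * exp 9" using b by (intro mult_left_mono) auto
        ultimately show ?thesis using \<theta> by auto
      next
        case False
        have "(1 + \<theta>) * exp (- \<theta>) \<le> exp \<theta> * exp (- \<theta>)"
          by (intro mult_right_mono exp_ge_add_one_self) auto
        then have "exp (- \<theta>) - 1 \<le> (- \<theta>) * exp (- \<theta>)" by (simp add: exp_add[symmetric] algebra_simps)
        also have "\<dots> \<le> b * exp 9" using \<theta> b False by (intro mult_mono) auto
        finally show ?thesis using False by simp
      qed
      \<comment> \<open>the exponent is its value at \<open>t = n\<close>, which is at most 0 by convexity, plus a part linear in \<open>t - n\<close>\<close>
      have "- \<theta> / 2 * n + (1 - exp (- \<theta>)) / 2 * t = n / 2 * (1 - \<theta> - exp (- \<theta>)) + (1 - exp (- \<theta>)) * (t - n) / 2"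
        by (simp add: field_simps)
      also have "\<dots> \<le> 0 + b * exp 9 * r / 2"
      proof (rule add_mono)
        show "n / 2 * (1 - \<theta> - exp (- \<theta>)) \<le> 0"
          using exp_ge_add_one_self[of "- \<theta>"] by (intro mult_nonneg_nonpos) auto
        have "(1 - exp (- \<theta>)) * (t - n) \<le> \<bar>1 - exp (- \<theta>)\<bar> * \<bar>t - n\<bar>"
          by (metis abs_ge_self abs_mult)
        also have "\<dots> \<le> b * exp 9 * r" using e tr b by (intro mult_mono) auto
        finally show "(1 - exp (- \<theta>)) * (t - n) / 2 \<le> b * exp 9 * r / 2" by simp
      qed
      also have "\<dots> = 9 / 2 * exp 9" using r by (simp add: b_def)
      finally show ?thesis by (simp add: C_def)
    qed
    have "(\<integral>\<^sup>+\<omega>. indicator J (exp \<theta> * T \<omega>) \<partial>M)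
        = (\<integral>\<^sup>+\<omega>. indicator J (T \<omega>) * ennreal (exp (- \<theta> / 2 * n + (1 - exp (- \<theta>)) / 2 * T \<omega>)) \<partial>M)"
      by (rule chi_square_tilt) simp
    also have "\<dots> \<le> (\<integral>\<^sup>+\<omega>. ennreal C * indicator E \<omega> \<partial>M)"
      using dens by (intro nn_integral_mono) (auto simp: indicator_def E_def intro!: ennreal_leI)
    also have "\<dots> = ennreal C * emeasure M E"
      by (subst nn_integral_cmult_indicator) auto
    finally show ?thesis .
  qed
  interpret PS: pair_sigma_finite M lborel by standard
  have [measurable]: "(\<lambda>x. T (fst x)) \<in> borel_measurable (M \<Otimes>\<^sub>M lborel)" by measurable
  have "ennreal (w / (2 * r)) * emeasure M Good = (\<integral>\<^sup>+\<omega>. ennreal (w / (2 * r)) * indicator Good \<omega> \<partial>M)"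
    by (subst nn_integral_cmult_indicator) auto
  also have "\<dots> \<le> (\<integral>\<^sup>+\<omega>. \<integral>\<^sup>+\<theta>. indicator {- b..b} \<theta> * indicator J (exp \<theta> * T \<omega>) \<partial>lborel \<partial>M)"
  proof (rule nn_integral_mono)
    fix \<omega>
    show "ennreal (w / (2 * r)) * indicator Good \<omega> \<le> (\<integral>\<^sup>+\<theta>. indicator {- b..b} \<theta> * indicator J (exp \<theta> * T \<omega>) \<partial>lborel)"
    proof (cases "\<omega> \<in> Good")
      case True
      then have t: "n * exp (- \<beta>) \<le> T \<omega>" "T \<omega> \<le> n * exp \<beta>" by (auto simp: Good_def)
      have n0: "real n > 0" using n by simp
      then have T0: "T \<omega> > 0" using t(1) by (meson exp_gt_zero less_le_trans mult_pos_pos)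
      \<comment> \<open>\<open>L\<close> is the parameter that carries the value of \<open>T\<close> exactly to \<open>n\<close>\<close>
      define L where "L = ln (n / T \<omega>)"
      have eL: "exp L * T \<omega> = n" using T0 n0 by (simp add: L_def)
      have "exp (- \<beta>) \<le> n / T \<omega>" "n / T \<omega> \<le> exp \<beta>"
        using t T0 n0 by (auto simp: exp_minus field_simps)
      then have L: "- \<beta> \<le> L" "L \<le> \<beta>" unfolding L_def using T0 n0
        by (simp_all add: ln_ge_iff ln_le_cancel_iff[symmetric, of _ "exp \<beta>"])
      define d where "d = w / (2 * r)"
      have d: "0 < d" "d \<le> 1 / (2 * r)" "d \<le> 1/2" using w r by (auto simp: d_def field_simps)
      have "{L..L + d} \<subseteq> {\<theta>. \<theta> \<in> {- b..b} \<and> exp \<theta> * T \<omega> \<in> J}"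
      proof (clarify, intro conjI)
        fix \<theta> assume th: "\<theta> \<in> {L..L + d}"
        have "\<beta> + 1 / (2 * r) \<le> b" "\<beta> \<le> b" using r by (auto simp: \<beta>_def b_def field_simps)
        then show "\<theta> \<in> {- b..b}" using th L d by auto
        have e: "exp \<theta> * T \<omega> = exp (\<theta> - L) * n" using eL by (simp add: exp_diff field_simps)
        define s where "s = \<theta> - L"
        have s: "0 \<le> s" "s \<le> d" using th by (auto simp: s_def)
        have "exp s \<le> 1 + s + s\<^sup>2" using s d by (intro exp_bound) auto
        also have "\<dots> \<le> 1 + 2 * d"
        proof -
          have "s\<^sup>2 \<le> s * 1" unfolding power2_eq_square using s d by (intro mult_left_mono) auto
          then show ?thesis using s by simp
        qed
        finally have "exp s * n \<le> (1 + 2 * d) * n" by (intro mult_right_mono) auto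
        also have "\<dots> = n + w * r" unfolding d_def r(3)[symmetric] using r(2) by (simp add: field_simps)
        finally have up: "exp s * n \<le> n + w * r" .
        have "1 * real n \<le> exp s * n" using s by (intro mult_right_mono) auto
        moreover have "0 \<le> w * r" using w r by simp
        ultimately show "exp \<theta> * T \<omega> \<in> J" using up unfolding e s_def[symmetric] J_def by auto
      qed
      then have "(\<integral>\<^sup>+\<theta>. indicator {L..L + d} \<theta> \<partial>lborel) \<le> (\<integral>\<^sup>+\<theta>. indicator {- b..b} \<theta> * indicator J (exp \<theta> * T \<omega>) \<partial>lborel)"
        by (intro nn_integral_mono) (auto simp: indicator_def)
      moreover have "(\<integral>\<^sup>+\<theta>. indicator {L..L + d} \<theta> \<partial>lborel) = ennreal d"
        using d by simp
      ultimately show ?thesis using True by (simp add: d_def)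
    qed simp
  qed
  also have "\<dots> = (\<integral>\<^sup>+\<theta>. \<integral>\<^sup>+\<omega>. indicator {- b..b} \<theta> * indicator J (exp \<theta> * T \<omega>) \<partial>M \<partial>lborel)"
    by (rule PS.Fubini'[symmetric]) measurable
  also have "\<dots> \<le> (\<integral>\<^sup>+\<theta>. ennreal C * emeasure M E * indicator {- b..b} \<theta> \<partial>lborel)"
  proof (rule nn_integral_mono)
    fix \<theta> :: real
    show "(\<integral>\<^sup>+\<omega>. indicator {- b..b} \<theta> * indicator J (exp \<theta> * T \<omega>) \<partial>M) \<le> ennreal C * emeasure M E * indicator {- b..b} \<theta>"
      using tilt[of \<theta>] by (cases "\<theta> \<in> {- b..b}") auto
  qed
  also have "\<dots> = ennreal C * emeasure M E * ennreal (2 * b)"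
    using b by (subst nn_integral_cmult_indicator) auto
  finally have "w / (2 * r) * prob Good \<le> C * prob E * (2 * b)"
    using w r b by (simp add: emeasure_eq_measure ennreal_mult[symmetric] C_def)
  moreover have "w / (2 * r) * (1 / 2) \<le> w / (2 * r) * prob Good"
    using good w r by (intro mult_left_mono) auto
  ultimately have "w / (2 * r) * (1 / 2) \<le> C * prob E * (2 * b)" by linarith
  then have "w \<le> 72 * C * prob E" using r by (simp add: b_def field_simps)
  then have "w / (72 * C) \<le> prob E" by (simp add: C_def field_simps)
  moreover have "E = {\<omega>\<in>space M. \<bar>T \<omega> - n\<bar> \<le> w * sqrt n}"
    by (auto simp: E_def J_def r_def)
  ultimately show ?thesis by (simp add: C_def)
qed

end

end

section \<open>Spectral norm and Gaussian vectors in coordinates\<close>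

abbreviation entries :: "real mat \<Rightarrow> nat \<Rightarrow> nat \<Rightarrow> real" where
  "entries A \<equiv> \<lambda>i j. A $$ (i, j)"

lemma mult_mat_vec_entry:
  assumes "A \<in> carrier_mat p p" "v \<in> carrier_vec p" "i < p"
  shows "(A *\<^sub>v v) $ i = mat_app p (entries A) (\<lambda>j. v $ j) i"
  using assms by (simp add: mat_app_def scalar_prod_def lessThan_atLeast0)

lemma scalar_prod_dot:
  assumes "w \<in> carrier_vec p"
  shows "v \<bullet> w = dot p (\<lambda>i. v $ i) (\<lambda>i. w $ i)"
  using assms by (simp add: dot_def scalar_prod_def lessThan_atLeast0)

lemma quadratic_form_dot:
  assumes A: "A \<in> carrier_mat p p"
  shows "vec p a \<bullet> (A *\<^sub>v vec p a) = dot p a (mat_app p (entries A) a)"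
proof -
  have "vec p a \<bullet> (A *\<^sub>v vec p a) = dot p (\<lambda>i. vec p a $ i) (\<lambda>i. (A *\<^sub>v vec p a) $ i)"
    using A by (intro scalar_prod_dot mult_mat_vec_carrier) auto
  also have "\<dots> = dot p a (mat_app p (entries A) (\<lambda>j. vec p a $ j))"
    unfolding dot_def using A by (intro sum.cong) (auto simp: mult_mat_vec_entry simp del: index_mult_mat_vec)
  also have "mat_app p (entries A) (\<lambda>j. vec p a $ j) = mat_app p (entries A) a"
    by (intro mat_app_cong) auto
  finally show ?thesis .
qed

text \<open>The supremum defining the spectral norm is one of real numbers, so it bounds its members only once it is known to be
finite; the Frobenius norm shows that.\<close>

lemma spectral_norm_op_bound:
  assumes A: "A \<in> carrier_mat p p" and le: "spectral_norm p A \<le> \<psi>" and \<psi>: "0 \<le> \<psi>"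
  shows "op_bound p (entries A) \<psi>"
proof -
  let ?S = "entries A"
  have norm: "sqrt (v \<bullet> v) = sqrt (sq_len p (\<lambda>i. v $ i))"
      "sqrt ((A *\<^sub>v v) \<bullet> (A *\<^sub>v v)) = sqrt (sq_len p (mat_app p ?S (\<lambda>i. v $ i)))" if v: "v \<in> carrier_vec p" for v
  proof -
    show "sqrt (v \<bullet> v) = sqrt (sq_len p (\<lambda>i. v $ i))"
      using v by (simp add: scalar_prod_dot dot_def sq_len_def power2_eq_square)
    have "(A *\<^sub>v v) \<bullet> (A *\<^sub>v v) = dot p (\<lambda>i. (A *\<^sub>v v) $ i) (\<lambda>i. (A *\<^sub>v v) $ i)"
      using A v by (intro scalar_prod_dot mult_mat_vec_carrier)
    also have "\<dots> = sq_len p (mat_app p ?S (\<lambda>i. v $ i))"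
      unfolding dot_def sq_len_def using A v
      by (intro sum.cong) (auto simp: mult_mat_vec_entry power2_eq_square simp del: index_mult_mat_vec)
    finally show "sqrt ((A *\<^sub>v v) \<bullet> (A *\<^sub>v v)) = sqrt (sq_len p (mat_app p ?S (\<lambda>i. v $ i)))" by simp
  qed
  have crude: "sq_len p (mat_app p ?S x) \<le> frob_sq p ?S * sq_len p x" for x
  proof -
    have "sq_len p (mat_app p ?S x) \<le> (\<Sum>i<p. (\<Sum>j<p. (?S i j)\<^sup>2) * (\<Sum>j<p. (x j)\<^sup>2))"
      unfolding sq_len_def mat_app_def by (intro sum_mono Cauchy_Schwarz_ineq_sum)
    then show ?thesis by (simp add: frob_sq_def sq_len_def sum_distrib_right)
  qed
  have bdd: "bdd_above ((\<lambda>v. sqrt ((A *\<^sub>v v) \<bullet> (A *\<^sub>v v))) ` {v \<in> carrier_vec p. sqrt (v \<bullet> v) \<le> 1})"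
  proof (rule bdd_aboveI2)
    fix v assume v: "v \<in> {v \<in> carrier_vec p. sqrt (v \<bullet> v) \<le> 1}"
    then have "sq_len p (\<lambda>i. v $ i) \<le> 1" using norm(1)[of v] by (metis (no_types, lifting) mem_Collect_eq real_sqrt_le_1_iff)
    then have "sq_len p (mat_app p ?S (\<lambda>i. v $ i)) \<le> frob_sq p ?S * 1"
      by (intro order.trans[OF crude] mult_left_mono frob_sq_nonneg)
    then show "sqrt ((A *\<^sub>v v) \<bullet> (A *\<^sub>v v)) \<le> sqrt (frob_sq p ?S)" using v by (simp add: norm)
  qed
  have "sq_len p (mat_app p ?S x) \<le> \<psi>\<^sup>2 * sq_len p x" for x
  proof (cases "sq_len p x = 0")
    case True
    then show ?thesis using crude[of x] by simp
  next
    case False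
    then have pos: "sq_len p x > 0" using sq_len_nonneg[of p x] by simp
    define c where "c = 1 / sqrt (sq_len p x)"
    have c: "c\<^sup>2 = 1 / sq_len p x" using pos by (simp add: c_def power_divide)
    define v where "v = vec p (\<lambda>i. c * x i)"
    have v: "v \<in> carrier_vec p" by (simp add: v_def)
    have "sq_len p (\<lambda>i. v $ i) = sq_len p (\<lambda>i. c * x i)" by (simp add: sq_len_def v_def)
    then have v1: "sq_len p (\<lambda>i. v $ i) = 1" using pos by (simp add: sq_len_scale c)
    have "mat_app p ?S (\<lambda>i. v $ i) = mat_app p ?S (\<lambda>i. c * x i)" by (intro mat_app_cong) (simp add: v_def)
    also have "\<dots> = (\<lambda>i. c * mat_app p ?S x i)" by (simp add: mat_app_def sum_distrib_left mult_ac)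
    finally have "sq_len p (mat_app p ?S (\<lambda>i. v $ i)) = sq_len p (mat_app p ?S x) / sq_len p x" by (simp add: sq_len_scale c)
    moreover have "sqrt (v \<bullet> v) \<le> 1" using norm(1)[OF v] v1 by simp
    then have "sqrt ((A *\<^sub>v v) \<bullet> (A *\<^sub>v v)) \<le> spectral_norm p A"
      unfolding spectral_norm_def using v by (intro cSUP_upper bdd) simp
    ultimately have "sqrt (sq_len p (mat_app p ?S x) / sq_len p x) \<le> \<psi>" using le v by (simp add: norm)
    then have "sq_len p (mat_app p ?S x) / sq_len p x \<le> \<psi>\<^sup>2" by (rule sqrt_le_D)
    then show ?thesis using pos by (simp add: divide_le_eq)
  qed
  then show ?thesis using \<psi> by (simp add: op_bound_def)
qed

lemma gaussian_vector_distr: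
  assumes M: "prob_space M" and X: "centered_gaussian M p \<Sigma> X"
  shows "gaussian_vector (distr M (PiM {..<p} (\<lambda>_. borel)) X) p (entries \<Sigma>)"
proof -
  interpret prob_space M by fact
  have \<Sigma>: "\<Sigma> \<in> carrier_mat p p" and sym: "transpose_mat \<Sigma> = \<Sigma>"
    and psd: "\<And>a. a \<in> carrier_vec p \<Longrightarrow> 0 \<le> a \<bullet> (\<Sigma> *\<^sub>v a)"
    and [measurable]: "X \<in> measurable M (PiM {..<p} (\<lambda>_. borel))"
    and law: "\<And>a. a \<in> carrier_vec p \<Longrightarrow> distr M borel (\<lambda>\<omega>. \<Sum>i<p. a $ i * X \<omega> i) = normal_law 0 (a \<bullet> (\<Sigma> *\<^sub>v a))"
    using X by (auto simp: centered_gaussian_def)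
  have dot_meas: "dot p a \<in> borel_measurable (PiM {..<p} (\<lambda>_. borel))" for a
    unfolding dot_def[abs_def]
    by (intro borel_measurable_sum borel_measurable_times borel_measurable_const measurable_component_singleton) auto
  show ?thesis
  proof (intro gaussian_vector.intro gaussian_vector_axioms.intro)
    show "prob_space (distr M (Pi\<^sub>M {..<p} (\<lambda>_. borel)) X)" by (rule prob_space_distr) measurable
    show "sets (distr M (Pi\<^sub>M {..<p} (\<lambda>_. borel)) X) = sets (Pi\<^sub>M {..<p} (\<lambda>_. borel))" by simp
    show "sym_on p (entries \<Sigma>)"
      unfolding sym_on_def using sym \<Sigma> by (metis carrier_matD index_transpose_mat(1))
    show "0 \<le> dot p a (mat_app p (entries \<Sigma>) a)" for a
      using psd[of "vec p a"] quadratic_form_dot[OF \<Sigma>, of a] by simp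
    show "distr (distr M (Pi\<^sub>M {..<p} (\<lambda>_. borel)) X) borel (dot p a) = normal_law 0 (dot p a (mat_app p (entries \<Sigma>) a))" for a
    proof -
      have "distr (distr M (Pi\<^sub>M {..<p} (\<lambda>_. borel)) X) borel (dot p a) = distr M borel (\<lambda>\<omega>. \<Sum>i<p. vec p a $ i * X \<omega> i)"
        by (subst distr_distr) (auto intro!: dot_meas simp: comp_def dot_def)
      also have "\<dots> = normal_law 0 (vec p a \<bullet> (\<Sigma> *\<^sub>v vec p a))" by (rule law) simp
      finally show ?thesis by (simp only: quadratic_form_dot[OF \<Sigma>])
    qed
  qed
qed

section \<open>A Hanson-Wright inequality for Gaussian samples\<close>

locale gaussian_sample = prob_space M for M :: "'a measure" +
  fixes p n :: nat and S :: "nat \<Rightarrow> nat \<Rightarrow> real" and X :: "nat \<Rightarrow> 'a \<Rightarrow> nat \<Rightarrow> real" and \<psi> :: real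
  assumes p: "p \<ge> 1" and n: "n \<ge> 1"
    and indep: "indep_vars (\<lambda>_. PiM {..<p} (\<lambda>_. borel)) X {1..n}"
    and gauss: "\<And>k. k \<in> {1..n} \<Longrightarrow> gaussian_vector (distr M (PiM {..<p} (\<lambda>_. borel)) (X k)) p S"
    and \<psi>: "\<psi> > 0" and op_S: "op_bound p S \<psi>"
begin

lemma X_measurable[measurable]: "k \<in> {1..n} \<Longrightarrow> X k \<in> measurable M (PiM {..<p} (\<lambda>_. borel))"
  using indep by (auto simp: indep_vars_def)

lemma coordinate_measurable[measurable]: "k \<in> {1..n} \<Longrightarrow> i < p \<Longrightarrow> (\<lambda>\<omega>. X k \<omega> i) \<in> borel_measurable M"
  using measurable_compose[OF X_measurable measurable_component_singleton[of i "{..<p}" "\<lambda>_. borel"]] by simp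

definition quad_form :: "(nat \<Rightarrow> nat \<Rightarrow> real) \<Rightarrow> nat \<Rightarrow> 'a \<Rightarrow> real" where
  "quad_form A k \<omega> = dot p (X k \<omega>) (mat_app p A (X k \<omega>))"

lemma quad_form_measurable[measurable]: "k \<in> {1..n} \<Longrightarrow> quad_form A k \<in> borel_measurable M"
  unfolding quad_form_def[abs_def] dot_def mat_app_def by (intro borel_measurable_sum borel_measurable_times) auto

lemma quad_form_mgf:
  assumes A: "sym_on p A" "op_bound p A a" and \<theta>: "0 \<le> \<theta>" "4 * \<psi> * (\<theta> * a) \<le> 1" and k: "k \<in> {1..n}"
  shows "(\<integral>\<^sup>+\<omega>. ennreal (exp (\<theta> * (quad_form A k \<omega> - trace_prod p A S))) \<partial>M) \<le> ennreal (exp (3 * \<psi>\<^sup>2 * \<theta>\<^sup>2 * frob_sq p A))"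
proof -
  interpret G: gaussian_vector "distr M (PiM {..<p} (\<lambda>_. borel)) (X k)" p S by (rule gauss[OF k])
  define B where "B i j = \<theta> * A i j" for i j
  define \<tau> where "\<tau> = trace_prod p A S"
  have mvB: "mat_app p B x = (\<lambda>i. \<theta> * mat_app p A x i)" for x
    by (simp add: mat_app_def B_def sum_distrib_left mult.assoc)
  have opB: "op_bound p B (\<theta> * a)"
    using A \<theta> by (simp add: op_bound_def mvB sq_len_scale power_mult_distrib mult.assoc mult_left_mono)
  have B: "sym_on p B" "frob_sq p B = \<theta>\<^sup>2 * frob_sq p A" "trace_prod p B S = \<theta> * \<tau>"
    using A by (auto simp: sym_on_def B_def frob_sq_def trace_prod_def \<tau>_def
        sum_distrib_left power_mult_distrib mult.assoc mult_left_mono)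
  have "(\<integral>\<^sup>+\<omega>. ennreal (exp (\<theta> * (quad_form A k \<omega> - \<tau>))) \<partial>M)
      = (\<integral>\<^sup>+\<omega>. ennreal (exp (- \<theta> * \<tau>)) * ennreal (exp (dot p (X k \<omega>) (mat_app p B (X k \<omega>)))) \<partial>M)"
    by (simp add: quad_form_def mvB dot_commute[of _ "_" "\<lambda>i. \<theta> * _ i"] dot_def sum_distrib_left ennreal_mult[symmetric] exp_add[symmetric] algebra_simps)
  also have "\<dots> = ennreal (exp (- \<theta> * \<tau>)) * (\<integral>\<^sup>+\<omega>. ennreal (exp (dot p (X k \<omega>) (mat_app p B (X k \<omega>)))) \<partial>M)"
    using quad_form_measurable[OF k, of B] by (intro nn_integral_cmult) (auto simp: quad_form_def[abs_def])
  also have "(\<integral>\<^sup>+\<omega>. ennreal (exp (dot p (X k \<omega>) (mat_app p B (X k \<omega>)))) \<partial>M) = G.quad_mgf B"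
    unfolding G.quad_mgf_def using G.quadratic_measurable[of B] k
    by (subst nn_integral_distr) auto
  also have "ennreal (exp (- \<theta> * \<tau>)) * G.quad_mgf B \<le> ennreal (exp (- \<theta> * \<tau>)) * ennreal (exp (\<theta> * \<tau> + 8 / 3 * \<psi>\<^sup>2 * (\<theta>\<^sup>2 * frob_sq p A)))"
    using G.quad_mgf_le[OF op_S _ B(1) opB] \<theta>(2) p by (intro mult_left_mono) (auto simp: B(2,3))
  also have "\<dots> = ennreal (exp (8 / 3 * \<psi>\<^sup>2 * (\<theta>\<^sup>2 * frob_sq p A)))"
    by (simp add: ennreal_mult[symmetric] exp_add[symmetric])
  also have "\<dots> \<le> ennreal (exp (3 * \<psi>\<^sup>2 * \<theta>\<^sup>2 * frob_sq p A))"
    using frob_sq_nonneg[of p A] by (intro ennreal_leI) (simp add: mult.assoc)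
  finally show ?thesis by (simp add: \<tau>_def)
qed

text \<open>Chernoff's argument. The exponential moment is available for \<open>4\<psi>\<theta>a \<le> 1\<close> only; the parameter \<open>\<theta>\<close>
is the unconstrained optimum \<open>t / (6\<psi>\<^sup>2f)\<close> if it satisfies this, and the largest admissible value
otherwise. In both cases half of the linear term survives.\<close>

theorem hanson_wright:
  fixes t :: real
  assumes A: "sym_on p A" "op_bound p A a" and a: "a > 0" and f: "frob_sq p A \<le> f" "f > 0" and t: "t > 0"
  shows "prob {\<omega>\<in>space M. n * t \<le> (\<Sum>k=1..n. quad_form A k \<omega> - trace_prod p A S)}
    \<le> max (exp (- (n * t\<^sup>2 / (12 * \<psi>\<^sup>2 * f)))) (exp (- (n * t / (8 * \<psi> * a))))"
proof -
  define \<theta> where "\<theta> = min (t / (6 * \<psi>\<^sup>2 * f)) (1 / (4 * \<psi> * a))"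
  have \<theta>: "\<theta> > 0" using a f t \<psi> by (auto simp: \<theta>_def)
  have "\<theta> \<le> 1 / (4 * \<psi> * a)" "\<theta> \<le> t / (6 * \<psi>\<^sup>2 * f)" by (auto simp: \<theta>_def)
  then have \<theta>1: "4 * \<psi> * (\<theta> * a) \<le> 1" and \<theta>2: "3 * \<psi>\<^sup>2 * f * \<theta> \<le> t / 2"
    using a f \<psi> by (auto simp: field_simps)
  define q where "q k \<omega> = quad_form A k \<omega> - trace_prod p A S" for k \<omega>
  let ?E = "{\<omega>\<in>space M. n * t \<le> (\<Sum>k=1..n. q k \<omega>)}"
  have [measurable]: "q k \<in> borel_measurable M" if "k \<in> {1..n}" for k
    unfolding q_def[abs_def] using that by measurable
  have [measurable]: "(\<lambda>\<omega>. \<Sum>k=1..n. q k \<omega>) \<in> borel_measurable M"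
    by (intro borel_measurable_sum) auto
  have "ennreal (exp (\<theta> * (n * t))) * emeasure M ?E = (\<integral>\<^sup>+\<omega>. ennreal (exp (\<theta> * (n * t))) * indicator ?E \<omega> \<partial>M)"
    by (subst nn_integral_cmult_indicator) auto
  also have "\<dots> \<le> (\<integral>\<^sup>+\<omega>. (\<Prod>k\<in>{1..n}. ennreal (exp (\<theta> * q k \<omega>))) \<partial>M)"
  proof (rule nn_integral_mono)
    fix \<omega>
    have "(\<Prod>k\<in>{1..n}. ennreal (exp (\<theta> * q k \<omega>))) = ennreal (exp (\<theta> * (\<Sum>k=1..n. q k \<omega>)))"
      by (simp add: prod_ennreal exp_sum sum_distrib_left)
    then show "ennreal (exp (\<theta> * (n * t))) * indicator ?E \<omega> \<le> (\<Prod>k\<in>{1..n}. ennreal (exp (\<theta> * q k \<omega>)))"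
      using \<theta> by (auto simp: indicator_def intro!: ennreal_leI)
  qed
  also have "\<dots> = (\<Prod>k\<in>{1..n}. \<integral>\<^sup>+\<omega>. ennreal (exp (\<theta> * q k \<omega>)) \<partial>M)"
  proof (rule indep_vars_nn_integral)
    have "indep_vars (\<lambda>_. borel) (\<lambda>k \<omega>. (\<lambda>x. ennreal (exp (\<theta> * (dot p x (mat_app p A x) - trace_prod p A S)))) (X k \<omega>)) {1..n}"
    proof (rule indep_vars_compose2[OF indep])
      show "(\<lambda>x. ennreal (exp (\<theta> * (dot p x (mat_app p A x) - trace_prod p A S)))) \<in> borel_measurable (PiM {..<p} (\<lambda>_. borel))" for k
        unfolding dot_def mat_app_def
        by (intro measurable_compose[OF _ measurable_ennreal] measurable_compose[OF _ borel_measurable_exp] borel_measurable_times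
           borel_measurable_diff borel_measurable_sum borel_measurable_const measurable_component_singleton) auto
    qed
    then show "indep_vars (\<lambda>_. borel) (\<lambda>k \<omega>. ennreal (exp (\<theta> * q k \<omega>))) {1..n}"
      by (simp add: q_def quad_form_def)
  qed auto
  also have "\<dots> \<le> (\<Prod>k\<in>{1..n}. ennreal (exp (3 * \<psi>\<^sup>2 * \<theta>\<^sup>2 * f)))"
  proof (rule prod_mono_ennreal)
    fix k assume k: "k \<in> {1..n}"
    have "(\<integral>\<^sup>+\<omega>. ennreal (exp (\<theta> * q k \<omega>)) \<partial>M) \<le> ennreal (exp (3 * \<psi>\<^sup>2 * \<theta>\<^sup>2 * frob_sq p A))"
      unfolding q_def using \<theta> by (intro quad_form_mgf[OF A _ \<theta>1 k]) simp
    also have "\<dots> \<le> ennreal (exp (3 * \<psi>\<^sup>2 * \<theta>\<^sup>2 * f))"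
      using f by (intro ennreal_leI) (simp add: mult_left_mono)
    finally show "(\<integral>\<^sup>+\<omega>. ennreal (exp (\<theta> * q k \<omega>)) \<partial>M) \<le> ennreal (exp (3 * \<psi>\<^sup>2 * \<theta>\<^sup>2 * f))" .
  qed
  also have "\<dots> = ennreal (exp (n * (3 * \<psi>\<^sup>2 * \<theta>\<^sup>2 * f)))"
    by (simp add: ennreal_power exp_of_nat_mult)
  finally have "exp (\<theta> * (n * t)) * prob ?E \<le> exp (n * (3 * \<psi>\<^sup>2 * \<theta>\<^sup>2 * f))"
    by (simp add: emeasure_eq_measure ennreal_mult[symmetric])
  then have "exp (- (\<theta> * (n * t))) * (exp (\<theta> * (n * t)) * prob ?E) \<le> exp (- (\<theta> * (n * t))) * exp (n * (3 * \<psi>\<^sup>2 * \<theta>\<^sup>2 * f))"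
    by (intro mult_left_mono) auto
  then have "prob ?E \<le> exp (- (\<theta> * (n * t)) + n * (3 * \<psi>\<^sup>2 * \<theta>\<^sup>2 * f))"
    by (simp add: exp_add[symmetric] mult.assoc[symmetric])
  also have "\<dots> \<le> exp (- (n * t * \<theta> / 2))"
  proof -
    have "(n * \<theta>) * (3 * \<psi>\<^sup>2 * f * \<theta>) \<le> (n * \<theta>) * (t / 2)" using \<theta>2 \<theta> by (intro mult_left_mono) auto
    then show ?thesis by (simp add: power2_eq_square algebra_simps)
  qed
  also have "\<dots> \<le> max (exp (- (n * t\<^sup>2 / (12 * \<psi>\<^sup>2 * f)))) (exp (- (n * t / (8 * \<psi> * a))))"
  proof (cases "t / (6 * \<psi>\<^sup>2 * f) \<le> 1 / (4 * \<psi> * a)")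
    case True
    have eq: "n * t * \<theta> / 2 = n * t\<^sup>2 / (12 * \<psi>\<^sup>2 * f)" using True by (simp add: \<theta>_def power2_eq_square)
    show ?thesis unfolding eq by (rule max.cobounded1)
  next
    case False
    have eq: "n * t * \<theta> / 2 = n * t / (8 * \<psi> * a)" using False by (simp add: \<theta>_def)
    show ?thesis unfolding eq by (rule max.cobounded2)
  qed
  finally show ?thesis by (simp add: q_def)
qed

corollary hanson_wright_two_sided:
  fixes t :: real
  assumes A: "sym_on p A" "op_bound p A a" and a: "a > 0" and f: "frob_sq p A \<le> f" "f > 0" and t: "t > 0"
  shows "prob {\<omega>\<in>space M. \<bar>(\<Sum>k=1..n. quad_form A k \<omega>) / n - trace_prod p A S\<bar> > t}
    \<le> 2 * max (exp (- (n * t\<^sup>2 / (12 * \<psi>\<^sup>2 * f)))) (exp (- (n * t / (8 * \<psi> * a))))"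
proof -
  define B where "B i j = - A i j" for i j
  have mvB: "mat_app p B x = (\<lambda>i. - mat_app p A x i)" for x by (simp add: mat_app_def B_def sum_negf)
  have opB: "op_bound p B a"
    using A(2) by (simp add: op_bound_def mvB sq_len_def)
  have B: "sym_on p B" "frob_sq p B \<le> f" "trace_prod p B S = - trace_prod p A S"
    using A f by (auto simp: sym_on_def B_def frob_sq_def trace_prod_def sum_negf)
  have qB: "quad_form B k \<omega> = - quad_form A k \<omega>" for k \<omega> by (simp add: quad_form_def mvB dot_def sum_negf)
  let ?E = "\<lambda>A. {\<omega>\<in>space M. n * t \<le> (\<Sum>k=1..n. quad_form A k \<omega> - trace_prod p A S)}"
  have [measurable]: "(\<lambda>\<omega>. \<Sum>k=1..n. quad_form A k \<omega> - trace_prod p A S) \<in> borel_measurable M" for A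
    by (intro borel_measurable_sum borel_measurable_diff) auto
  have meas: "?E A \<in> sets M" for A by measurable
  have "{\<omega>\<in>space M. \<bar>(\<Sum>k=1..n. quad_form A k \<omega>) / n - trace_prod p A S\<bar> > t} \<subseteq> ?E A \<union> ?E B"
  proof safe
    fix \<omega> assume \<omega>: "\<omega> \<in> space M" "t < \<bar>(\<Sum>k=1..n. quad_form A k \<omega>) / n - trace_prod p A S\<bar>"
      and nB: "\<not> n * t \<le> (\<Sum>k=1..n. quad_form B k \<omega> - trace_prod p B S)"
    have "n * t < n * \<bar>(\<Sum>k=1..n. quad_form A k \<omega>) / n - trace_prod p A S\<bar>" using \<omega>(2) n by simp
    also have "\<dots> = \<bar>(\<Sum>k=1..n. quad_form A k \<omega>) - n * trace_prod p A S\<bar>"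
    proof -
      have "n * \<bar>(\<Sum>k=1..n. quad_form A k \<omega>) / n - trace_prod p A S\<bar> = \<bar>n * ((\<Sum>k=1..n. quad_form A k \<omega>) / n - trace_prod p A S)\<bar>"
        by (simp add: abs_mult)
      then show ?thesis using n by (simp add: right_diff_distrib)
    qed
    finally show "n * t \<le> (\<Sum>k=1..n. quad_form A k \<omega> - trace_prod p A S)"
      using nB by (simp add: qB B(3) sum_subtractf sum_negf sum.distrib)
  qed
  then have "prob {\<omega>\<in>space M. \<bar>(\<Sum>k=1..n. quad_form A k \<omega>) / n - trace_prod p A S\<bar> > t} \<le> prob (?E A \<union> ?E B)"
    using meas by (intro finite_measure_mono sets.Un)
  also have "\<dots> \<le> prob (?E A) + prob (?E B)" using meas by (intro measure_Un_le)
  also have "\<dots> \<le> 2 * max (exp (- (n * t\<^sup>2 / (12 * \<psi>\<^sup>2 * f)))) (exp (- (n * t / (8 * \<psi> * a))))"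
    using hanson_wright[OF A a f t] hanson_wright[OF B(1) opB a B(2) f(2) t] by simp
  finally show ?thesis .
qed

end

section \<open>Deviation of the projected sample covariance\<close>

locale invariant_sample = vertex_group p G + gaussian_sample M p n S X \<psi>
  for p G and M :: "'a measure" and n S X \<psi> +
  assumes inv_S: "\<And>g i j. g \<in> G \<Longrightarrow> i < p \<Longrightarrow> j < p \<Longrightarrow> S (g i) (g j) = S i j"
begin

definition emp_cov :: "'a \<Rightarrow> nat \<Rightarrow> nat \<Rightarrow> real" where
  "emp_cov \<omega> a b = (\<Sum>k=1..n. X k \<omega> a * X k \<omega> b) / n"

lemma sym_S: "sym_on p S"
  using gauss[of 1] n gaussian_vector.sym_S by force

lemma sym_emp_cov: "sym_on p (emp_cov \<omega>)"
  by (simp add: sym_on_def emp_cov_def mult.commute)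

lemma group_avg_emp_cov_eq_quad_form:
  assumes ij: "i < p" "j < p"
  shows "group_avg (emp_cov \<omega>) i j = (\<Sum>k=1..n. quad_form (orbit_weight i j) k \<omega>) / n"
proof -
  let ?W = "orbit_weight i j"
  have "group_avg (emp_cov \<omega>) i j = trace_prod p ?W (emp_cov \<omega>)"
    by (rule trace_orbit_weight[OF ij sym_emp_cov, symmetric])
  also have "\<dots> = (\<Sum>a<p. \<Sum>b<p. \<Sum>k=1..n. ?W a b * (X k \<omega> a * X k \<omega> b) / n)"
    by (simp add: trace_prod_def emp_cov_def sum_distrib_left sum_divide_distrib)
  also have "\<dots> = (\<Sum>a<p. \<Sum>k=1..n. \<Sum>b<p. ?W a b * (X k \<omega> a * X k \<omega> b) / n)"
    by (intro sum.cong refl sum.swap)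
  also have "\<dots> = (\<Sum>k=1..n. \<Sum>a<p. \<Sum>b<p. ?W a b * (X k \<omega> a * X k \<omega> b) / n)"
    by (rule sum.swap)
  also have "\<dots> = (\<Sum>k=1..n. quad_form ?W k \<omega>) / n"
    by (simp add: quad_form_def dot_def mat_app_def sum_distrib_left sum_divide_distrib mult_ac)
  finally show ?thesis .
qed

lemma group_avg_S: "i < p \<Longrightarrow> j < p \<Longrightarrow> group_avg S i j = S i j"
  by (rule group_avg_invariant) (rule inv_S)

text \<open>The Hanson-Wright inequality for the orbit weights, whose Frobenius and operator norms were bounded by \<open>1/|O|\<close> and
\<open>d/|O|\<close>.\<close>

lemma entry_tail:
  assumes ij: "i < p" "j < p" and t: "t > 0"
  shows "prob {\<omega>\<in>space M. \<bar>group_avg (emp_cov \<omega>) i j - S i j\<bar> > t}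
    \<le> 2 * max (exp (- (1 / (12 * \<psi>\<^sup>2)) * n * min_orbit p G * t\<^sup>2)) (exp (- (1 / (8 * \<psi>)) * n * min_orbit_deg p G * t))"
proof -
  let ?O = "real (card (edge_orbit G i j))" and ?d = "real (orbit_degree G i j)"
  have pos: "?O > 0" "?d > 0" using card_edge_orbit orbit_degree_pos by simp_all
  have "prob {\<omega>\<in>space M. \<bar>group_avg (emp_cov \<omega>) i j - S i j\<bar> > t}
      = prob {\<omega>\<in>space M. \<bar>(\<Sum>k=1..n. quad_form (orbit_weight i j) k \<omega>) / n - trace_prod p (orbit_weight i j) S\<bar> > t}"
    by (simp add: group_avg_emp_cov_eq_quad_form[OF ij] trace_orbit_weight[OF ij sym_S] group_avg_S[OF ij])
  also have "\<dots> \<le> 2 * max (exp (- (n * t\<^sup>2 / (12 * \<psi>\<^sup>2 * (1 / ?O))))) (exp (- (n * t / (8 * \<psi> * (?d / ?O)))))"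
    using pos ij t op_bound_orbit_weight frob_sq_orbit_weight orbit_weight_sym by (intro hanson_wright_two_sided) (auto simp: sym_on_def)
  also have "\<dots> = 2 * max (exp (- (1 / (12 * \<psi>\<^sup>2) * n * ?O * t\<^sup>2))) (exp (- (1 / (8 * \<psi>) * n * (?O / ?d) * t)))"
    using pos \<psi> by (simp add: field_simps)
  also have "\<dots> \<le> 2 * max (exp (- (1 / (12 * \<psi>\<^sup>2) * n * min_orbit p G * t\<^sup>2))) (exp (- (1 / (8 * \<psi>) * n * min_orbit_deg p G * t)))"
  proof -
    have "1 / (12 * \<psi>\<^sup>2) * n * min_orbit p G * t\<^sup>2 \<le> 1 / (12 * \<psi>\<^sup>2) * n * ?O * t\<^sup>2"
      using min_orbit_le[OF ij] by (intro mult_right_mono mult_left_mono) auto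
    moreover have "1 / (8 * \<psi>) * n * min_orbit_deg p G * t \<le> 1 / (8 * \<psi>) * n * (?O / ?d) * t"
      using min_orbit_deg_le[OF ij] t \<psi> by (intro mult_right_mono mult_left_mono) auto
    ultimately show ?thesis by (intro mult_left_mono max.mono) auto
  qed
  finally show ?thesis by simp
qed

lemma emp_cov_measurable[measurable]: "i < p \<Longrightarrow> j < p \<Longrightarrow> (\<lambda>\<omega>. emp_cov \<omega> i j) \<in> borel_measurable M"
  unfolding emp_cov_def by (intro borel_measurable_divide borel_measurable_sum borel_measurable_times) auto

lemma group_avg_emp_cov_measurable[measurable]:
  assumes "i < p" "j < p"
  shows "(\<lambda>\<omega>. group_avg (emp_cov \<omega>) i j) \<in> borel_measurable M"
  unfolding group_avg_def using assms less_iff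
  by (intro borel_measurable_divide borel_measurable_sum emp_cov_measurable) auto

definition deviates :: "real \<Rightarrow> 'a set" where
  "deviates t = {\<omega>\<in>space M. \<exists>i<p. \<exists>j<p. \<bar>group_avg (emp_cov \<omega>) i j - S i j\<bar> > t}"

text \<open>The deviation depends on the pair \<open>(i, j)\<close> only through its edge orbit, so the union runs over one representative of
each orbit.\<close>

lemma union_bound:
  assumes t: "t > 0"
  shows "prob (deviates t) \<le> num_orbits p G *
    (2 * max (exp (- (1 / (12 * \<psi>\<^sup>2)) * n * min_orbit p G * t\<^sup>2)) (exp (- (1 / (8 * \<psi>)) * n * min_orbit_deg p G * t)))"
    (is "_ \<le> _ * ?y")
proof -
  let ?Orb = "{edge_orbit G i j | i j. i < p \<and> j < p}"
  define rep where "rep e = (SOME ij. fst ij < p \<and> snd ij < p \<and> edge_orbit G (fst ij) (snd ij) = e)" for e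
  have rep: "fst (rep e) < p \<and> snd (rep e) < p \<and> edge_orbit G (fst (rep e)) (snd (rep e)) = e" if e: "e \<in> ?Orb" for e
  proof -
    obtain i j where "i < p" "j < p" "edge_orbit G i j = e" using e by blast
    then have "fst (i, j) < p \<and> snd (i, j) < p \<and> edge_orbit G (fst (i, j)) (snd (i, j)) = e" by simp
    then show ?thesis unfolding rep_def by (rule someI)
  qed
  define F where "F e = {\<omega>\<in>space M. \<bar>group_avg (emp_cov \<omega>) (fst (rep e)) (snd (rep e)) - S (fst (rep e)) (snd (rep e))\<bar> > t}" for e
  have F: "F e \<in> sets M" if "e \<in> ?Orb" for e
  proof -
    have "{\<omega>\<in>space M. \<bar>group_avg (emp_cov \<omega>) i j - s\<bar> > t} \<in> sets M" if "i < p" "j < p" for i j s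
    proof -
      note group_avg_emp_cov_measurable[OF that, measurable]
      show ?thesis by measurable
    qed
    then show ?thesis unfolding F_def using rep[OF that] by blast
  qed
  have "deviates t \<subseteq> (\<Union>e\<in>?Orb. F e)"
  proof
    fix \<omega> assume "\<omega> \<in> deviates t"
    then obtain i j where ij: "i < p" "j < p" and \<omega>: "\<omega> \<in> space M" "\<bar>group_avg (emp_cov \<omega>) i j - S i j\<bar> > t"
      by (auto simp: deviates_def)
    define e where "e = edge_orbit G i j"
    have e: "e \<in> ?Orb" using ij by (auto simp: e_def)
    note r = rep[OF e]
    have "group_avg (emp_cov \<omega>) i j = group_avg (emp_cov \<omega>) (fst (rep e)) (snd (rep e))"
      using r ij by (intro group_avg_edge_orbit_cong sym_emp_cov) (auto simp: e_def)
    moreover have "group_avg S i j = group_avg S (fst (rep e)) (snd (rep e))"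
      using r ij by (intro group_avg_edge_orbit_cong sym_S) (auto simp: e_def)
    ultimately have "\<omega> \<in> F e" using \<omega> r ij by (simp add: F_def group_avg_S)
    then show "\<omega> \<in> (\<Union>e\<in>?Orb. F e)" using e by blast
  qed
  then have "prob (deviates t) \<le> prob (\<Union>e\<in>?Orb. F e)"
    using F finite_orbits by (intro finite_measure_mono sets.finite_UN) auto
  also have "\<dots> \<le> (\<Sum>e\<in>?Orb. prob (F e))"
    using F finite_orbits by (intro finite_measure_subadditive_finite) auto
  also have "\<dots> \<le> (\<Sum>e\<in>?Orb. ?y)"
  proof (rule sum_mono)
    fix e assume "e \<in> ?Orb"
    from rep[OF this] show "prob (F e) \<le> ?y" unfolding F_def by (intro entry_tail t) auto
  qed
  also have "\<dots> = num_orbits p G * ?y" by (simp add: num_orbits_def)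
  finally show ?thesis .
qed

text \<open>With one vertex the group is trivial and the only entry is the sample variance, a multiple of a chi-square
variable unless the variance vanishes; in the latter case the sample is almost surely zero.\<close>

lemma one_vertex_small_ball:
  assumes p1: "p = 1" and t: "t > 0"
  shows "prob (deviates t) \<le> 1 - min 1 (sqrt n * t / \<psi>) / (72 * exp (9 / 2 * exp 9))"
proof -
  define v where "v = S 0 0"
  define K where "K = 72 * exp (9 / 2 * exp (9 :: real))"
  define w where "w = min 1 (sqrt n * t / \<psi>)"
  have K: "K \<ge> 1" by (simp add: K_def order.trans[OF _ mult_mono[of 1 72 1]])
  have w: "0 < w" "w \<le> 1" using t \<psi> n by (auto simp: w_def)
  have law: "distr M borel (\<lambda>\<omega>. X k \<omega> 0) = normal_law 0 v" "v \<ge> 0" if k: "k \<in> {1..n}" for k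
  proof -
    interpret G: gaussian_vector "distr M (PiM {..<p} (\<lambda>_. borel)) (X k)" p S by (rule gauss[OF k])
    have u: "dot p (std_unit 0) = (\<lambda>x. x 0)" using p1 by (simp add: dot_std_unit fun_eq_iff)
    have q: "dot p (std_unit 0) (mat_app p S (std_unit 0)) = v" using p1 by (simp add: dot_std_unit mat_app_std_unit v_def)
    show "v \<ge> 0" using G.psd_S[of "std_unit 0"] unfolding q .
    have "distr (distr M (PiM {..<p} (\<lambda>_. borel)) (X k)) borel (\<lambda>x. x 0) = normal_law 0 v"
      using G.law[of "std_unit 0"] unfolding q unfolding u .
    moreover have "distr (distr M (PiM {..<p} (\<lambda>_. borel)) (X k)) borel (\<lambda>x. x 0) = distr M borel (\<lambda>\<omega>. X k \<omega> 0)"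
      by (subst distr_distr[OF _ X_measurable[OF k]]) (use p1 in \<open>auto intro!: measurable_component_singleton simp: comp_def\<close>)
    ultimately show "distr M borel (\<lambda>\<omega>. X k \<omega> 0) = normal_law 0 v" by simp
  qed
  have v0: "v \<ge> 0" using law(2)[of 1] n by simp
  have v\<psi>: "v \<le> \<psi>" using op_bound_diag[OF op_S, of 0] p1 by (simp add: v_def)
  have g0: "g 0 = 0" if "g \<in> G" for g using less_iff[OF that, of 0] p1 by simp
  have "group_avg (emp_cov \<omega>) 0 0 = emp_cov \<omega> 0 0" for \<omega>
    by (intro group_avg_invariant arg_cong2[of _ _ _ _ "emp_cov \<omega>"] g0)
  then have avg0: "group_avg (emp_cov \<omega>) 0 0 = (\<Sum>k=1..n. (X k \<omega> 0)\<^sup>2) / n" for \<omega>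
    by (simp add: emp_cov_def power2_eq_square)
  have dev: "deviates t = {\<omega>\<in>space M. \<bar>(\<Sum>k=1..n. (X k \<omega> 0)\<^sup>2) / n - v\<bar> > t}"
    unfolding deviates_def using p1 by (auto simp: avg0 v_def)
  define B where "B = {\<omega>\<in>space M. \<bar>(\<Sum>k=1..n. (X k \<omega> 0)\<^sup>2) / n - v\<bar> \<le> t}"
  have [measurable]: "k \<in> {1..n} \<Longrightarrow> (\<lambda>\<omega>. X k \<omega> 0) \<in> borel_measurable M" for k using p1 by simp
  have meas: "(\<lambda>\<omega>. \<Sum>k=1..n. (X k \<omega> 0)\<^sup>2) \<in> borel_measurable M"
    by (intro borel_measurable_sum borel_measurable_power) auto
  note meas[measurable]
  have B: "B \<in> sets M" unfolding B_def by measurable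
  have compl: "prob (deviates t) = 1 - prob B"
  proof -
    have "deviates t = space M - B" by (auto simp: dev B_def)
    then show ?thesis using prob_compl[OF B] by simp
  qed
  have "w / K \<le> prob B"
  proof (cases "v = 0")
    case True
    have "AE \<omega> in M. X k \<omega> 0 = 0" if k: "k \<in> {1..n}" for k
    proof -
      have "AE x in distr M borel (\<lambda>\<omega>. X k \<omega> 0). x = 0"
      proof -
        have "normal_law 0 0 = return borel 0" by (simp add: normal_law_def)
        moreover have "AE x in return borel (0 :: real). x = 0" by (subst AE_return) auto
        ultimately show ?thesis unfolding law(1)[OF k] True by (simp only:)
      qed
      then show ?thesis using k by (subst (asm) AE_distr_iff) auto
    qed
    then have "AE \<omega> in M. \<forall>k\<in>{1..n}. X k \<omega> 0 = 0" by (intro AE_finite_allI) auto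
    then have "AE \<omega> in M. \<omega> \<in> B"
      using AE_space by eventually_elim (use t True in \<open>simp add: B_def\<close>)
    then have "prob B = 1" using B by (simp add: prob_eq_1)
    moreover have "w / K \<le> 1" using w K by (simp add: divide_le_eq)
    ultimately show ?thesis by simp
  next
    case False
    with v0 have v: "v > 0" by simp
    define Y where "Y k \<omega> = X k \<omega> 0 / sqrt v" for k \<omega>
    define T where "T = (\<lambda>\<omega>. \<Sum>k=1..n. (Y k \<omega>)\<^sup>2)"
    have "indep_vars (\<lambda>_. borel) (\<lambda>k \<omega>. (\<lambda>x. x 0 / sqrt v) (X k \<omega>)) {1..n}"
      using p1 by (intro indep_vars_compose2[OF indep] borel_measurable_divide measurable_component_singleton) auto
    then have indepY: "indep_vars (\<lambda>_. borel) Y {1..n}" by (simp add: Y_def[abs_def])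
    have lawY: "distr M borel (Y k) = std_normal_distribution" if k: "k \<in> {1..n}" for k
    proof -
      have "distr M borel (Y k) = distr (distr M borel (\<lambda>\<omega>. X k \<omega> 0)) borel (\<lambda>x. x / sqrt v)"
        using k by (subst distr_distr) (auto simp: comp_def Y_def[abs_def])
      also have "\<dots> = distr std_normal_distribution borel (\<lambda>z. sqrt v * z / sqrt v)"
        unfolding law(1)[OF k] normal_law_eq_distr[OF v0] by (subst distr_distr) (auto simp: comp_def)
      also have "\<dots> = distr std_normal_distribution std_normal_distribution (\<lambda>z. z)"
        using v by (intro distr_cong) auto
      finally show ?thesis by (simp add: distr_id2)
    qed
    have TX: "T \<omega> = (\<Sum>k=1..n. (X k \<omega> 0)\<^sup>2) / v" for \<omega>
      using v by (simp add: T_def Y_def power_divide sum_divide_distrib)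
    have "w / K \<le> prob {\<omega>\<in>space M. \<bar>T \<omega> - n\<bar> \<le> w * sqrt n}"
      unfolding K_def by (rule chi_square_small_ball[OF n indepY lawY T_def w])
    also have "\<dots> \<le> prob B"
    proof (intro finite_measure_mono B subsetI)
      fix \<omega> assume "\<omega> \<in> {\<omega>\<in>space M. \<bar>T \<omega> - n\<bar> \<le> w * sqrt n}"
      then have \<omega>: "\<omega> \<in> space M" "\<bar>T \<omega> - n\<bar> \<le> w * sqrt n" by auto
      have "(\<Sum>k=1..n. (X k \<omega> 0)\<^sup>2) / n - v = v / n * (T \<omega> - n)"
        using v n by (simp add: TX field_simps)
      then have "\<bar>(\<Sum>k=1..n. (X k \<omega> 0)\<^sup>2) / n - v\<bar> = v / n * \<bar>T \<omega> - n\<bar>"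
        using v by (simp add: abs_mult)
      also have "\<dots> \<le> v / n * (w * sqrt n)" using \<omega>(2) v by (intro mult_left_mono) auto
      also have "\<dots> \<le> v / n * (sqrt n * t / \<psi> * sqrt n)"
        using v by (intro mult_left_mono mult_right_mono) (auto simp: w_def)
      also have "\<dots> = v / \<psi> * t" using n by (simp add: field_simps)
      also have "\<dots> \<le> 1 * t" using v\<psi> \<psi> t by (intro mult_right_mono) auto
      finally show "\<omega> \<in> B" using \<omega>(1) by (simp add: B_def)
    qed
    finally show ?thesis .
  qed
  then show ?thesis unfolding compl K_def w_def by simp
qed

end

section \<open>Absorbing the factor two\<close>

text \<open>Here \<open>y\<close> is the target exponential and \<open>y^m\<close> the one for which the bound with factor 2 is known. Either
\<open>N y\<close> is at least 1, or \<open>2y \<le> N y\<close> is below 1 and one power of \<open>y\<close> pays for the factor.\<close>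

lemma absorb_factor_many:
  fixes y N P :: real
  assumes N: "2 \<le> N" and m: "2 \<le> m" and y: "0 \<le> y" and P: "P \<le> 1" "P \<le> N * (2 * y ^ m)"
  shows "P \<le> N * y"
proof (cases "N * y \<ge> 1")
  case True
  then show ?thesis using P by simp
next
  case False
  have "2 * y \<le> N * y" using N y by (rule mult_right_mono)
  then have y2: "2 * y \<le> 1" using False by simp
  have "y ^ m \<le> y ^ 2" using y y2 m by (intro power_decreasing) auto
  then have "2 * y ^ m \<le> (2 * y) * y" by (simp add: power2_eq_square)
  also have "\<dots> \<le> 1 * y" using y y2 by (intro mult_right_mono) auto
  finally have "N * (2 * y ^ m) \<le> N * y" using N by (intro mult_left_mono) auto
  then show ?thesis using P by simp
qed

text \<open>If \<open>P\<close> stays away from 1 by \<open>c\<close>, the factor has to be paid only where \<open>y < 1 - c\<close>, which a sufficiently high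
power achieves.\<close>

lemma absorb_factor_one:
  fixes y P c :: real
  assumes m: "2 * (1 - c) ^ (m - 1) \<le> 1" "1 \<le> m" and y: "0 \<le> y" and P: "P \<le> 1 - c" "P \<le> 2 * y ^ m"
  shows "P \<le> y"
proof (cases "y \<ge> 1 - c")
  case True
  then show ?thesis using P by simp
next
  case False
  have "2 * y ^ (m - 1) \<le> 2 * (1 - c) ^ (m - 1)" using False y by (intro mult_left_mono power_mono) auto
  then have "2 * y ^ (m - 1) \<le> 1" using m by simp
  then have "(2 * y ^ (m - 1)) * y \<le> 1 * y" using y by (rule mult_right_mono)
  moreover have "y ^ m = y ^ (m - 1) * y" using m(2) by (metis power_minus_mult Suc_le_eq One_nat_def mult.commute)
  ultimately show ?thesis using P by simp
qed

theorem corollary3p2: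
  fixes \<psi> :: real
  shows "\<exists>C1>0. \<exists>C2>0. \<forall>(p::nat) (n::nat) G \<Sigma> (M :: 'a measure) X.
    p \<ge> 1 \<longrightarrow> n \<ge> 1 \<longrightarrow>
    subgroup G (sym_grp p) \<longrightarrow>
    \<Sigma> \<in> carrier_mat p p \<longrightarrow> invariant_mat p G \<Sigma> \<longrightarrow> spectral_norm p \<Sigma> \<le> \<psi> \<longrightarrow>
    iid_gaussian_samples M p n \<Sigma> X \<longrightarrow>
    (\<forall>t>0. measure M {\<omega> \<in> space M.
          max_abs_entry p
            (frob_proj p (invariant_subspace p G) (sample_cov p n (\<lambda>k. X k \<omega>)) - \<Sigma>) > t}
        \<le> real (num_orbits p G) *
          max (exp (- C1 * real n * real (min_orbit p G) * t\<^sup>2))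
              (exp (- C2 * real n * min_orbit_deg p G * t)))"
proof -
  \<comment> \<open>a positive bound on the spectral norm, so that dividing by it is harmless\<close>
  define \<Psi> where "\<Psi> = max \<psi> 1"
  have \<Psi>: "\<Psi> > 0" "\<psi> \<le> \<Psi>" by (auto simp: \<Psi>_def)
  \<comment> \<open>the small-ball constant of the chi-square law\<close>
  define c where "c = 1 / (72 * exp (9 / 2 * exp (9 :: real)))"
  have c: "0 < c" "c \<le> 1"
    using one_le_exp_iff[of "9 / 2 * exp (9 :: real)"] by (auto simp: c_def divide_le_eq simp del: one_le_exp_iff)
  have "(\<lambda>m. (1 - c) ^ m) \<longlonglongrightarrow> 0" using c by (intro LIMSEQ_realpow_zero) auto
  then have "\<forall>\<^sub>F m in sequentially. (1 - c) ^ m < 1 / 2" by (rule order_tendstoD) simp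
  then obtain m0 where m0: "\<And>m. m \<ge> m0 \<Longrightarrow> (1 - c) ^ m < 1 / 2" by (auto simp: eventually_sequentially)
  define m where "m = m0 + 2"
  have m: "2 * (1 - c) ^ (m - 1) \<le> 1" "2 \<le> m" using m0[of "m - 1"] by (auto simp: m_def)
  define c1 where "c1 = 1 / (12 * \<Psi>\<^sup>2)"
  define c2 where "c2 = 1 / (8 * \<Psi>)"
  \<comment> \<open>dividing by \<open>m\<close> pays for the factor 2; the second entry of the minimum comes from the small-ball bound
    and matters only for \<open>p = 1\<close>\<close>
  define C1 where "C1 = min (c1 / m) (c / \<Psi>\<^sup>2)"
  define C2 where "C2 = c2 / m"
  have C: "C1 > 0" "C2 > 0" using \<Psi> c m by (auto simp: C1_def C2_def c1_def c2_def)
  show ?thesis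
  proof (rule exI[of _ C1], rule conjI[OF C(1)], rule exI[of _ C2], rule conjI[OF C(2)], intro allI impI)
    fix p n :: nat and G \<Sigma> and M :: "'a measure" and X and t :: real
    assume p: "p \<ge> 1" and n: "n \<ge> 1" and G: "subgroup G (sym_grp p)" and \<Sigma>: "\<Sigma> \<in> carrier_mat p p"
      and inv: "invariant_mat p G \<Sigma>" and norm: "spectral_norm p \<Sigma> \<le> \<psi>" and iid: "iid_gaussian_samples M p n \<Sigma> X"
      and t: "t > 0"
    define S where "S = entries \<Sigma>"
    have M: "prob_space M" using iid by (simp add: iid_gaussian_samples_def)
    have grp: "vertex_group p G" using G by (simp add: vertex_group_def)
    interpret invariant_sample p G M n S X \<Psi>
    proof (intro invariant_sample.intro gaussian_sample.intro gaussian_sample_axioms.intro invariant_sample_axioms.intro grp M p n \<Psi>(1))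
      show "prob_space.indep_vars M (\<lambda>_. Pi\<^sub>M {..<p} (\<lambda>_. borel)) X {1..n}"
        using iid by (simp add: iid_gaussian_samples_def)
      show "gaussian_vector (distr M (Pi\<^sub>M {..<p} (\<lambda>_. borel)) (X k)) p S" if "k \<in> {1..n}" for k
        unfolding S_def using iid that by (intro gaussian_vector_distr M) (auto simp: iid_gaussian_samples_def)
      show "op_bound p S \<Psi>"
        unfolding S_def using norm \<Psi> by (intro spectral_norm_op_bound \<Sigma>) auto
      show "S (g i) (g j) = S i j" if "g \<in> G" "i < p" "j < p" for g i j
        using inv that vertex_group.invariant_mat_iff[OF grp \<Sigma>] by (auto simp: S_def)
    qed
    have event: "{\<omega> \<in> space M. max_abs_entry p (frob_proj p (invariant_subspace p G) (sample_cov p n (\<lambda>k. X k \<omega>)) - \<Sigma>) > t} = deviates t"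
    proof -
      have "max_abs_entry p (frob_proj p (invariant_subspace p G) (sample_cov p n (\<lambda>k. X k \<omega>)) - \<Sigma>) > t
          \<longleftrightarrow> (\<exists>i<p. \<exists>j<p. \<bar>group_avg (emp_cov \<omega>) i j - S i j\<bar> > t)" for \<omega>
      proof -
        let ?D = "frob_proj p (invariant_subspace p G) (sample_cov p n (\<lambda>k. X k \<omega>)) - \<Sigma>"
        have entry: "?D $$ (i, j) = group_avg (emp_cov \<omega>) i j - S i j" if "i < p" "j < p" for i j
        proof -
          have "group_avg (\<lambda>a b. sample_cov p n (\<lambda>k. X k \<omega>) $$ (a, b)) i j = group_avg (emp_cov \<omega>) i j"
            unfolding group_avg_def using that less_iff
            by (intro arg_cong[of _ _ "\<lambda>x. x / _"] sum.cong refl) (auto simp: sample_cov_def emp_cov_def)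
          moreover have "sample_cov p n (\<lambda>k. X k \<omega>) \<in> carrier_mat p p" by (simp add: sample_cov_def)
          ultimately show ?thesis using that \<Sigma> by (simp add: frob_proj_eq_group_avg S_def)
        qed
        let ?E = "{\<bar>?D $$ (i, j)\<bar> | i j. i < p \<and> j < p}"
        have "?E = (\<lambda>(i, j). \<bar>?D $$ (i, j)\<bar>) ` ({..<p} \<times> {..<p})" by auto
        then have "finite ?E" by simp
        moreover have "\<bar>?D $$ (0, 0)\<bar> \<in> ?E" using p by force
        ultimately have "Max ?E > t \<longleftrightarrow> (\<exists>a\<in>?E. a > t)" by (intro Max_gr_iff) auto
        also have "\<dots> \<longleftrightarrow> (\<exists>i<p. \<exists>j<p. \<bar>?D $$ (i, j)\<bar> > t)" by blast
        also have "\<dots> \<longleftrightarrow> (\<exists>i<p. \<exists>j<p. \<bar>group_avg (emp_cov \<omega>) i j - S i j\<bar> > t)"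
          by (intro ex_cong1 conj_cong refl) (simp only: entry)
        finally show ?thesis by (simp only: max_abs_entry_def)
      qed
      then show ?thesis by (simp add: deviates_def)
    qed
    let ?x1 = "n * min_orbit p G * t\<^sup>2" and ?x2 = "n * min_orbit_deg p G * t"
    define y where "y = max (exp (- (c1 / m * ?x1))) (exp (- (c2 / m * ?x2)))"
    define y' where "y' = max (exp (- C1 * real n * real (min_orbit p G) * t\<^sup>2)) (exp (- C2 * real n * min_orbit_deg p G * t))"
    have y: "0 \<le> y" by (simp add: y_def le_max_iff_disj)
    have yy': "y \<le> y'"
    proof -
      have "C1 * ?x1 \<le> c1 / m * ?x1" by (intro mult_right_mono) (auto simp: C1_def)
      then show ?thesis unfolding y_def y'_def by (intro max.mono) (auto simp: C2_def mult.assoc)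
    qed
    have ym: "max (exp (- (1 / (12 * \<Psi>\<^sup>2)) * n * min_orbit p G * t\<^sup>2)) (exp (- (1 / (8 * \<Psi>)) * n * min_orbit_deg p G * t)) = y ^ m"
    proof -
      have e: "exp (- (a / m * x)) ^ m = exp (- a * x)" for a x :: real
        using m by (simp add: exp_of_nat_mult[symmetric])
      have pm: "(max a b) ^ m = max (a ^ m) (b ^ m)" if "0 \<le> a" "0 \<le> b" for a b :: real
        using that by (simp add: max_def power_mono antisym)
      show ?thesis unfolding y_def by (subst pm) (simp_all only: e c1_def c2_def exp_ge_zero mult.assoc of_nat_mult)
    qed
    note ub = union_bound[OF t, unfolded ym]
    have "prob (deviates t) \<le> num_orbits p G * y'"
    proof (cases "p = 1")
      case False
      then have "2 \<le> real (num_orbits p G)" using num_orbits_ge_2 p by simp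
      from absorb_factor_many[OF this m(2) y prob_le_1 ub]
      have "prob (deviates t) \<le> num_orbits p G * y" .
      also have "\<dots> \<le> num_orbits p G * y'" using yy' by (intro mult_left_mono) auto
      finally show ?thesis .
    next
      \<comment> \<open>the only case with a single orbit\<close>
      case True
      have g0: "g 0 = 0" if "g \<in> G" for g using less_iff[OF that, of 0] True by simp
      have orb0: "edge_orbit G 0 0 = {{0}}" using edge_in_orbit[of 0 0] g0 by (auto simp: edge_orbit_def)
      have N: "num_orbits p G = 1"
      proof -
        have "{edge_orbit G i j | i j. i < p \<and> j < p} = {{{0}}}" using True orb0 by auto
        then show ?thesis by (simp add: num_orbits_def)
      qed
      have O: "min_orbit p G \<le> 1" using min_orbit_le[of 0 0] True orb0 by simp
      note sb = one_vertex_small_ball[OF True t]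
      have "prob (deviates t) \<le> y'"
      proof (cases "sqrt n * t \<le> \<Psi>")
        case small: True
        then have eq: "min 1 (sqrt n * t / \<Psi>) = sqrt n * t / \<Psi>" using \<Psi> by (intro min_absorb2) simp
        have "prob (deviates t) \<le> 1 - c * (sqrt n * t / \<Psi>)"
          using sb unfolding eq by (simp add: c_def mult.commute)
        also have "\<dots> \<le> 1 - c * (sqrt n * t / \<Psi>)\<^sup>2"
        proof -
          have "(sqrt n * t / \<Psi>)\<^sup>2 \<le> sqrt n * t / \<Psi>"
            unfolding power2_eq_square using small \<Psi> t by (intro mult_left_le) auto
          then have "c * (sqrt n * t / \<Psi>)\<^sup>2 \<le> c * (sqrt n * t / \<Psi>)" using c by (intro mult_left_mono) auto
          then show ?thesis by linarith
        qed
        also have "\<dots> = 1 + - (c / \<Psi>\<^sup>2 * (n * t\<^sup>2))" by (simp add: power_mult_distrib power_divide)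
        also have "\<dots> \<le> exp (- (c / \<Psi>\<^sup>2 * (n * t\<^sup>2)))" by (rule exp_ge_add_one_self)
        also have "\<dots> \<le> exp (- (C1 * ?x1))"
        proof -
          have "n * min_orbit p G \<le> n * 1" using O by (intro mult_left_mono) auto
          then have "real (n * min_orbit p G) \<le> real (n * 1)" by (simp only: of_nat_le_iff)
          then have x1: "?x1 \<le> n * t\<^sup>2" by (intro mult_right_mono) auto
          have "C1 * ?x1 \<le> c / \<Psi>\<^sup>2 * (n * t\<^sup>2)"
          proof (rule mult_mono[OF _ x1])
            show "C1 \<le> c / \<Psi>\<^sup>2" by (simp add: C1_def)
          qed (use c in simp_all)
          then show ?thesis by simp
        qed
        also have "\<dots> \<le> y'" unfolding y'_def by (simp add: mult.assoc)
        finally show ?thesis .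
      next
        case False
        then have eq: "min 1 (sqrt n * t / \<Psi>) = 1" using \<Psi> by (intro min_absorb1) simp
        have "prob (deviates t) \<le> 1 - c"
          using sb unfolding eq by (simp add: c_def)
        moreover have "prob (deviates t) \<le> 2 * y ^ m" using ub by (simp add: N)
        ultimately have "prob (deviates t) \<le> y"
          using m(2) by (intro absorb_factor_one[OF m(1) _ y]) simp_all
        with yy' show ?thesis by simp
      qed
      then show ?thesis by (simp add: N)
    qed
    then show "measure M {\<omega> \<in> space M. t < max_abs_entry p (frob_proj p (invariant_subspace p G) (sample_cov p n (\<lambda>k. X k \<omega>)) - \<Sigma>)}
        \<le> real (num_orbits p G) * max (exp (- C1 * real n * real (min_orbit p G) * t\<^sup>2)) (exp (- C2 * real n * min_orbit_deg p G * t))"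
      unfolding event y'_def .
  qed
qed

end
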